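(* Let $s\ge 0$ and $0\le\sigma<\frac12$. For each choice of sign $\pm$ and every $\varepsilon>0$ there is a constant $c$ such that for all $u$, $n_\pm$ for which the right-hand side is finite $$\|u\,n_{\pm}\|_{X^{s,-\frac12-\varepsilon}}\le c\Big(\|u\|_{X^{0,\frac12+\varepsilon}}\|n_\pm\|_{X_\pm^{s-\frac12,\frac12+\varepsilon}}+\|u\|_{X^{s-\sigma,0}}\|n_\pm\|_{X_\pm^{\sigma+\frac12+\varepsilon,\frac12+\varepsilon}}\Big).$$ The same estimate holds if $u$ and/or $n_\pm$ are replaced by their complex conjugates $\overline u$ and/or $\overline{n}_\pm$ on the left-hand side and/or on the right-hand side (keeping the same spaces).
   Context: Functions are defined on $\mathbb R^3\times\mathbb R\ni(x,t)$; $\langle\lambda\rangle=(1+|\lambda|^2)^{1/2}$. For a real function $\varphi$ on $\mathbb R^3$, $X^{s,b}_\varphi$ is the completion of the Schwartz space $\mathcal S(\mathbb R^4)$ with respect to $$\|f\|_{X^{s,b}_\varphi}=\|\langle\xi\rangle^s\langle\tau+\varphi(\xi)\rangle^b\widehat f(\xi,\tau)\|_{L^2_{\xi\tau}},$$ where $\widehat f$ is the space-time Fourier transform (with kernel $e^{-i(x\cdot\xi+t\tau)}$). $X^{s,b}$ denotes the case $\varphi(\xi)=|\xi|^2$, and $X^{s,b}_\pm$ the case $\varphi(\xi)=\pm\langle\xi\rangle$. Products are understood as continuous extensions of the pointwise product of Schwartz functions. *)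

theory Defs
  imports "HOL-Analysis.Analysis"
begin

type_synonym spacetime = "(real^3) \<times> real"

definition japanese :: "'a::real_normed_vector \<Rightarrow> real" where
  "japanese x = sqrt (1 + (norm x)\<^sup>2)"


section \<open>Schwartz functions and the Fourier transform\<close>

primrec partial_derivs :: "'a list \<Rightarrow> ('a::euclidean_space \<Rightarrow> complex) \<Rightarrow> 'a \<Rightarrow> complex" where
  "partial_derivs [] f = f"
| "partial_derivs (i # is) f = partial_derivs is (\<lambda>x. frechet_derivative f (at x) i)"

definition schwartz :: "('a::euclidean_space \<Rightarrow> complex) \<Rightarrow> bool" where
  "schwartz f \<longleftrightarrow>
     (\<forall>is. set is \<subseteq> Basis \<longrightarrow>
        partial_derivs is f differentiable_on UNIV \<and>
        (\<forall>k::nat. bounded (range (\<lambda>x. norm x ^ k *\<^sub>R partial_derivs is f x))))"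

text \<open>On \<^typ>\<open>spacetime\<close> the inner product of \<open>(x, t)\<close> and \<open>(\<xi>, \<tau>)\<close> is \<open>x \<bullet> \<xi> + t * \<tau>\<close>.\<close>

definition fourier :: "('a::euclidean_space \<Rightarrow> complex) \<Rightarrow> 'a \<Rightarrow> complex" where
  "fourier f \<zeta> = (LINT z|lborel. cis (- (z \<bullet> \<zeta>)) * f z)"


section \<open>The spaces $X^{s,b}_\varphi$\<close>

text \<open>For Schwartz \<open>f\<close> and \<open>\<phi>\<close> of polynomial growth, as is the case for the two
  phase functions below, the integrand is integrable.\<close>

definition schwartz_X_norm ::
    "(real^3 \<Rightarrow> real) \<Rightarrow> real \<Rightarrow> real \<Rightarrow> (spacetime \<Rightarrow> complex) \<Rightarrow> real" where
  "schwartz_X_norm \<phi> s b f =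
     sqrt (LINT (\<xi>, \<tau>)|lborel.
       (japanese \<xi> powr s * japanese (\<tau> + \<phi> \<xi>) powr b * cmod (fourier f (\<xi>, \<tau>)))\<^sup>2)"

text \<open>The completion is realised inside the tempered distributions, so that elements of
  different spaces can be compared and intersections make sense. A distribution is a functional
  on test functions of which only the values on Schwartz functions matter. \<open>X_tendsto \<phi> s b f u\<close>
  says that the Schwartz functions \<open>f k\<close> form a Cauchy sequence for the \<open>X\<close>-norm whose
  element of the completion is \<open>u\<close>, i.e. that \<open>f k\<close> converges to \<open>u\<close> in the space.
  Linearity and continuity of \<open>u\<close> on Schwartz functions follow.\<close>

type_synonym distribution = "(spacetime \<Rightarrow> complex) \<Rightarrow> complex"

definition X_tendsto ::
    "(real^3 \<Rightarrow> real) \<Rightarrow> real \<Rightarrow> real \<Rightarrow> (nat \<Rightarrow> spacetime \<Rightarrow> complex) \<Rightarrow> distribution \<Rightarrow> bool" where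
  "X_tendsto \<phi> s b f u \<longleftrightarrow>
     (\<forall>k. schwartz (f k)) \<and>
     (\<forall>e>0. \<exists>N. \<forall>j\<ge>N. \<forall>k\<ge>N. schwartz_X_norm \<phi> s b (\<lambda>z. f j z - f k z) < e) \<and>
     (\<forall>\<psi>. schwartz \<psi> \<longrightarrow> (\<lambda>k. LINT z|lborel. f k z * \<psi> z) \<longlonglongrightarrow> u \<psi>)"

definition X_space :: "(real^3 \<Rightarrow> real) \<Rightarrow> real \<Rightarrow> real \<Rightarrow> distribution set" where
  "X_space \<phi> s b = {u. \<exists>f. X_tendsto \<phi> s b f u}"

definition X_norm :: "(real^3 \<Rightarrow> real) \<Rightarrow> real \<Rightarrow> real \<Rightarrow> distribution \<Rightarrow> real" where
  "X_norm \<phi> s b u =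
     (THE r. \<exists>f. X_tendsto \<phi> s b f u \<and> (\<lambda>k. schwartz_X_norm \<phi> s b (f k)) \<longlonglongrightarrow> r)"

definition phase_S :: "real^3 \<Rightarrow> real" where
  "phase_S \<xi> = (norm \<xi>)\<^sup>2"

definition phase_KG :: "real \<Rightarrow> real^3 \<Rightarrow> real" where
  "phase_KG pm \<xi> = pm * japanese \<xi>"


section \<open>Conjugates and products\<close>

definition conj_if :: "bool \<Rightarrow> (spacetime \<Rightarrow> complex) \<Rightarrow> spacetime \<Rightarrow> complex" where
  "conj_if c f = (if c then (\<lambda>z. cnj (f z)) else f)"

definition dconj_if :: "bool \<Rightarrow> distribution \<Rightarrow> distribution" where
  "dconj_if c u = (if c then (\<lambda>\<psi>. cnj (u (\<lambda>z. cnj (\<psi> z)))) else u)"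

text \<open>Value of the continuous extension of the map sending Schwartz functions \<open>f, g\<close> to the
  pointwise product of \<open>f\<close> or its conjugate (if \<open>c\<close>) and \<open>g\<close> or its conjugate (if \<open>d\<close>).
  \<open>U\<close> and \<open>V\<close> are the sequences of Schwartz functions converging to the two arguments,
  and \<open>W h w\<close> says that \<open>h\<close> converges to \<open>w\<close> in the target space: \<open>w\<close> is the limit of the
  products for every choice of approximating sequences, and such sequences exist.\<close>

definition extended_product ::
    "(nat \<Rightarrow> spacetime \<Rightarrow> complex) set \<Rightarrow> (nat \<Rightarrow> spacetime \<Rightarrow> complex) set \<Rightarrow>
     ((nat \<Rightarrow> spacetime \<Rightarrow> complex) \<Rightarrow> distribution \<Rightarrow> bool) \<Rightarrow> bool \<Rightarrow> bool \<Rightarrow> distribution \<Rightarrow> bool" where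
  "extended_product U V W c d w \<longleftrightarrow>
     U \<noteq> {} \<and> V \<noteq> {} \<and>
     (\<forall>f\<in>U. \<forall>g\<in>V. W (\<lambda>k z. conj_if c (f k) z * conj_if d (g k) z) w)"

end

theory Submission
  imports Defs "HOL-Probability.Probability"
begin

text \<open>
  The weights $\langle\xi\rangle^s \langle\tau+\varphi(\xi)\rangle^b$ and their inverses are smooth and grow at
  most polynomially together with all derivatives, so multiplication by them preserves Schwartz
  functions. Therefore a Cauchy sequence in a space \<open>X\<close> is controlled by its pairings with Schwartz
  functions: two sequences with the same distributional limit approach each other in norm, and
  sequences for two different spaces can be merged into one. This reduces the theorem to a
  bilinear bound for Schwartz functions.

  On the Fourier side the product is a convolution, $\xi = \xi_1 + \xi_2$ with $\xi_1$ the frequency of \<open>u\<close>. If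
  $8|\xi_1| \le |\xi_2|$, the identity for the sum of the three modulations forces one of them to be at
  least of order $\langle\xi_2\rangle^2$. As it enters with a power of at least $1/2$, this gains a factor
  $\langle\xi_2\rangle^{-1}$ and leads to the first term on the right. Otherwise $\langle\xi\rangle$ is bounded by a
  multiple of $\langle\xi_1\rangle$, and the second term suffices. In each region the Cauchy--Schwarz inequality
  leaves the integral of a squared kernel with one of the three frequencies fixed. Integrating in
  time merges two modulation weights into one, and what remains is an integral over a
  neighbourhood of a sphere or of a slab, bounded by averaging over dilations or translations.
\<close>

section \<open>Smooth functions of controlled growth\<close>

text \<open>Where |\<xi>2| dominates, the gained bracket of \<xi>2 is spent in two halves. One half
  lowers the exponent on the second factor from s to s - 1/2. The other leaves a power -1/2 of a
  bracket in the kernel. Its square cuts the Jacobian \<open>\<mu>\<^sup>2\<close> of dilations in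
  dimension three down to \<mu>, which is the size of the derivative of a quadratic phase along a
  ray, so a substitution bounds the integral of the modulation weight uniformly in the fixed
  frequency and in the constant part of the phase. In the slab estimates the cross section is
  balanced against the derivative of the phase in the same way. The Klein-Gordon phase has slope at
  most 1 and only perturbs these derivatives, which is why both signs and all conjugates are covered
  by one argument with parameters \<alpha> and \<beta>. Each summand on the right multiplies norms
  of the same two functions in different spaces. An approximating sequence is therefore usable only
  if it converges in both spaces of its factor at once, and this is what forces the merging of
  sequences.\<close>

abbreviation pd :: "'a::euclidean_space \<Rightarrow> ('a \<Rightarrow> complex) \<Rightarrow> 'a \<Rightarrow> complex" where
  "pd i f \<equiv> (\<lambda>x. frechet_derivative f (at x) i)"

text \<open>The growth condition is a parameter, so that stability under sums and products is proved
  once for rapid decay and for polynomial growth.\<close>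

definition smooth_in :: "(('a::euclidean_space \<Rightarrow> complex) \<Rightarrow> bool) \<Rightarrow> ('a \<Rightarrow> complex) \<Rightarrow> bool" where
  "smooth_in B f \<longleftrightarrow> (\<forall>is. set is \<subseteq> Basis \<longrightarrow>
     partial_derivs is f differentiable_on UNIV \<and> B (partial_derivs is f))"

definition rapid :: "('a::real_normed_vector \<Rightarrow> complex) \<Rightarrow> bool" where
  "rapid f \<longleftrightarrow> (\<forall>k::nat. bounded (range (\<lambda>x. norm x ^ k *\<^sub>R f x)))"

definition polybdd :: "('a::real_normed_vector \<Rightarrow> complex) \<Rightarrow> bool" where
  "polybdd f \<longleftrightarrow> (\<exists>(k::nat) C. \<forall>x. cmod (f x) \<le> C * (1 + norm x) ^ k)"

abbreviation slow :: "('a::euclidean_space \<Rightarrow> complex) \<Rightarrow> bool" where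
  "slow \<equiv> smooth_in polybdd"

lemma schwartz_iff: "schwartz f \<longleftrightarrow> smooth_in rapid f"
  by (simp add: schwartz_def smooth_in_def rapid_def)

text \<open>\<open>partial_derivs\<close> differentiates by the head of the list first, so a class
  of functions stable under every \<open>pd i\<close> contains all iterated derivatives. Later
  smoothness proofs only have to exhibit such a class.\<close>

lemma smooth_in_coinduct:
  assumes "P f" and diff: "\<And>f. P f \<Longrightarrow> f differentiable_on UNIV" and B: "\<And>f. P f \<Longrightarrow> B f"
    and pd: "\<And>f i. P f \<Longrightarrow> i \<in> Basis \<Longrightarrow> P (pd i f)"
  shows "smooth_in B f"
proof -
  have "set is \<subseteq> Basis \<Longrightarrow> P f \<Longrightarrow> P (partial_derivs is f)" for "is" f
    by (induction "is" arbitrary: f) (auto intro: pd)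
  with assms show ?thesis unfolding smooth_in_def by blast
qed

lemma smooth_in_differentiable: "smooth_in B f \<Longrightarrow> f differentiable (at x)"
  unfolding smooth_in_def by (drule spec[of _ "[]"]) (simp add: differentiable_on_def)

lemma smooth_in_has_derivative:
  "smooth_in B f \<Longrightarrow> (f has_derivative frechet_derivative f (at x)) (at x)"
  using smooth_in_differentiable frechet_derivative_works by blast

lemma smooth_in_D: "smooth_in B f \<Longrightarrow> B f"
  unfolding smooth_in_def by (drule spec[of _ "[]"]) simp

lemma smooth_in_pd: "smooth_in B (f :: 'a::euclidean_space \<Rightarrow> complex) \<Longrightarrow> i \<in> Basis \<Longrightarrow> smooth_in B (pd i f)"
  unfolding smooth_in_def
proof (intro allI impI)
  fix "is" :: "'a list"
  assume *: "\<forall>is. set is \<subseteq> Basis \<longrightarrow>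
     partial_derivs is f differentiable_on UNIV \<and> B (partial_derivs is f)" and "i \<in> Basis" "set is \<subseteq> Basis"
  then show "partial_derivs is (pd i f) differentiable_on UNIV \<and> B (partial_derivs is (pd i f))"
    using *[rule_format, of "i # is"] by simp
qed

lemma smooth_in_continuous: "smooth_in B f \<Longrightarrow> continuous_on UNIV f"
  by (meson continuous_at_imp_continuous_on differentiable_imp_continuous_within smooth_in_differentiable)

lemma smooth_in_measurable: "smooth_in B f \<Longrightarrow> f \<in> borel_measurable borel"
  by (simp add: borel_measurable_continuous_onI smooth_in_continuous)

lemma pd_eqI: "(\<And>x. (f has_derivative D x) (at x)) \<Longrightarrow> pd i f = (\<lambda>x. D x i)"
  using frechet_derivative_at by metis

lemma pd_add:
  assumes "\<And>x. f differentiable (at x)" "\<And>x. g differentiable (at x)"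
  shows "pd i (\<lambda>x. f x + g x) = (\<lambda>x. pd i f x + pd i g x)"
  using assms by (intro pd_eqI has_derivative_add) (auto simp: frechet_derivative_works)

lemma pd_mult:
  assumes "\<And>x. f differentiable (at x)" "\<And>x. g differentiable (at x)"
  shows "pd i (\<lambda>x. f x * g x) = (\<lambda>x. f x * pd i g x + pd i f x * g x)"
  using assms by (intro pd_eqI has_derivative_mult) (auto simp: frechet_derivative_works)

lemma smooth_in_add:
  assumes "smooth_in B f" "smooth_in B g" and B: "\<And>f g. B f \<Longrightarrow> B g \<Longrightarrow> B (\<lambda>x. f x + g x)"
  shows "smooth_in B (\<lambda>x. f x + g x)"
proof (rule smooth_in_coinduct[where P="\<lambda>h. \<exists>f g. smooth_in B f \<and> smooth_in B g \<and> h = (\<lambda>x. f x + g x)"])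
  fix h i assume "\<exists>f g. smooth_in B f \<and> smooth_in B g \<and> h = (\<lambda>x. f x + g x)" "(i::'a) \<in> Basis"
  then obtain f g where h: "smooth_in B f" "smooth_in B g" "h = (\<lambda>x. f x + g x)" by blast
  then have "pd i h = (\<lambda>x. pd i f x + pd i g x)"
    using pd_add smooth_in_differentiable by blast
  then show "\<exists>f g. smooth_in B f \<and> smooth_in B g \<and> pd i h = (\<lambda>x. f x + g x)"
    using h smooth_in_pd \<open>i \<in> Basis\<close> by blast
qed (use assms in \<open>auto simp: differentiable_on_def smooth_in_differentiable differentiable_add dest:
    smooth_in_D\<close>)

text \<open>By the Leibniz rule single products are not stable under differentiation, but finite
  sums of products are. This is the class fed to \<open>smooth_in_coinduct\<close>.\<close>

inductive prodsum :: "(('a::euclidean_space \<Rightarrow> complex) \<Rightarrow> bool) \<Rightarrow> (('a \<Rightarrow> complex) \<Rightarrow> bool) \<Rightarrow> ('a \<Rightarrow> complex)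
    \<Rightarrow> bool"
  for A B where
  prod: "A f \<Longrightarrow> B g \<Longrightarrow> prodsum A B (\<lambda>x. f x * g x)"
| sum: "prodsum A B f \<Longrightarrow> prodsum A B g \<Longrightarrow> prodsum A B (\<lambda>x. f x + g x)"

lemma smooth_in_mult:
  assumes f: "smooth_in B1 f" and g: "smooth_in B2 g"
    and mult: "\<And>f g. B1 f \<Longrightarrow> B2 g \<Longrightarrow> B3 (\<lambda>x. f x * g x)"
    and add: "\<And>f g. B3 f \<Longrightarrow> B3 g \<Longrightarrow> B3 (\<lambda>x. f x + g x)"
  shows "smooth_in B3 (\<lambda>x. f x * g x)"
proof (rule smooth_in_coinduct[where P="prodsum (smooth_in B1) (smooth_in B2)"])
  show "prodsum (smooth_in B1) (smooth_in B2) (\<lambda>x. f x * g x)"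
    using f g by (rule prodsum.prod)
  show diff: "g differentiable_on UNIV" if "prodsum (smooth_in B1) (smooth_in B2) g" for g
    using that by induction
      (auto simp: differentiable_on_def differentiable_add differentiable_mult smooth_in_differentiable)
  show "B3 g" if "prodsum (smooth_in B1) (smooth_in B2) g" for g
    using that by induction (auto intro: mult add dest: smooth_in_D)
  show "prodsum (smooth_in B1) (smooth_in B2) (pd i g)"
    if "prodsum (smooth_in B1) (smooth_in B2) g" "i \<in> Basis" for g i
    using that
  proof induction
    case (prod f g)
    have "pd i (\<lambda>x. f x * g x) = (\<lambda>x. f x * pd i g x + pd i f x * g x)"
      using prod by (intro pd_mult) (auto intro: smooth_in_differentiable)
    moreover have "prodsum (smooth_in B1) (smooth_in B2) (\<lambda>x. f x * pd i g x + pd i f x * g x)"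
      using prod by (intro prodsum.sum prodsum.prod smooth_in_pd)
    ultimately show ?case by simp
  next
    case (sum f g)
    then have "pd i (\<lambda>x. f x + g x) = (\<lambda>x. pd i f x + pd i g x)"
      using diff unfolding differentiable_on_def by (intro pd_add) simp_all
    then show ?case using sum by (simp add: prodsum.sum)
  qed
qed


section \<open>Polynomial growth and rapid decay\<close>

lemma polybddI: "(\<And>x. cmod (f x) \<le> C * (1 + norm x) ^ k) \<Longrightarrow> polybdd f"
  unfolding polybdd_def by blast

lemma polybddE:
  assumes "polybdd f"
  obtains k :: nat and C where "C \<ge> 0" "\<And>x. cmod (f x) \<le> C * (1 + norm x) ^ k"
proof -
  obtain k C where C: "\<And>x. cmod (f x) \<le> C * (1 + norm x) ^ k" using assms unfolding polybdd_def by blast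
  have "0 \<le> cmod (f 0)" by simp
  also have "\<dots> \<le> C" using C[of 0] by simp
  finally show ?thesis using C that by blast
qed

lemma polybdd_add: "polybdd f \<Longrightarrow> polybdd g \<Longrightarrow> polybdd (\<lambda>x. f x + g x)"
proof -
  assume "polybdd f" "polybdd g"
  then obtain k C l D where C: "C \<ge> 0" "\<And>x. cmod (f x) \<le> C * (1 + norm x) ^ k"
    and D: "D \<ge> 0" "\<And>x. cmod (g x) \<le> D * (1 + norm x) ^ l" by (metis polybddE)
  show ?thesis
  proof (rule polybddI)
    fix x
    have "cmod (f x + g x) \<le> C * (1 + norm x) ^ k + D * (1 + norm x) ^ l"
      using C(2) D(2) by (intro norm_triangle_le add_mono)
    also have "\<dots> \<le> C * (1 + norm x) ^ (k + l) + D * (1 + norm x) ^ (k + l)"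
      using C(1) D(1) by (intro add_mono mult_left_mono power_increasing) auto
    finally show "cmod (f x + g x) \<le> (C + D) * (1 + norm x) ^ (k + l)"
      by (simp add: algebra_simps)
  qed
qed

lemma polybdd_mult: "polybdd f \<Longrightarrow> polybdd g \<Longrightarrow> polybdd (\<lambda>x. f x * g x)"
proof -
  assume "polybdd f" "polybdd g"
  then obtain k C l D where C: "C \<ge> 0" "\<And>x. cmod (f x) \<le> C * (1 + norm x) ^ k"
    and D: "D \<ge> 0" "\<And>x. cmod (g x) \<le> D * (1 + norm x) ^ l" by (metis polybddE)
  show ?thesis
  proof (rule polybddI)
    fix x
    have "cmod (f x * g x) \<le> (C * (1 + norm x) ^ k) * (D * (1 + norm x) ^ l)"
      unfolding norm_mult using C D by (intro mult_mono) auto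
    then show "cmod (f x * g x) \<le> (C * D) * (1 + norm x) ^ (k + l)"
      by (simp add: power_add mult_ac)
  qed
qed

lemma rapid_add: "rapid f \<Longrightarrow> rapid g \<Longrightarrow> rapid (\<lambda>x. f x + g x)"
  unfolding rapid_def scaleR_add_right by (intro allI bounded_plus_comp) (erule allE, assumption)+

text \<open>The binomial expansion of \<open>(1 + norm x) ^ k\<close> combines the separate bounds
  for the powers of \<open>norm x\<close>.\<close>

lemma rapidE:
  assumes "rapid f"
  obtains C where "C \<ge> 0" "\<And>x. cmod (f x) * (1 + norm x) ^ k \<le> C"
proof -
  have 1: "bounded (range (\<lambda>x. norm x ^ j *\<^sub>R f x))" for j
    using assms unfolding rapid_def by blast
  have "\<exists>D. \<forall>x. norm x ^ j * cmod (f x) \<le> D" for j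
    using 1[of j] by (auto simp: bounded_iff)
  then obtain D where D: "\<And>x j. norm x ^ j * cmod (f x) \<le> D j" by metis
  let ?C = "\<Sum>j\<le>k. (k choose j) * D j"
  have C: "cmod (f x) * (1 + norm x) ^ k \<le> ?C" for x
  proof -
    have "cmod (f x) * (1 + norm x) ^ k = (\<Sum>j\<le>k. (k choose j) * (norm x ^ j * cmod (f x)))"
      by (subst add.commute, subst binomial_ring) (simp add: sum_distrib_left mult_ac)
    also have "\<dots> \<le> ?C"
      by (intro sum_mono mult_left_mono D) auto
    finally show ?thesis .
  qed
  moreover have "0 \<le> ?C" using C[of 0] norm_ge_zero[of "f 0"] by (simp del: norm_ge_zero)
  ultimately show ?thesis using that by blast
qed

lemma rapidI:
  assumes "\<And>k. \<exists>C. \<forall>x. cmod (f x) * norm x ^ k \<le> C"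
  shows "rapid f"
  unfolding rapid_def
proof
  fix k :: nat
  obtain C where "\<And>x. cmod (f x) * norm x ^ k \<le> C" using assms by blast
  then show "bounded (range (\<lambda>x. norm x ^ k *\<^sub>R f x))"
    by (intro boundedI[where B=C]) (auto simp: mult.commute)
qed

lemma rapid_polybdd_mult:
  assumes "polybdd f" "rapid g" shows "rapid (\<lambda>x. f x * g x)"
proof (rule rapidI)
  fix k :: nat
  obtain l C where C: "C \<ge> 0" "\<And>x. cmod (f x) \<le> C * (1 + norm x) ^ l"
    using assms polybddE by metis
  obtain D where D: "\<And>x. cmod (g x) * (1 + norm x) ^ (l + k) \<le> D" using assms rapidE by metis
  have "cmod (f x * g x) * norm x ^ k \<le> C * D" for x
  proof -
    have "cmod (f x * g x) * norm x ^ k \<le> (C * (1 + norm x) ^ l) * cmod (g x) * (1 + norm x) ^ k"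
      unfolding norm_mult using C by (intro mult_mono power_mono) auto
    also have "\<dots> = C * (cmod (g x) * (1 + norm x) ^ (l + k))" by (simp add: power_add)
    also have "\<dots> \<le> C * D" using C D by (intro mult_left_mono)
    finally show ?thesis .
  qed
  then show "\<exists>C. \<forall>x. cmod (f x * g x) * norm x ^ k \<le> C" by blast
qed

lemma rapid_imp_polybdd: "rapid f \<Longrightarrow> polybdd f"
proof -
  assume "rapid f"
  then obtain C where "\<And>x. cmod (f x) * (1 + norm x) ^ 0 \<le> C" using rapidE[where k=0] by metis
  then show "polybdd f" by (intro polybddI[where C=C and k=0]) simp
qed

lemma smooth_in_mono: "smooth_in B f \<Longrightarrow> (\<And>f. B f \<Longrightarrow> B' f) \<Longrightarrow> smooth_in B' f"
  unfolding smooth_in_def by blast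

lemma schwartz_imp_slow: "schwartz f \<Longrightarrow> slow f"
  unfolding schwartz_iff by (erule smooth_in_mono) (rule rapid_imp_polybdd)

lemma slow_add: "slow f \<Longrightarrow> slow g \<Longrightarrow> slow (\<lambda>x. f x + g x)"
  by (rule smooth_in_add) (auto intro: polybdd_add)

lemma slow_mult: "slow f \<Longrightarrow> slow g \<Longrightarrow> slow (\<lambda>x. f x * g x)"
  by (erule (1) smooth_in_mult) (auto intro: polybdd_add polybdd_mult)

lemma schwartz_slow_mult: "slow f \<Longrightarrow> schwartz g \<Longrightarrow> schwartz (\<lambda>x. f x * g x)"
  unfolding schwartz_iff by (erule (1) smooth_in_mult) (auto intro: rapid_add rapid_polybdd_mult)

lemma schwartz_add: "schwartz f \<Longrightarrow> schwartz g \<Longrightarrow> schwartz (\<lambda>x. f x + g x)"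
  unfolding schwartz_iff by (rule smooth_in_add) (auto intro: rapid_add)

lemma slow_const: "slow (\<lambda>x. c)"
proof (rule smooth_in_coinduct[where P="\<lambda>f. \<exists>c. f = (\<lambda>x. c)"])
  fix f :: "'a \<Rightarrow> complex" assume "\<exists>c. f = (\<lambda>x. c)"
  then obtain c where "f = (\<lambda>x. c)" by blast
  then show "polybdd f" by (intro polybddI[where C="cmod c" and k=0]) simp
qed (auto simp: frechet_derivative_const)

text \<open>The derivative of a linear form is constant, so the stable class consists of this one
  function together with everything already known to be slow.\<close>

lemma slow_inner: "slow (\<lambda>x. complex_of_real (x \<bullet> v))"
proof (rule smooth_in_coinduct[where P="\<lambda>f. slow f \<or> f = (\<lambda>x. complex_of_real (x \<bullet> v))"])
  fix f :: "'a \<Rightarrow> complex" and i :: 'a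
  have der: "((\<lambda>x. complex_of_real (x \<bullet> v)) has_derivative (\<lambda>h. complex_of_real (h \<bullet> v))) (at x)" for x
    by (intro derivative_intros)
  assume f: "slow f \<or> f = (\<lambda>x. complex_of_real (x \<bullet> v))"
  then show "f differentiable_on UNIV"
    using der by (auto simp: differentiable_on_def differentiable_def intro: smooth_in_has_derivative)
  show "polybdd f"
    using f
  proof
    assume *: "f = (\<lambda>x. complex_of_real (x \<bullet> v))"
    show ?thesis
    proof (rule polybddI)
      fix x
      have "\<bar>x \<bullet> v\<bar> \<le> norm x * norm v" by (rule Cauchy_Schwarz_ineq2)
      also have "\<dots> \<le> norm v * (1 + norm x) ^ 1" by (simp add: algebra_simps)
      finally show "cmod (f x) \<le> norm v * (1 + norm x) ^ 1" using * by simp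
    qed
  qed (auto dest: smooth_in_D)
  assume i: "i \<in> Basis"
  show "slow (pd i f) \<or> pd i f = (\<lambda>x. complex_of_real (x \<bullet> v))"
    using f
  proof
    assume "f = (\<lambda>x. complex_of_real (x \<bullet> v))"
    then have "pd i f = (\<lambda>x. complex_of_real (i \<bullet> v))"
      using pd_eqI[OF der] by simp
    then show ?thesis using slow_const by metis
  qed (use i smooth_in_pd in blast)
qed simp

lemma slow_sum: "(\<And>i. i \<in> I \<Longrightarrow> slow (f i)) \<Longrightarrow> slow (\<lambda>x. \<Sum>i\<in>I. f i x)"
  by (induction I rule: infinite_finite_induct) (auto intro: slow_const slow_add)

lemma schwartz_cmult: "schwartz f \<Longrightarrow> schwartz (\<lambda>x. c * f x)"
  by (rule schwartz_slow_mult[OF slow_const])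

lemma schwartz_diff: "schwartz f \<Longrightarrow> schwartz g \<Longrightarrow> schwartz (\<lambda>x. f x - g x)"
  using schwartz_add[OF _ schwartz_cmult[where c="-1"]] by fastforce

lemma schwartz_mult: "schwartz f \<Longrightarrow> schwartz g \<Longrightarrow> schwartz (\<lambda>x. f x * g x)"
  by (intro schwartz_slow_mult schwartz_imp_slow)

lemma schwartz_cnj: "schwartz f \<Longrightarrow> schwartz (\<lambda>x. cnj (f x))"
  unfolding schwartz_iff
proof (rule smooth_in_coinduct[where P="\<lambda>g. \<exists>f. smooth_in rapid f \<and> g = (\<lambda>x. cnj (f x))"])
  fix g :: "'a \<Rightarrow> complex" and i :: 'a assume "\<exists>f. smooth_in rapid f \<and> g = (\<lambda>x. cnj (f x))"
  then obtain f where f: "smooth_in rapid f" and g: "g = (\<lambda>x. cnj (f x))" by blast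
  have der: "(g has_derivative (\<lambda>h. cnj (frechet_derivative f (at x) h))) (at x)" for x
    unfolding g using smooth_in_has_derivative[OF f] by (intro has_derivative_cnj)
  then show "g differentiable_on UNIV" by (auto simp: differentiable_on_def differentiable_def)
  have "rapid f" using f by (rule smooth_in_D)
  then show "rapid g" unfolding rapid_def g by (auto simp: bounded_iff)
  show "i \<in> Basis \<Longrightarrow> \<exists>f. smooth_in rapid f \<and> pd i g = (\<lambda>x. cnj (f x))"
    using pd_eqI[OF der] smooth_in_pd[OF f] by blast
qed blast

lemma schwartz_reflect: "schwartz f \<Longrightarrow> schwartz (\<lambda>x. f (- x))"
  unfolding schwartz_iff
proof (rule smooth_in_coinduct[where P="\<lambda>g. \<exists>f. smooth_in rapid f \<and> g = (\<lambda>x. f (- x))"])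
  fix g :: "'a \<Rightarrow> complex" and i :: 'a assume "\<exists>f. smooth_in rapid f \<and> g = (\<lambda>x. f (- x))"
  then obtain f where f: "smooth_in rapid f" and g: "g = (\<lambda>x. f (- x))" by blast
  have der: "(g has_derivative (\<lambda>h. frechet_derivative f (at (- x)) (- h))) (at x)" for x
    unfolding g
    by (rule has_derivative_compose[where f="\<lambda>x. - x"
        and g=f]) (auto intro!: derivative_eq_intros smooth_in_has_derivative[OF f])
  then show "g differentiable_on UNIV" by (auto simp: differentiable_on_def differentiable_def)
  have "rapid f" using f by (rule smooth_in_D)
  then show "rapid g" unfolding rapid_def g bounded_iff
      by (metis (no_types, lifting) norm_minus_cancel rangeE rangeI)
  assume i: "i \<in> Basis"
  have "pd i g = (\<lambda>x. (-1) * pd i f (- x))"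
    using pd_eqI[OF der, of i] linear_neg[OF has_derivative_linear[OF smooth_in_has_derivative[OF f]]] by simp
  moreover have "smooth_in rapid (\<lambda>x. (-1) * pd i f x)"
    using schwartz_cmult[of "pd i f" "-1"] smooth_in_pd[OF f i] unfolding schwartz_iff by blast
  ultimately show "\<exists>f. smooth_in rapid f \<and> pd i g = (\<lambda>x. f (- x))" by blast
qed blast

text \<open>Differentiating \<open>q powr a\<close> produces the exponent \<open>a - 1\<close>, so
  no fixed exponent gives a stable class. Sums with varying exponents and slow coefficients
  do.\<close>

inductive powsum :: "('a::euclidean_space \<Rightarrow> real) \<Rightarrow> ('a \<Rightarrow> complex) \<Rightarrow> bool" for q where
  mult: "slow m \<Longrightarrow> powsum q (\<lambda>x. complex_of_real (q x powr a) * m x)"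
| add: "powsum q f \<Longrightarrow> powsum q g \<Longrightarrow> powsum q (\<lambda>x. f x + g x)"

text \<open>The source of all weights and multipliers. With \<open>q\<close> equal to one plus a
  square it makes arbitrary real powers of brackets slow, negative ones included, since
  \<open>q\<close> stays away from zero.\<close>

lemma slow_powr:
  fixes q :: "'a::euclidean_space \<Rightarrow> real"
  assumes q: "slow (\<lambda>x. complex_of_real (q x))" and q1: "\<And>x. q x \<ge> 1"
  shows "slow (\<lambda>x. complex_of_real (q x powr a))"
proof (rule smooth_in_coinduct[where P="powsum q"])
  have "powsum q (\<lambda>x. complex_of_real (q x powr a) * 1)"
    by (intro powsum.mult slow_const)
  then show "powsum q (\<lambda>x. complex_of_real (q x powr a))" by simp
  let ?q = "\<lambda>x. complex_of_real (q x)"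
  have qder: "(q has_derivative (\<lambda>h. Re (frechet_derivative ?q (at x) h))) (at x)" for x
    using has_derivative_Re[OF smooth_in_has_derivative[OF q, of x]] by simp
  have pder: "((\<lambda>x. complex_of_real (q x powr a)) has_derivative
      (\<lambda>h. complex_of_real (a * q x powr (a - 1) * Re (frechet_derivative ?q (at x) h)))) (at x)" for x a
  proof -
    have "((\<lambda>y. y powr a) has_derivative (\<lambda>h. a * q x powr (a - 1) * h)) (at (q x))"
      using has_real_derivative_powr[of "q x" a] q1[of x] by (simp add: has_field_derivative_def)
    from has_derivative_of_real[OF has_derivative_compose[OF qder this]] show ?thesis by (simp add: o_def)
  qed
  \<comment> \<open>The derivative of a real-valued function is real, so the real part introduced in
    \<open>qder\<close> can be removed and the slow function \<open>pd i ?q\<close>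
    reappears.\<close>
  have Re_q: "complex_of_real (Re (frechet_derivative ?q (at x) h)) = frechet_derivative ?q (at x) h" for x h
  proof -
    have "(?q has_derivative (\<lambda>h. complex_of_real (Re (frechet_derivative ?q (at x) h)))) (at x)"
      by (rule has_derivative_of_real[OF qder])
    from frechet_derivative_at[OF this] show ?thesis by metis
  qed
  \<comment> \<open>Since \<open>q\<close> is at least 1, the real exponent may be rounded up to a
    natural number, for which polynomial growth is clear.\<close>
  have bdd: "polybdd (\<lambda>x. complex_of_real (q x powr a))" for a
  proof -
    obtain k C where C: "\<And>x. \<bar>q x\<bar> \<le> C * (1 + norm x) ^ k"
      by (rule polybddE[OF smooth_in_D[OF q]]) auto
    obtain n :: nat where n: "a \<le> n" using real_arch_simple by blast
    show ?thesis
    proof (rule polybddI)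
      fix x
      have "q x powr a \<le> q x powr n" using q1 n by (intro powr_mono)
      also have "\<dots> = q x ^ n" using q1[of x] by (simp add: powr_realpow)
      also have "\<dots> \<le> (C * (1 + norm x) ^ k) ^ n" using q1[of x] C[of x] by (intro power_mono) auto
      finally show "cmod (of_real (q x powr a)) \<le> C ^ n * (1 + norm x) ^ (k * n)"
        by (simp add: power_mult_distrib power_mult)
    qed
  qed
  show diff: "f differentiable_on UNIV" if "powsum q f" for f
    using that
    by induction (auto simp: differentiable_on_def differentiable_add smooth_in_differentiable
        intro!: differentiable_mult differentiableI[OF pder])
  show "polybdd f" if "powsum q f" for f
    using that by induction (auto intro: polybdd_add polybdd_mult bdd dest: smooth_in_D)
  show "powsum q (pd i f)" if "powsum q f" "i \<in> Basis" for f i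
    using that
  proof induction
    case (mult m a)
    let ?p = "\<lambda>x. complex_of_real (q x powr a)"
    have "pd i (\<lambda>x. ?p x * m x) = (\<lambda>x. ?p x * pd i m x + pd i ?p x * m x)"
      using mult pder differentiableI smooth_in_differentiable by (intro pd_mult) blast+
    also have "\<dots> = (\<lambda>x. ?p x * pd i m x + complex_of_real (q x powr (a - 1)) * (a * pd i ?q x * m x))"
      using fun_cong[OF pd_eqI[OF pder, where i=i]] by (simp add: Re_q mult_ac)
    moreover have "powsum q \<dots>"
      using mult q by (intro powsum.intros slow_mult slow_const smooth_in_pd)
    ultimately show ?case by simp
  next
    case (add f g)
    then have "pd i (\<lambda>x. f x + g x) = (\<lambda>x. pd i f x + pd i g x)"
      using diff unfolding differentiable_on_def by (intro pd_add) simp_all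
    then show ?case using add by (simp add: powsum.add)
  qed
qed

section \<open>Integrability of rapidly decreasing functions\<close>

lemma norm_square_sum: "(norm x)\<^sup>2 = (\<Sum>i\<in>Basis. (x \<bullet> i)\<^sup>2)"
  by (simp only: norm_eq_sqrt_inner euclidean_inner[of x x] power2_eq_square)
     (simp add: sum_nonneg)

text \<open>\<open>lborel\<close> is the image of the product of one-dimensional Lebesgue measures
  under expansion in the basis, so both claims come from the product measure.\<close>

lemma integrable_prod_Basis:
  fixes h :: "'a::euclidean_space \<Rightarrow> real \<Rightarrow> 'b::{real_normed_field, banach, second_countable_topology}"
  assumes h: "\<And>i. i \<in> Basis \<Longrightarrow> integrable lborel (h i)"
  shows "integrable lborel (\<lambda>x::'a. \<Prod>i\<in>Basis. h i (x \<bullet> i))"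
    and "(LINT x|lborel. (\<Prod>i\<in>Basis. h i (x \<bullet> i))) = (\<Prod>i\<in>Basis. LINT x|lborel. h i x)"
proof -
  interpret product_sigma_finite "\<lambda>i::'a. lborel :: real measure"
    by standard
  have [measurable]: "i \<in> Basis \<Longrightarrow> h i \<in> borel_measurable borel" for i
    using h borel_measurable_integrable by auto
  have meas: "(\<lambda>f. \<Sum>b\<in>(Basis::'a set). f b *\<^sub>R b) \<in> measurable (\<Pi>\<^sub>M b\<in>Basis. lborel) borel"
    by measurable
  have meas2: "(\<lambda>x. \<Prod>i\<in>Basis. h i (x \<bullet> i)) \<in> borel_measurable borel"
    by measurable
  have eq: "(\<Prod>i\<in>Basis. h i ((\<Sum>b\<in>Basis. f b *\<^sub>R b) \<bullet> i)) = (\<Prod>i\<in>Basis. h i (f i))" for f :: "'a \<Rightarrow> real"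
    by (rule prod.cong[OF refl]) simp
  have "integrable (\<Pi>\<^sub>M b\<in>(Basis::'a set). lborel) (\<lambda>f. \<Prod>i\<in>Basis. h i (f i))"
    using assms by (intro product_integrable_prod) auto
  then show "integrable lborel (\<lambda>x::'a. \<Prod>i\<in>Basis. h i (x \<bullet> i))"
    by (subst lborel_eq, subst integrable_distr_eq[OF meas meas2]) (simp only: eq)
  have "(LINT x|lborel. (\<Prod>i\<in>(Basis::'a set). h i (x \<bullet> i)))
      = (LINT f|(\<Pi>\<^sub>M b\<in>(Basis::'a set). lborel). (\<Prod>i\<in>Basis. h i ((\<Sum>b\<in>Basis. f b *\<^sub>R b) \<bullet> i)))"
    by (subst lborel_eq) (rule integral_distr[OF meas meas2])
  also have "\<dots> = (\<Prod>i\<in>(Basis::'a set). LINT x|lborel. h i x)"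
    unfolding eq using assms by (intro product_integral_prod) auto
  finally show "(LINT x|lborel. (\<Prod>i\<in>(Basis::'a set). h i (x \<bullet> i))) = (\<Prod>i\<in>Basis. LINT x|lborel. h i x)" .
qed

text \<open>Each factor \<open>1 + (x \<bullet> i)\<^sup>2\<close> is at most
  \<open>(1 + norm x)\<^sup>2\<close>, so a product of one-dimensional integrable functions
  dominates. This is the origin of the exponent \<open>2 * DIM('a)\<close>.\<close>

lemma integrable_inverse_power_norm:
  "integrable lborel (\<lambda>x::'a::euclidean_space. inverse ((1 + norm x) ^ (2 * DIM('a))))"
proof -
  let ?h = "\<lambda>x::real. inverse (1 + x\<^sup>2)"
  have "integrable lborel ?h"
    using integrable_inverse_1_plus_square by (simp add: set_integrable_def)
  then have "integrable lborel (\<lambda>x::'a. \<Prod>i\<in>Basis. ?h (x \<bullet> i))"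
    by (intro integrable_prod_Basis(1))
  then show ?thesis
  proof (rule Bochner_Integration.integrable_bound)
    have "inverse ((1 + norm x) ^ (2 * DIM('a))) \<le> (\<Prod>i\<in>Basis. ?h (x \<bullet> i))" for x :: 'a
    proof -
      have pos: "(\<Prod>i\<in>Basis. (1 + (x \<bullet> i)\<^sup>2)) > 0"
        by (intro prod_pos) (simp add: add_pos_nonneg)
      have "(\<Prod>i\<in>Basis. (1 + (x \<bullet> i)\<^sup>2)) \<le> (\<Prod>i\<in>(Basis::'a set). (1 + norm x)\<^sup>2)"
      proof (intro prod_mono conjI)
        fix i :: 'a assume "i \<in> Basis"
        then have "\<bar>x \<bullet> i\<bar> \<le> norm x" by (rule Basis_le_norm)
        then have "(x \<bullet> i)\<^sup>2 \<le> (norm x)\<^sup>2" using abs_le_square_iff by fastforce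
        then show "1 + (x \<bullet> i)\<^sup>2 \<le> (1 + norm x)\<^sup>2"
          using norm_ge_zero[of x] unfolding power2_sum power_one by linarith
      qed simp
      also have "\<dots> = (1 + norm x) ^ (2 * DIM('a))" by (simp add: power_mult)
      finally have "inverse ((1 + norm x) ^ (2 * DIM('a))) \<le> inverse (\<Prod>i\<in>Basis. (1 + (x \<bullet> i)\<^sup>2))"
        using pos by (rule le_imp_inverse_le)
      also have "\<dots> = (\<Prod>i\<in>Basis. ?h (x \<bullet> i))" by (simp add: prod_inversef[symmetric] o_def)
      finally show ?thesis .
    qed
    then show "AE x::'a in lborel. norm (inverse ((1 + norm x) ^ (2 * DIM('a))))
        \<le> norm (\<Prod>i\<in>Basis. ?h (x \<bullet> i))"
      by (intro always_eventually allI) (simp add: prod_nonneg)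
  qed simp
qed

lemma rapid_integrable:
  fixes f :: "'a::euclidean_space \<Rightarrow> complex"
  assumes f: "rapid f" and [measurable]: "f \<in> borel_measurable borel"
  shows "integrable lborel f"
proof -
  obtain C where C: "C \<ge> 0" "\<And>x. cmod (f x) * (1 + norm x) ^ (2 * DIM('a)) \<le> C" using f rapidE by metis
  show ?thesis
  proof (rule Bochner_Integration.integrable_bound)
    show "integrable lborel (\<lambda>x::'a. C * inverse ((1 + norm x) ^ (2 * DIM('a))))"
      using integrable_inverse_power_norm by (rule integrable_mult_right)
    show "AE x in lborel. cmod (f x) \<le> norm (C * inverse ((1 + norm x) ^ (2 * DIM('a))))"
    proof (intro always_eventually allI)
      fix x :: 'a
      have "(1 + norm x) ^ (2 * DIM('a)) > 0" by (simp add: add_pos_nonneg)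
      with C show "cmod (f x) \<le> norm (C * inverse ((1 + norm x) ^ (2 * DIM('a))))"
        by (simp add: divide_inverse[symmetric] pos_le_divide_eq)
    qed
  qed simp
qed

lemma schwartz_measurable [measurable_dest]: "schwartz f \<Longrightarrow> f \<in> borel_measurable borel"
  by (simp add: schwartz_iff smooth_in_measurable)

lemma schwartz_rapid: "schwartz f \<Longrightarrow> rapid f"
  by (simp add: schwartz_iff smooth_in_D)

lemma schwartz_integrable: "schwartz f \<Longrightarrow> integrable lborel f"
  by (intro rapid_integrable schwartz_rapid schwartz_measurable)

section \<open>The Fourier transform of Schwartz functions\<close>

lemma cis_measurable [measurable]: "cis \<in> borel_measurable borel"
  by (intro borel_measurable_continuous_onI continuous_intros)

lemma integrable_cis_mult:
  fixes f :: "'a::euclidean_space \<Rightarrow> complex"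
  assumes f: "integrable lborel f" and [measurable]: "r \<in> borel_measurable borel"
  shows "integrable lborel (\<lambda>z. cis (r z) * f z)"
proof -
  have [measurable]: "f \<in> borel_measurable borel" using f by (simp add: borel_measurable_integrable)
  show ?thesis by (rule Bochner_Integration.integrable_bound[OF f]) (auto simp: norm_mult)
qed

lemma nn_integral_lborel_affine:
  fixes f :: "'a::euclidean_space \<Rightarrow> ennreal"
  assumes [measurable]: "f \<in> borel_measurable borel" and c: "c \<noteq> 0"
  shows "(\<integral>\<^sup>+x. f x \<partial>lborel) = ennreal (\<bar>c\<bar> ^ DIM('a)) * (\<integral>\<^sup>+x. f (t + c *\<^sub>R x) \<partial>lborel)"
  by (subst lborel_affine[OF c, of t]) (simp add: nn_integral_density nn_integral_distr nn_integral_cmult)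

lemma integral_lborel_affine:
  fixes f :: "'a::euclidean_space \<Rightarrow> 'b::{banach, second_countable_topology}"
  assumes [measurable]: "f \<in> borel_measurable borel" and c: "c \<noteq> 0"
  shows "(LINT x|lborel. f x) = (\<bar>c\<bar> ^ DIM('a)) *\<^sub>R (LINT x|lborel. f (t + c *\<^sub>R x))"
  by (subst lborel_affine[OF c, of t]) (simp add: integral_density integral_distr)

lemma integrable_lborel_affine:
  fixes f :: "'a::euclidean_space \<Rightarrow> 'b::{banach, second_countable_topology}"
  assumes [measurable]: "f \<in> borel_measurable borel" and c: "c \<noteq> 0"
  shows "integrable lborel f \<longleftrightarrow> integrable lborel (\<lambda>x. f (t + c *\<^sub>R x))"
proof -
  have "integrable lborel f \<longleftrightarrow> integrable lborel (\<lambda>x. \<bar>c\<bar> ^ DIM('a) *\<^sub>R f (t + c *\<^sub>R x))"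
    by (subst lborel_affine[OF c, of t]) (simp add: integrable_density integrable_distr_eq)
  also have "\<dots> \<longleftrightarrow> integrable lborel (\<lambda>x. f (t + c *\<^sub>R x))"
    using c integrable_scaleR_right[of "inverse (\<bar>c\<bar> ^ DIM('a))" lborel "\<lambda>x. \<bar>c\<bar> ^ DIM('a) *\<^sub>R f (t
        + c *\<^sub>R x)"]
    by auto
  finally show ?thesis .
qed

lemma integral_lborel_reflect:
  fixes f :: "'a::euclidean_space \<Rightarrow> 'b::{banach, second_countable_topology}"
  assumes "f \<in> borel_measurable borel"
  shows "(LINT x|lborel. f (- x)) = (LINT x|lborel. f x)"
  using integral_lborel_affine[OF assms, of "-1" 0] by simp

lemma integral_lborel_translate:
  fixes f :: "'a::euclidean_space \<Rightarrow> 'b::{banach, second_countable_topology}"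
  assumes "f \<in> borel_measurable borel"
  shows "(LINT x|lborel. f (t + x)) = (LINT x|lborel. f x)"
  using integral_lborel_affine[OF assms, of "1" t] by simp

lemma integrable_lborel_translate:
  fixes f :: "'a::euclidean_space \<Rightarrow> 'b::{banach, second_countable_topology}"
  assumes "integrable lborel f"
  shows "integrable lborel (\<lambda>x. f (t + x))"
  using integrable_lborel_affine[of f "1" t] assms by (simp add: borel_measurable_integrable)

lemma integrable_lborel_reflect:
  fixes f :: "'a::euclidean_space \<Rightarrow> 'b::{banach, second_countable_topology}"
  assumes "integrable lborel f"
  shows "integrable lborel (\<lambda>x. f (- x))"
  using integrable_lborel_affine[of f "-1" 0] assms by (simp add: borel_measurable_integrable)

lemma fourier_bound: "cmod (fourier f \<zeta>) \<le> (LINT z|lborel. cmod (f z))"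
proof -
  have "cmod (fourier f \<zeta>) \<le> (LINT z|lborel. cmod (cis (- (z \<bullet> \<zeta>)) * f z))"
    unfolding fourier_def by (rule integral_norm_bound)
  then show ?thesis by (simp add: norm_mult)
qed

lemma cis_approx: "cmod (cis t - 1 - \<i> * t) \<le> t\<^sup>2"
proof -
  have "cmod (iexp t - (\<Sum>k \<le> 1. (\<i> * t)^k / fact k)) \<le> \<bar>t\<bar>^(Suc 1) / fact (Suc 1)"
    by (rule iexp_approx1)
  then have "cmod (cis t - 1 - \<i> * t) \<le> t\<^sup>2 / 2"
    by (simp add: cis_conv_exp diff_diff_eq power2_eq_square)
  then show ?thesis using zero_le_power2[of t] by linarith
qed

lemma has_derivative_quadratic:
  fixes g :: "'a::euclidean_space \<Rightarrow> 'b::real_normed_vector"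
  assumes "bounded_linear D" and b: "\<And>h. norm (g (x + h) - g x - D h) \<le> C * (norm h)\<^sup>2"
  shows "(g has_derivative D) (at x)"
proof (rule has_derivativeI_sandwich[where e=1 and H="\<lambda>y. C * norm (y - x)"])
  show "norm (g y - g x - D (y - x)) / norm (y - x) \<le> C * norm (y - x)" if "y \<noteq> x" for y
    using b[of "y - x"] that by (simp add: divide_le_eq power2_eq_square mult.assoc)
  have "((\<lambda>y. C * norm (y - x)) \<longlongrightarrow> C * norm (x - x)) (at x)"
    by (intro tendsto_intros)
  then show "((\<lambda>y. C * norm (y - x)) \<longlongrightarrow> 0) (at x)" by simp
qed (use assms in auto)

text \<open>The Taylor remainder of \<open>cis\<close> is at most
  \<open>(z \<bullet> h)\<^sup>2\<close>, so the error of the linear approximation is at most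
  \<open>(norm h)\<^sup>2\<close> times the second moment of \<open>f\<close>. This gives the
  Frechet derivative without a limit under the integral sign.\<close>

lemma fourier_has_derivative:
  fixes f :: "'a::euclidean_space \<Rightarrow> complex"
  assumes f: "schwartz f"
  shows "(fourier f has_derivative (\<lambda>h. LINT z|lborel. cis (- (z \<bullet> \<zeta>)) * (complex_of_real (z \<bullet> h) * (- \<i>
      * f z)))) (at \<zeta>)"
proof -
  have [measurable]: "f \<in> borel_measurable borel" using f by (rule schwartz_measurable)
  let ?d = "\<lambda>h z. cis (- (z \<bullet> \<zeta>)) * (complex_of_real (z \<bullet> h) * (- \<i> * f z))"
  let ?C = "LINT z|lborel. (norm z)\<^sup>2 * cmod (f z)"
  have I0: "integrable lborel (\<lambda>z. cis (- (z \<bullet> \<eta>)) * f z)" for \<eta>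
    by (intro integrable_cis_mult schwartz_integrable f) simp
  have I1: "integrable lborel (?d h)" for h
    by (intro integrable_cis_mult schwartz_integrable schwartz_slow_mult[OF slow_inner] schwartz_cmult f) simp
  have sq: "schwartz (\<lambda>z. (\<Sum>i\<in>Basis. complex_of_real (z \<bullet> i) * complex_of_real (z \<bullet> i)) * f z)"
    by (intro schwartz_slow_mult slow_sum slow_mult slow_inner f)
  have I2: "integrable lborel (\<lambda>z. (norm z)\<^sup>2 * cmod (f z))"
  proof -
    have "cmod (\<Sum>i\<in>Basis. complex_of_real (z \<bullet> i) * complex_of_real (z \<bullet> i)) = (norm z)\<^sup>2" for z :: 'a
    proof -
      have "(\<Sum>i\<in>Basis. complex_of_real (z \<bullet> i) * complex_of_real (z \<bullet> i)) = complex_of_real ((norm z)\<^sup>2)"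
        by (subst norm_square_sum) (simp only: power2_eq_square of_real_sum of_real_mult)
      then show ?thesis by (simp only: norm_of_real) simp
    qed
    then show ?thesis using integrable_norm[OF schwartz_integrable[OF sq]] by (simp add: norm_mult)
  qed
  show ?thesis
  proof (rule has_derivative_quadratic)
    have "linear (\<lambda>h. LINT z|lborel. ?d h z)"
    proof (rule linearI)
      fix h k
      have "(LINT z|lborel. ?d (h + k) z) = (LINT z|lborel. ?d h z + ?d k z)"
        by (simp add: algebra_simps)
      then show "(LINT z|lborel. ?d (h + k) z) = (LINT z|lborel. ?d h z) + (LINT z|lborel. ?d k z)"
        using I1 by simp
    next
      fix r h
      have "(LINT z|lborel. ?d (r *\<^sub>R h) z) = (LINT z|lborel. r *\<^sub>R ?d h z)"
        by (simp add: scaleR_conv_of_real mult_ac)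
      then show "(LINT z|lborel. ?d (r *\<^sub>R h) z) = r *\<^sub>R (LINT z|lborel. ?d h z)"
        by simp
    qed
    then show "bounded_linear (\<lambda>h. LINT z|lborel. ?d h z)" by (simp add: linear_conv_bounded_linear)
    fix h
    have split: "cis (- (z \<bullet> (\<zeta> + h))) = cis (- (z \<bullet> \<zeta>)) * cis (- (z \<bullet> h))" for z
      by (simp add: cis_mult inner_add_right)
    have "fourier f (\<zeta> + h) - fourier f \<zeta> - (LINT z|lborel. ?d h z)
        = (LINT z|lborel. cis (- (z \<bullet> (\<zeta> + h))) * f z - cis (- (z \<bullet> \<zeta>)) * f z - ?d h z)"
      unfolding fourier_def using I0 I1 by simp
    also have "\<dots> = (LINT z|lborel. cis (- (z \<bullet> \<zeta>)) * (cis (- (z \<bullet> h)) - 1 - \<i>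
        * complex_of_real (- (z \<bullet> h))) * f z)"
      by (intro Bochner_Integration.integral_cong) (auto simp: split ring_distribs mult_ac)
    also have "cmod \<dots> \<le> (LINT z|lborel. (norm h)\<^sup>2 * ((norm z)\<^sup>2 * cmod (f z)))"
    proof (rule Bochner_Integration.integral_norm_bound_integral)
      show "integrable lborel (\<lambda>z. cis (- (z \<bullet> \<zeta>)) * (cis (- (z \<bullet> h)) - 1 - \<i>
          * complex_of_real (- (z \<bullet> h))) * f z)"
      proof (rule Bochner_Integration.integrable_cong[THEN iffD1, OF refl])
        show "integrable lborel (\<lambda>z. cis (- (z \<bullet> (\<zeta> + h))) * f z - cis (- (z \<bullet> \<zeta>)) * f z - ?d h z)"
          using I0 I1 by (intro Bochner_Integration.integrable_diff)
      qed (auto simp: split ring_distribs mult_ac)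
      show "integrable lborel (\<lambda>z. (norm h)\<^sup>2 * ((norm z)\<^sup>2 * cmod (f z)))" using I2 by simp
      fix z :: 'a
      have "cmod (cis (- (z \<bullet> h)) - 1 - \<i> * complex_of_real (- (z \<bullet> h))) \<le> (- (z \<bullet> h))\<^sup>2"
        by (rule cis_approx)
      also have "\<dots> \<le> (norm z * norm h)\<^sup>2"
        using Cauchy_Schwarz_ineq2[of z h] by (metis abs_le_square_iff abs_mult abs_norm_cancel power2_minus)
      finally have "cmod (cis (- (z \<bullet> h)) - 1 - \<i> * complex_of_real (- (z \<bullet> h))) * cmod (f z) \<le> (norm z
          * norm h)\<^sup>2 * cmod (f z)"
        by (rule mult_right_mono) simp
      then show "cmod (cis (- (z \<bullet> \<zeta>)) * (cis (- (z \<bullet> h)) - 1 - \<i> * complex_of_real (- (z \<bullet> h))) * f z)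
          \<le> (norm h)\<^sup>2 * ((norm z)\<^sup>2 * cmod (f z))"
        by (simp only: norm_mult norm_cis power_mult_distrib mult_ac mult_1_left mult_1_right)
    qed
    also have "\<dots> = ?C * (norm h)\<^sup>2" by simp
    finally show "cmod (fourier f (\<zeta> + h) - fourier f \<zeta> - (LINT z|lborel. ?d h z)) \<le> ?C * (norm h)\<^sup>2" .
  qed
qed

lemma slow_cis_inner: "slow (\<lambda>z::'a::euclidean_space. cis (z \<bullet> v))"
proof (rule smooth_in_coinduct[where P="\<lambda>f. \<exists>c. f = (\<lambda>z. c * cis (z \<bullet> v))"])
  show "\<exists>c. (\<lambda>z. cis (z \<bullet> v)) = (\<lambda>z. c * cis (z \<bullet> v))" by (rule exI[of _ 1]) simp
  fix f :: "'a \<Rightarrow> complex" and i :: 'a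
  assume "\<exists>c. f = (\<lambda>z. c * cis (z \<bullet> v))"
  then obtain c where f: "f = (\<lambda>z. c * cis (z \<bullet> v))" by blast
  have der: "(f has_derivative (\<lambda>h. c * ((h \<bullet> v) *\<^sub>R (\<i> * cis (z \<bullet> v))))) (at z)" for z
    unfolding f by (auto intro!: derivative_eq_intros)
  then show "f differentiable_on UNIV" by (auto simp: differentiable_on_def differentiable_def)
  show "polybdd f" by (rule polybddI[where C="cmod c" and k=0]) (simp add: f norm_mult)
  have "pd i f = (\<lambda>z. (c * (i \<bullet> v) * \<i>) * cis (z \<bullet> v))"
    using pd_eqI[OF der] by (simp add: scaleR_conv_of_real mult_ac)
  then show "\<exists>c. pd i f = (\<lambda>z. c * cis (z \<bullet> v))" by blast
qed

text \<open>The difference quotients have integral zero by translation invariance, so no integration by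
  parts is needed.\<close>

lemma integral_pd_eq_0:
  fixes F :: "'a::euclidean_space \<Rightarrow> complex"
  assumes F: "schwartz F" and e: "e \<in> Basis"
  shows "(LINT z|lborel. pd e F z) = 0"
proof -
  let ?N = "2 * DIM('a)"
  have [measurable]: "F \<in> borel_measurable borel" using F by (rule schwartz_measurable)
  have pF: "schwartz (pd e F)" using F e smooth_in_pd unfolding schwartz_iff by blast
  then have [measurable]: "pd e F \<in> borel_measurable borel" by (rule schwartz_measurable)
  obtain C where C: "C \<ge> 0" "\<And>x. cmod (pd e F x) * (1 + norm x) ^ ?N \<le> C"
    using rapidE[OF schwartz_rapid[OF pF]] by metis
  have der: "(F has_derivative frechet_derivative F (at x)) (at x)" for x
    using F unfolding schwartz_iff by (rule smooth_in_has_derivative)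
  define h where "h m = inverse (real (Suc m))" for m
  have h: "0 < h m" "h m \<le> 1" for m unfolding h_def by (auto simp: field_simps)
  have h0: "h \<longlonglongrightarrow> 0" unfolding h_def by (rule LIMSEQ_inverse_real_of_nat)
  define s where "s m z = (1 / h m) *\<^sub>R (F (h m *\<^sub>R e + z) - F z)" for m z
  have "(\<lambda>m. LINT z|lborel. s m z) \<longlonglongrightarrow> (LINT z|lborel. pd e F z)"
  proof (rule integral_dominated_convergence)
    show "s m \<in> borel_measurable lborel" for m unfolding s_def by measurable
    show "integrable lborel (\<lambda>x::'a. (C * 2 ^ ?N) * inverse ((1 + norm x) ^ ?N))"
      using integrable_inverse_power_norm by (rule integrable_mult_right)
    show "AE z in lborel. (\<lambda>m. s m z) \<longlonglongrightarrow> pd e F z"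
    proof (intro always_eventually allI)
      fix z
      have "((\<lambda>t. F (z + t *\<^sub>R e)) has_derivative (\<lambda>t. frechet_derivative F (at (z
          + 0 *\<^sub>R e)) (t *\<^sub>R e))) (at 0)"
        by (rule has_derivative_compose[where g=F, OF _ der]) (auto intro!: derivative_eq_intros)
      then have "((\<lambda>t. F (z + t *\<^sub>R e)) has_derivative (\<lambda>t. t *\<^sub>R pd e F z)) (at 0)"
        by (simp add: linear_cmul[OF has_derivative_linear[OF der]])
      then have "((\<lambda>t. cmod (F (z + t *\<^sub>R e) - F z - t *\<^sub>R pd e F z) / norm t) \<longlongrightarrow> 0) (at 0)"
        by (simp add: has_derivative_at)
      moreover have "filterlim h (at 0) sequentially"
        unfolding filterlim_at using h0 h(1) by (auto simp: dual_order.strict_implies_not_eq)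
      ultimately have "((\<lambda>m. cmod (F (z + h m *\<^sub>R e) - F z - h m *\<^sub>R pd e F z) / norm (h m)) \<longlongrightarrow> 0)
          sequentially"
        by (rule filterlim_compose)
      moreover have "cmod (F (z + h m *\<^sub>R e) - F z - h m *\<^sub>R pd e F z) / norm (h m)
          = cmod (s m z - pd e F z)" for m
      proof -
        have "s m z - pd e F z = (1 / h m) *\<^sub>R (F (z + h m *\<^sub>R e) - F z - h m *\<^sub>R pd e F z)"
          using h(1)[of m] by (simp add: s_def add.commute scaleR_diff_right)
        then show ?thesis using h(1)[of m] by simp
      qed
      ultimately show "(\<lambda>m. s m z) \<longlonglongrightarrow> pd e F z" by (simp add: tendsto_norm_zero_iff LIM_zero_iff)
    qed
    \<comment> \<open>The mean value inequality on the segment from \<open>z\<close> to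
      \<open>z + h m *\<^sub>R e\<close> bounds the quotient by the derivative there. As the segment
      has length at most 1, \<open>1 + norm\<close> changes by a factor of at most 2, which costs
      \<open>2 ^ ?N\<close>.\<close>
    show "AE z in lborel. cmod (s m z) \<le> (C * 2 ^ ?N) * inverse ((1 + norm z) ^ ?N)" for m
    proof (intro always_eventually allI)
      fix z :: 'a
      let ?B = "(C * 2 ^ ?N) * inverse ((1 + norm z) ^ ?N)"
      have two_bound: "1 + a \<le> 2 * (1 + b)" if "a \<le> b + 1" "0 \<le> b" for a b :: real using that by argo
      have npos: "(1 + norm x) ^ k > 0" for x :: 'a and k by (simp add: add_pos_nonneg)
      have bd: "cmod (pd e F (z + t *\<^sub>R e)) \<le> ?B" if "0 \<le> t" "t \<le> h m" for t
      proof -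
        have "norm (t *\<^sub>R e) \<le> 1" using that h(2)[of m] e by simp
        then have "norm z \<le> norm (z + t *\<^sub>R e) + 1" using norm_triangle_ineq4[of "z + t *\<^sub>R e" "t *\<^sub>R e"]
            by simp
        then have "(1 + norm z) ^ ?N \<le> (2 * (1 + norm (z + t *\<^sub>R e))) ^ ?N"
          by (intro power_mono two_bound) auto
        then have "cmod (pd e F (z + t *\<^sub>R e)) * (1 + norm z) ^ ?N \<le> cmod (pd e F (z + t *\<^sub>R e)) * (2 * (1
            + norm (z + t *\<^sub>R e))) ^ ?N"
          by (rule mult_left_mono) simp
        also have "\<dots> \<le> C * 2 ^ ?N"
          unfolding power_mult_distrib
          using mult_right_mono[OF C(2)[of "z + t *\<^sub>R e"], of "2 ^ ?N"]
              by (simp only: mult_ac zero_le_power zero_le_numeral)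
        finally show ?thesis using npos[of z] by (simp add: divide_inverse[symmetric] pos_le_divide_eq)
      qed
      have "cmod (F (z + h m *\<^sub>R e) - F (z + 0 *\<^sub>R e)) \<le> ?B * norm (h m - 0)"
      proof (rule differentiable_bound[of "{0..h m}" "\<lambda>t. F (z + t *\<^sub>R e)"
          "\<lambda>t s. frechet_derivative F (at (z + t *\<^sub>R e)) (s *\<^sub>R e)"])
        fix t assume t: "t \<in> {0..h m}"
        show "((\<lambda>t. F (z + t *\<^sub>R e)) has_derivative (\<lambda>s. frechet_derivative F (at (z
            + t *\<^sub>R e)) (s *\<^sub>R e))) (at t within {0..h m})"
          by (rule has_derivative_compose[where g=F, OF _ der]) (auto intro!: derivative_eq_intros)
        show "onorm (\<lambda>s. frechet_derivative F (at (z + t *\<^sub>R e)) (s *\<^sub>R e)) \<le> ?B"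
        proof (rule onorm_le)
          fix s :: real
          show "cmod (frechet_derivative F (at (z + t *\<^sub>R e)) (s *\<^sub>R e)) \<le> ?B * norm s"
            using mult_right_mono[OF bd[of t], of "\<bar>s\<bar>"] t
            by (simp add: linear_cmul[OF has_derivative_linear[OF der]] mult_ac)
        qed
      qed (use h(1)[of m] in auto)
      then have "cmod (F (h m *\<^sub>R e + z) - F z) \<le> ?B * h m" using h(1)[of m] by (simp add: add.commute)
      then show "cmod (s m z) \<le> ?B" using h(1)[of m] by (simp add: s_def divide_le_eq)
    qed
  qed measurable
  moreover have "(LINT z|lborel. s m z) = 0" for m
    unfolding s_def using schwartz_integrable[OF F] integrable_lborel_translate[OF schwartz_integrable[OF F]]
    by (simp add: integral_lborel_translate)
  ultimately show ?thesis by (simp add: LIMSEQ_const_iff)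
qed

text \<open>The product of the character and \<open>f\<close> is again a Schwartz function, so its
  derivative integrates to zero. The Leibniz rule then gives the formula.\<close>

lemma fourier_pd:
  fixes f :: "'a::euclidean_space \<Rightarrow> complex"
  assumes f: "schwartz f" and i: "i \<in> Basis"
  shows "fourier (pd i f) \<zeta> = \<i> * (\<zeta> \<bullet> i) * fourier f \<zeta>"
proof -
  let ?c = "\<lambda>z. cis (z \<bullet> (- \<zeta>))"
  have F: "schwartz (\<lambda>z. ?c z * f z)" by (intro schwartz_slow_mult slow_cis_inner f)
  have pf: "schwartz (pd i f)" using f i smooth_in_pd unfolding schwartz_iff by blast
  have cder: "(?c has_derivative (\<lambda>h. (h \<bullet> (-\<zeta>)) *\<^sub>R (\<i> * ?c z))) (at z)" for z
    by (auto intro!: derivative_eq_intros)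
  have "pd i (\<lambda>z. ?c z * f z) = (\<lambda>z. ?c z * pd i f z + pd i ?c z * f z)"
    using cder differentiableI smooth_in_differentiable f schwartz_iff by (intro pd_mult) blast+
  also have "\<dots> = (\<lambda>z. ?c z * pd i f z - (\<i> * (\<zeta> \<bullet> i)) * (?c z * f z))"
    using fun_cong[OF pd_eqI[OF cder, where i=i]]
        by (simp add: scaleR_conv_of_real inner_commute algebra_simps)
  finally have "(LINT z|lborel. ?c z * pd i f z - (\<i> * (\<zeta> \<bullet> i)) * (?c z * f z)) = 0"
    using integral_pd_eq_0[OF F i] by simp
  moreover have "integrable lborel (\<lambda>z. ?c z * pd i f z)" "integrable lborel (\<lambda>z. ?c z * f z)"
    by (intro integrable_cis_mult schwartz_integrable pf f; simp)+
  ultimately show ?thesis by (simp add: fourier_def)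
qed

text \<open>One power of \<open>norm x\<close> is bounded by the sum of the coordinates, and each
  coordinate is traded for a derivative of \<open>f\<close>. This is an induction over all Schwartz
  functions at once.\<close>

lemma fourier_rapid:
  fixes f :: "'a::euclidean_space \<Rightarrow> complex"
  assumes "schwartz f" shows "rapid (fourier f)"
proof (rule rapidI)
  fix k show "\<exists>C. \<forall>x. cmod (fourier f x) * norm x ^ k \<le> C"
    using assms
  proof (induction k arbitrary: f)
    case 0
    show ?case using fourier_bound[of f] by auto
  next
    case (Suc k)
    have "\<exists>C. \<forall>x. cmod (fourier (pd i f) x) * norm x ^ k \<le> C" if "i \<in> Basis" for i
      using that Suc smooth_in_pd unfolding schwartz_iff by blast
    then obtain C where C: "\<And>i x. i \<in> Basis \<Longrightarrow> cmod (fourier (pd i f) x) * norm x ^ k \<le> C i" by metis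
    have "cmod (fourier f x) * norm x ^ Suc k \<le> (\<Sum>i\<in>Basis. C i)" for x
    proof -
      have "cmod (fourier f x) * norm x ^ Suc k \<le> cmod (fourier f x) * ((\<Sum>i\<in>Basis. \<bar>x \<bullet> i\<bar>) * norm x ^ k)"
        unfolding power_Suc by (intro mult_left_mono mult_right_mono norm_le_l1) auto
      also have "\<dots> = (\<Sum>i\<in>Basis. cmod (fourier (pd i f) x) * norm x ^ k)"
        by (simp add: sum_distrib_left sum_distrib_right fourier_pd[OF Suc.prems] norm_mult mult_ac)
      also have "\<dots> \<le> (\<Sum>i\<in>Basis. C i)" by (intro sum_mono C)
      finally show ?thesis .
    qed
    then show ?case by blast
  qed
qed

text \<open>A derivative of a transform is the transform of \<open>f\<close> times a linear form, so
  the transforms of Schwartz functions are a stable class of rapidly decreasing functions.\<close>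

lemma schwartz_fourier: "schwartz f \<Longrightarrow> schwartz (fourier f)"
  for f :: "'a::euclidean_space \<Rightarrow> complex"
  unfolding schwartz_iff
proof (rule smooth_in_coinduct[where P="\<lambda>g. \<exists>f. schwartz f \<and> g = fourier f"])
  fix g :: "'a \<Rightarrow> complex" and i :: 'a
  assume "\<exists>f. schwartz f \<and> g = fourier f"
  then obtain f where f: "schwartz f" "g = fourier f" by blast
  note der = fourier_has_derivative[OF f(1), folded f(2)]
  then show "g differentiable_on UNIV" by (auto simp: differentiable_on_def differentiable_def)
  show "rapid g" using f fourier_rapid by blast
  have "pd i g = fourier (\<lambda>z. complex_of_real (z \<bullet> i) * (- \<i> * f z))"
    using pd_eqI[OF der] by (simp add: fourier_def fun_eq_iff)
  moreover have "schwartz (\<lambda>z. complex_of_real (z \<bullet> i) * (- \<i> * f z))"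
    by (intro schwartz_slow_mult[OF slow_inner] schwartz_cmult f)
  ultimately show "\<exists>f. schwartz f \<and> pd i g = fourier f" by blast
qed (auto simp: schwartz_iff)


lemma fourier_measurable [measurable]:
  fixes f :: "'a::euclidean_space \<Rightarrow> complex"
  assumes [measurable]: "f \<in> borel_measurable borel"
  shows "fourier f \<in> borel_measurable borel"
  unfolding fourier_def by measurable

text \<open>Fubini for the integrable function of two variables
  \<open>cis (- (z \<bullet> \<zeta>)) * f z * g \<zeta>\<close>. Inversion, convolution and all
  pairings with test functions are reduced to this formula.\<close>

lemma integral_fourier_mult:
  fixes f g :: "'a::euclidean_space \<Rightarrow> complex"
  assumes f: "integrable lborel f" and g: "integrable lborel g"
  shows "(LINT \<zeta>|lborel. fourier f \<zeta> * g \<zeta>) = (LINT z|lborel. f z * fourier g z)"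
proof -
  have [measurable]: "f \<in> borel_measurable borel" "g \<in> borel_measurable borel"
    using f g by (simp_all add: borel_measurable_integrable)
  let ?h = "\<lambda>z \<zeta>. cis (- (z \<bullet> \<zeta>)) * f z * g \<zeta>"
  have "integrable (lborel \<Otimes>\<^sub>M lborel) (\<lambda>(z, \<zeta>). ?h z \<zeta>)"
  proof (rule lborel_pair.Fubini_integrable)
    show "integrable lborel (\<lambda>z. LINT \<zeta>|lborel. norm (case (z, \<zeta>) of (z, \<zeta>) \<Rightarrow> ?h z \<zeta>))"
      using f g by (simp add: norm_mult)
    show "AE z in lborel. integrable lborel (\<lambda>\<zeta>. case (z, \<zeta>) of (z, \<zeta>) \<Rightarrow> ?h z \<zeta>)"
      using integrable_cis_mult[OF g] by (simp add: mult.assoc mult.left_commute[of _ "f _"])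
  qed measurable
  from lborel_pair.Fubini_integral[OF this]
  have "(LINT \<zeta>|lborel. LINT z|lborel. ?h z \<zeta>) = (LINT z|lborel. LINT \<zeta>|lborel. ?h z \<zeta>)" .
  moreover have "(LINT z|lborel. ?h z \<zeta>) = fourier f \<zeta> * g \<zeta>" for \<zeta>
    unfolding fourier_def by (rule integral_mult_left_zero)
  moreover have "(LINT \<zeta>|lborel. ?h z \<zeta>) = f z * fourier g z" for z
    unfolding fourier_def
    by (subst Bochner_Integration.integral_mult_right_zero[symmetric], rule
        Bochner_Integration.integral_cong) (simp_all add: inner_commute mult_ac)
  ultimately show ?thesis by (simp only:)
qed

section \<open>Gaussians and Fourier inversion\<close>

definition gauss :: "'a::real_normed_vector \<Rightarrow> real" where
  "gauss x = exp (- (norm x)\<^sup>2 / 2)"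

lemma gauss_measurable [measurable]: "gauss \<in> borel_measurable borel"
  unfolding gauss_def by measurable

lemma gauss_pos: "gauss x > 0" and gauss_le_1: "gauss x \<le> 1"
  by (auto simp: gauss_def)

lemma gauss_prod: "gauss (x::'a::euclidean_space) = (\<Prod>i\<in>Basis. exp (- (x \<bullet> i)\<^sup>2 / 2))"
  unfolding gauss_def norm_square_sum by (simp add: exp_sum[symmetric] sum_negf sum_divide_distrib)

text \<open>Up to normalisation the integral is the characteristic function of the standard normal
  distribution.\<close>

lemma gauss_real:
  fixes t :: real
  shows "integrable lborel (\<lambda>x::real. exp (- x\<^sup>2 / 2))"
    and "(LINT x|lborel. cis (- (x * t)) * complex_of_real (exp (- x\<^sup>2 / 2))) = sqrt (2 * pi)
        * exp (- t\<^sup>2 / 2)"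
proof -
  have "integrable lborel (\<lambda>x. sqrt (2 * pi) * std_normal_density x)" by simp
  then show "integrable lborel (\<lambda>x::real. exp (- x\<^sup>2 / 2))" by (simp add: std_normal_density_def)
  have "complex_of_real (exp (- t\<^sup>2 / 2)) = char std_normal_distribution (- t)"
    by (simp add: char_std_normal_distribution)
  also have "\<dots> = (LINT x|lborel. std_normal_density x *\<^sub>R cis (- (x * t)))"
    unfolding char_def by (subst integral_density) (auto simp: cis_conv_exp mult_ac)
  also have "\<dots> = (LINT x|lborel. complex_of_real (1 / sqrt (2 * pi)) * (cis (- (x * t))
      * complex_of_real (exp (- x\<^sup>2 / 2))))"
    by (rule Bochner_Integration.integral_cong) (auto simp: std_normal_density_def scaleR_conv_of_real)
  finally show "(LINT x|lborel. cis (- (x * t)) * complex_of_real (exp (- x\<^sup>2 / 2))) = sqrt (2 * pi)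
      * exp (- t\<^sup>2 / 2)"
    by (simp add: divide_simps mult_ac)
qed

lemma cis_sum: "cis (\<Sum>i\<in>I. f i) = (\<Prod>i\<in>I. cis (f i))"
  by (induction I rule: infinite_finite_induct) (auto simp: cis_mult[symmetric])

lemma fourier_gauss:
  fixes \<zeta> :: "'a::euclidean_space"
  shows "integrable lborel (gauss :: 'a \<Rightarrow> real)"
    and "fourier (\<lambda>x. complex_of_real (gauss x)) \<zeta> = complex_of_real (sqrt (2 * pi) ^ DIM('a) * gauss \<zeta>)"
proof -
  show "integrable lborel (gauss :: 'a \<Rightarrow> real)"
    unfolding gauss_prod by (intro integrable_prod_Basis gauss_real)
  have *: "cis (- (z \<bullet> \<zeta>)) = (\<Prod>i\<in>Basis. cis (- ((z \<bullet> i) * (\<zeta> \<bullet> i))))" for z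
    by (subst euclidean_inner) (simp add: cis_sum[symmetric] sum_negf)
  let ?h = "\<lambda>i x. cis (- (x * (\<zeta> \<bullet> i))) * complex_of_real (exp (- x\<^sup>2 / 2))"
  have "fourier (\<lambda>x. complex_of_real (gauss x)) \<zeta> = (LINT x|lborel. (\<Prod>i\<in>Basis. ?h i (x \<bullet> i)))"
    unfolding fourier_def * gauss_prod by (simp add: prod.distrib)
  also have "\<dots> = (\<Prod>i\<in>Basis. LINT x|lborel. ?h i x)"
    using gauss_real(1) by (intro integrable_prod_Basis(2) integrable_cis_mult integrable_of_real) auto
  also have "\<dots> = complex_of_real (sqrt (2 * pi) ^ DIM('a) * gauss \<zeta>)"
    by (simp only: gauss_real(2) gauss_prod prod.distrib prod_constant of_real_mult of_real_power
        of_real_prod)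
  finally show "fourier (\<lambda>x. complex_of_real (gauss x)) \<zeta> = complex_of_real (sqrt (2 * pi) ^ DIM('a)
      * gauss \<zeta>)" .
qed

text \<open>Gaussian summation: the iterated integral is regularised by a widening Gaussian, and the
  transform is moved from \<open>f\<close> onto that cutoff, where it is explicit. One factor
  \<open>?s\<close> comes from the transform of the Gaussian and one from its integral; together
  they make the constant.\<close>

theorem fourier_fourier:
  fixes f :: "'a::euclidean_space \<Rightarrow> complex"
  assumes f: "schwartz f"
  shows "fourier (fourier f) x = of_real ((2 * pi) ^ DIM('a)) * f (- x)"
proof -
  let ?n = "DIM('a)" and ?s = "complex_of_real (sqrt (2 * pi) ^ DIM('a))"
  have [measurable]: "f \<in> borel_measurable borel" using f by (rule schwartz_measurable)
  have If: "integrable lborel f" by (rule schwartz_integrable[OF f])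
  have Iff: "integrable lborel (fourier f)" by (rule schwartz_integrable[OF schwartz_fourier[OF f]])
  obtain C where C: "\<And>x. cmod (f x) * (1 + norm x) ^ 0 \<le> C" using rapidE[OF schwartz_rapid[OF f]] by metis
  define h where "h m = inverse (real (Suc m))" for m
  have h: "0 < h m" "h m \<le> 1" for m unfolding h_def by (auto simp: field_simps)
  have h0: "h \<longlonglongrightarrow> 0" unfolding h_def by (rule LIMSEQ_inverse_real_of_nat)
  \<comment> \<open>The transform of this modulated cutoff is a multiple of a Gaussian centred at
    \<open>- x\<close> of width \<open>h m\<close>. The centre explains the reflected argument in
    the theorem.\<close>
  define g where "g m \<zeta> = cis (- (\<zeta> \<bullet> x)) * complex_of_real (gauss (h m *\<^sub>R \<zeta>))" for m and \<zeta> :: 'a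
  have gm [measurable]: "g m \<in> borel_measurable borel" for m unfolding g_def by measurable
  have Ig: "integrable lborel (g m)" for m
  proof -
    have "integrable lborel (\<lambda>\<zeta>. gauss (0 + h m *\<^sub>R \<zeta>) :: real)"
      using integrable_lborel_affine[of gauss "h m" 0] fourier_gauss(1) h(1)[of m] by auto
    then show ?thesis unfolding g_def by (intro integrable_cis_mult integrable_of_real) auto
  qed
  have Fg: "of_real (h m ^ ?n) * fourier (g m) (- x + h m *\<^sub>R y) = ?s * of_real (gauss y)" for m y
  proof -
    have "fourier (g m) (- x + h m *\<^sub>R y) = (LINT \<zeta>|lborel. cis (- ((h m *\<^sub>R \<zeta>) \<bullet> y))
        * of_real (gauss (h m *\<^sub>R \<zeta>)))"
      unfolding fourier_def g_def
      by (rule Bochner_Integration.integral_cong) (auto simp: mult.assoc[symmetric] cis_mult inner_diff_right)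
    moreover have "fourier (\<lambda>\<zeta>. of_real (gauss \<zeta>)) y
        = (\<bar>h m\<bar> ^ ?n) *\<^sub>R (LINT \<zeta>|lborel. cis (- ((h m *\<^sub>R \<zeta>) \<bullet> y)) * of_real (gauss (h m *\<^sub>R \<zeta>)))"
      unfolding fourier_def
      by (subst integral_lborel_affine[where c="h m" and t=0]) (use h(1)[of m] in auto)
    ultimately show ?thesis using h(1)[of m] by (simp add: fourier_gauss(2) scaleR_conv_of_real)
  qed
  have "(LINT \<zeta>|lborel. fourier f \<zeta> * g m \<zeta>) = (LINT y|lborel. f (- x + h m *\<^sub>R y) * (?s
      * of_real (gauss y)))" for m
  proof -
    have "(LINT \<zeta>|lborel. fourier f \<zeta> * g m \<zeta>) = (LINT z|lborel. f z * fourier (g m) z)"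
      by (rule integral_fourier_mult[OF If Ig])
    also have "\<dots> = (\<bar>h m\<bar> ^ ?n) *\<^sub>R (LINT y|lborel. f (- x + h m *\<^sub>R y) * fourier (g m) (- x + h m *\<^sub>R y))"
      using h(1)[of m] by (intro integral_lborel_affine) auto
    also have "\<dots> = (LINT y|lborel. f (- x + h m *\<^sub>R y) * (of_real (h m ^ ?n) * fourier (g m) (- x
        + h m *\<^sub>R y)))"
      using h(1)[of m] by (simp add: scaleR_conv_of_real mult.left_commute[of "f _"] del: of_real_power)
    finally show ?thesis by (simp only: Fg)
  qed
  moreover have "(\<lambda>m. LINT \<zeta>|lborel. fourier f \<zeta> * g m \<zeta>) \<longlonglongrightarrow> (LINT \<zeta>|lborel. fourier f \<zeta> * cis (- (\<zeta> \<bullet> x)))"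
  proof (rule integral_dominated_convergence)
    show "integrable lborel (\<lambda>\<zeta>. cmod (fourier f \<zeta>))" using Iff by (rule integrable_norm)
    show "AE \<zeta> in lborel. (\<lambda>m. fourier f \<zeta> * g m \<zeta>) \<longlonglongrightarrow> fourier f \<zeta> * cis (- (\<zeta> \<bullet> x))"
    proof (intro always_eventually allI)
      fix \<zeta> :: 'a
      have "(\<lambda>m. fourier f \<zeta> * g m \<zeta>) \<longlonglongrightarrow> fourier f \<zeta> * (cis (- (\<zeta> \<bullet> x))
          * of_real (exp (- (norm (0 *\<^sub>R \<zeta>))\<^sup>2 / 2)))"
        unfolding g_def gauss_def by (intro tendsto_intros h0) simp
      then show "(\<lambda>m. fourier f \<zeta> * g m \<zeta>) \<longlonglongrightarrow> fourier f \<zeta> * cis (- (\<zeta> \<bullet> x))" by simp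
    qed
    show "AE \<zeta> in lborel. cmod (fourier f \<zeta> * g m \<zeta>) \<le> cmod (fourier f \<zeta>)" for m
      by (intro always_eventually allI) (simp add: norm_mult g_def mult_left_le abs_of_pos gauss_le_1
          gauss_pos)
  qed measurable
  \<comment> \<open>In the scaled variable \<open>y\<close> the Gaussian is fixed and only the
    argument of \<open>f\<close> moves to \<open>- x\<close>, so continuity and boundedness of
    \<open>f\<close> suffice.\<close>
  moreover have "(\<lambda>m. LINT y|lborel. f (- x + h m *\<^sub>R y) * (?s * of_real (gauss y)))
      \<longlonglongrightarrow> (LINT y|lborel. f (- x) * (?s * of_real (gauss (y::'a))))"
  proof (rule integral_dominated_convergence)
    show "integrable lborel (\<lambda>y::'a. (C * cmod ?s) * gauss y)" using fourier_gauss(1)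
        by (rule integrable_mult_right)
    show "AE y in lborel. (\<lambda>m. f (- x + h m *\<^sub>R y) * (?s * of_real (gauss y))) \<longlonglongrightarrow> f (- x) * (?s
        * of_real (gauss y))"
    proof (intro always_eventually allI)
      fix y :: 'a
      have "isCont f (- x + 0 *\<^sub>R y)" using f smooth_in_continuous unfolding schwartz_iff
          by (metis UNIV_I continuous_on_eq_continuous_at open_UNIV)
      then have "(\<lambda>m. f (- x + h m *\<^sub>R y)) \<longlonglongrightarrow> f (- x + 0 *\<^sub>R y)"
        by (rule isCont_tendsto_compose) (intro tendsto_intros h0)
      then show "(\<lambda>m. f (- x + h m *\<^sub>R y) * (?s * of_real (gauss y))) \<longlonglongrightarrow> f (- x) * (?s * of_real (gauss y))"
        by (intro tendsto_intros) simp
    qed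
    show "AE y in lborel. cmod (f (- x + h m *\<^sub>R y) * (?s * of_real (gauss y))) \<le> (C * cmod ?s) * gauss y"
        for m
    proof (intro always_eventually allI)
      fix y :: 'a
      have "cmod (f (- x + h m *\<^sub>R y)) * (cmod ?s * gauss y) \<le> C * (cmod ?s * gauss y)"
        using C[of "- x + h m *\<^sub>R y"] gauss_pos[of y] by (intro mult_right_mono) auto
      then show "cmod (f (- x + h m *\<^sub>R y) * (?s * of_real (gauss y))) \<le> (C * cmod ?s) * gauss y"
        using gauss_pos[of y] by (simp add: norm_mult mult_ac)
    qed
  qed measurable
  ultimately have "(LINT \<zeta>|lborel. fourier f \<zeta> * cis (- (\<zeta> \<bullet> x))) = (LINT y|lborel. f (- x) * (?s
      * of_real (gauss (y::'a))))"
    by (simp add: LIMSEQ_unique)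
  moreover have "fourier (fourier f) x = (LINT \<zeta>|lborel. fourier f \<zeta> * cis (- (\<zeta> \<bullet> x)))"
    unfolding fourier_def[of "fourier f"] by (simp only: mult.commute)
  moreover have "(LINT y|lborel. complex_of_real (gauss (y::'a))) = ?s"
  proof -
    have "fourier (\<lambda>y::'a. complex_of_real (gauss y)) 0 = (LINT y|lborel. complex_of_real (gauss (y::'a)))"
      unfolding fourier_def by simp
    then show ?thesis unfolding fourier_gauss(2) by (simp add: gauss_def)
  qed
  moreover have "?s * ?s = of_real ((2 * pi) ^ DIM('a))"
  proof -
    have "sqrt (2 * pi) ^ DIM('a) * sqrt (2 * pi) ^ DIM('a) = (2 * pi) ^ DIM('a)"
    proof -
      have "sqrt (2 * pi) * sqrt (2 * pi) = 2 * pi" using pi_ge_zero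
          by (simp only: real_sqrt_mult_self abs_of_nonneg)
      then show ?thesis by (simp only: power_mult_distrib[symmetric])
    qed
    then show ?thesis by (metis of_real_mult)
  qed
  ultimately have "fourier (fourier f) x = f (- x) * of_real ((2 * pi) ^ DIM('a))"
    by (simp only: integral_mult_right_zero)
  then show ?thesis by (simp only: mult.commute)
qed

lemma fourier_reflect:
  fixes f :: "'a::euclidean_space \<Rightarrow> complex"
  assumes [measurable]: "f \<in> borel_measurable borel"
  shows "fourier (\<lambda>z. f (- z)) \<zeta> = fourier f (- \<zeta>)"
  unfolding fourier_def
  using integral_lborel_reflect[of "\<lambda>z. cis (- (z \<bullet> - \<zeta>)) * f z"] by simp

lemma fourier_cnj: "fourier (\<lambda>z. cnj (f z)) \<zeta> = cnj (fourier f (- \<zeta>))"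
proof -
  have "fourier (\<lambda>z. cnj (f z)) \<zeta> = (LINT z|lborel. cnj (cis (- (z \<bullet> (- \<zeta>))) * f z))"
    unfolding fourier_def by (simp add: cis_cnj)
  also have "\<dots> = cnj (fourier f (- \<zeta>))" unfolding fourier_def by (rule Bochner_Integration.integral_cnj)
  finally show ?thesis .
qed

lemma fourier_add:
  assumes "schwartz f" "schwartz g"
  shows "fourier (\<lambda>z. f z + g z) \<zeta> = fourier f \<zeta> + fourier g \<zeta>"
proof -
  have "integrable lborel (\<lambda>z. cis (- (z \<bullet> \<zeta>)) * f z)" "integrable lborel (\<lambda>z. cis (- (z \<bullet> \<zeta>)) * g z)"
    by (intro integrable_cis_mult schwartz_integrable assms; simp)+
  then show ?thesis unfolding fourier_def by (simp add: distrib_left)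
qed

lemma fourier_cmult: "fourier (\<lambda>z. c * f z) \<zeta> = c * fourier f \<zeta>"
  unfolding fourier_def by (simp add: mult.left_commute[of _ c])

lemma fourier_diff:
  assumes "schwartz f" "schwartz g"
  shows "fourier (\<lambda>z. f z - g z) \<zeta> = fourier f \<zeta> - fourier g \<zeta>"
  using fourier_add[OF assms(1) schwartz_cmult[OF assms(2), of "-1"], of \<zeta>] fourier_cmult[of "-1" g \<zeta>] by simp

definition ifourier :: "('a::euclidean_space \<Rightarrow> complex) \<Rightarrow> 'a \<Rightarrow> complex" where
  "ifourier f z = of_real (inverse ((2 * pi) ^ DIM('a))) * fourier f (- z)"

lemma two_pi_power_inverse: "complex_of_real (inverse ((2 * pi) ^ n)) * complex_of_real ((2 * pi) ^ n) = 1"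
proof -
  have "inverse ((2 * pi) ^ n) * (2 * pi) ^ n = 1" by (rule left_inverse) simp
  then show ?thesis by (metis of_real_mult of_real_1)
qed

lemma schwartz_ifourier: "schwartz f \<Longrightarrow> schwartz (ifourier f)"
  unfolding ifourier_def by (intro schwartz_cmult schwartz_reflect schwartz_fourier)

lemma fourier_ifourier:
  fixes f :: "'a::euclidean_space \<Rightarrow> complex"
  assumes "schwartz f"
  shows "fourier (ifourier f) = f"
proof
  fix \<zeta>
  have "fourier (ifourier f) \<zeta> = of_real (inverse ((2 * pi) ^ DIM('a))) * fourier (fourier f) (- \<zeta>)"
    unfolding ifourier_def using assms
    by (simp only: fourier_cmult fourier_reflect fourier_measurable schwartz_measurable)
  also have "\<dots> = f \<zeta>"
    by (simp only: fourier_fourier[OF assms] minus_minus mult.assoc[symmetric] two_pi_power_inverse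
        mult_1_left)
  finally show "fourier (ifourier f) \<zeta> = f \<zeta>" .
qed

lemma ifourier_fourier:
  fixes f :: "'a::euclidean_space \<Rightarrow> complex"
  assumes "schwartz f"
  shows "ifourier (fourier f) = f"
  by (simp only: ifourier_def fourier_fourier[OF assms] fun_eq_iff minus_minus mult.assoc[symmetric]
      two_pi_power_inverse mult_1_left simp_thms)

text \<open>The function \<open>f\<close> is written as an inverse transform, and the outer
  transform is moved onto the reflected and modulated \<open>g\<close>, whose transform is that of
  \<open>g\<close> at \<open>\<zeta> - \<eta>\<close>.\<close>

lemma fourier_mult:
  fixes f g :: "'a::euclidean_space \<Rightarrow> complex"
  assumes f: "schwartz f" and g: "schwartz g"
  shows "fourier (\<lambda>z. f z * g z) \<zeta>
    = of_real (inverse ((2 * pi) ^ DIM('a))) * (LINT \<eta>|lborel. fourier f \<eta> * fourier g (\<zeta> - \<eta>))"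
proof -
  let ?c = "complex_of_real (inverse ((2 * pi) ^ DIM('a)))"
  let ?G = "\<lambda>z. cis (z \<bullet> \<zeta>) * g (- z)"
  have [measurable]: "f \<in> borel_measurable borel" "g \<in> borel_measurable borel"
    using f g by (auto intro: schwartz_measurable)
  have IG: "integrable lborel ?G"
    by (intro integrable_cis_mult integrable_lborel_reflect schwartz_integrable g) simp
  have If: "integrable lborel (fourier f)" by (intro schwartz_integrable schwartz_fourier f)
  have FG: "fourier ?G \<eta> = fourier g (\<zeta> - \<eta>)" for \<eta>
    unfolding fourier_def
    using integral_lborel_reflect[of "\<lambda>z. cis (- (z \<bullet> (\<zeta> - \<eta>))) * g z"]
    by (simp add: mult.assoc[symmetric] cis_mult inner_diff_right)
  have "fourier (\<lambda>z. f z * g z) \<zeta> = (LINT z|lborel. cis (- (z \<bullet> \<zeta>)) * (ifourier (fourier f) z * g z))"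
    by (simp add: fourier_def ifourier_fourier[OF f])
  also have "\<dots> = (LINT z|lborel. ?c * (fourier (fourier f) (- z) * (cis (- (z \<bullet> \<zeta>)) * g z)))"
    by (simp add: ifourier_def mult_ac)
  also have "\<dots> = ?c * (LINT z|lborel. fourier (fourier f) (- z) * (cis (- (z \<bullet> \<zeta>)) * g z))"
    by (rule integral_mult_right_zero)
  also have "(LINT z|lborel. fourier (fourier f) (- z) * (cis (- (z \<bullet> \<zeta>)) * g z))
      = (LINT z|lborel. fourier (fourier f) z * ?G z)"
    using integral_lborel_reflect[of "\<lambda>z. fourier (fourier f) z * ?G z"] by simp
  also have "\<dots> = (LINT \<eta>|lborel. fourier f \<eta> * fourier ?G \<eta>)"
    by (rule integral_fourier_mult[OF If IG])
  finally show ?thesis by (simp add: FG)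
qed

section \<open>Weighted norms and their limits\<close>

text \<open>Slowness of \<open>m\<close> makes weighted norms of Schwartz functions finite and lets
  the squared weight be absorbed into test functions. Slowness of \<open>1 / m\<close> is what
  bounds pairings by the norm.\<close>

definition weight :: "('a::euclidean_space \<Rightarrow> real) \<Rightarrow> bool" where
  "weight m \<longleftrightarrow> (\<forall>z. 0 < m z) \<and> slow (\<lambda>z. complex_of_real (m z)) \<and> slow (\<lambda>z. complex_of_real (1 / m z))"

definition wnorm :: "('a::euclidean_space \<Rightarrow> real) \<Rightarrow> ('a \<Rightarrow> complex) \<Rightarrow> real" where
  "wnorm m f = sqrt (LINT \<zeta>|lborel. (m \<zeta> * cmod (fourier f \<zeta>))\<^sup>2)"

lemma weight_pos: "weight m \<Longrightarrow> 0 < m z" by (simp add: weight_def)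

lemma weight_measurable:
  assumes "weight m" shows "m \<in> borel_measurable borel"
proof -
  have "(\<lambda>z. complex_of_real (m z)) \<in> borel_measurable borel"
    using assms smooth_in_measurable unfolding weight_def by blast
  then have "(\<lambda>z. Re (complex_of_real (m z))) \<in> borel_measurable borel" by measurable
  then show ?thesis by simp
qed

lemma slow_integrable_square:
  fixes f :: "'a::euclidean_space \<Rightarrow> complex"
  assumes m: "slow (\<lambda>z. complex_of_real (m z))" and f: "schwartz f"
  shows "integrable lborel (\<lambda>\<zeta>. (m \<zeta> * cmod (f \<zeta>))\<^sup>2)"
proof -
  let ?g = "\<lambda>\<zeta>. (complex_of_real (m \<zeta>) * complex_of_real (m \<zeta>)) * (f \<zeta> * cnj (f \<zeta>))"
  have "schwartz ?g"
    by (intro schwartz_slow_mult slow_mult m schwartz_mult schwartz_cnj f)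
  then have "integrable lborel (\<lambda>\<zeta>. Re (?g \<zeta>))" by (intro integrable_Re schwartz_integrable)
  moreover have "?g \<zeta> = complex_of_real ((m \<zeta> * cmod (f \<zeta>))\<^sup>2)" for \<zeta>
    by (simp only: complex_norm_square[symmetric] power_mult_distrib of_real_mult of_real_power
        power2_eq_square mult_ac)
  ultimately show ?thesis by (simp only: Re_complex_of_real)
qed

lemma weight_integrable:
  "weight m \<Longrightarrow> schwartz f \<Longrightarrow> integrable lborel (\<lambda>\<zeta>. (m \<zeta> * cmod (fourier f \<zeta>))\<^sup>2)"
  unfolding weight_def by (blast intro: slow_integrable_square schwartz_fourier)

lemma wnorm_nonneg [simp]: "0 \<le> wnorm m f" unfolding wnorm_def
    by (intro real_sqrt_ge_zero integral_nonneg_AE) auto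

lemma wnorm_square: "(wnorm m f)\<^sup>2 = (LINT \<zeta>|lborel. (m \<zeta> * cmod (fourier f \<zeta>))\<^sup>2)"
  unfolding wnorm_def by (intro real_sqrt_pow2 integral_nonneg_AE) auto

text \<open>For positive \<open>A\<close> and \<open>B\<close> the square of a sum satisfies
  \<open>(a + b)\<^sup>2 \<le> (A + B) * (a\<^sup>2 / A + b\<^sup>2 / B)\<close>. Integrated with
  \<open>A\<close> and \<open>B\<close> close to the two norms, this is Minkowski's
  inequality.\<close>

lemma L2_triangle:
  fixes a b c :: "'a \<Rightarrow> real"
  assumes a: "integrable M (\<lambda>x. (a x)\<^sup>2)" and b: "integrable M (\<lambda>x. (b x)\<^sup>2)" and c: "\<And>x. \<bar>c x\<bar> \<le> a x + b x"
  shows "sqrt (LINT x|M. (c x)\<^sup>2) \<le> sqrt (LINT x|M. (a x)\<^sup>2) + sqrt (LINT x|M. (b x)\<^sup>2)"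
proof (rule field_le_epsilon)
  fix e :: real assume "e > 0"
  \<comment> \<open>The added \<open>e / 2\<close> keeps the divisors positive when a norm
    vanishes.\<close>
  define A where "A = sqrt (LINT x|M. (a x)\<^sup>2) + e / 2"
  define B where "B = sqrt (LINT x|M. (b x)\<^sup>2) + e / 2"
  have nn: "0 \<le> sqrt (LINT x|M. (a x)\<^sup>2)" "0 \<le> sqrt (LINT x|M. (b x)\<^sup>2)"
    by (auto intro!: integral_nonneg_AE)
  have A: "A > 0" "sqrt (LINT x|M. (a x)\<^sup>2) \<le> A" and B: "B > 0" "sqrt (LINT x|M. (b x)\<^sup>2) \<le> B"
    using nn \<open>e > 0\<close> unfolding A_def B_def by linarith+
  have A2: "(LINT x|M. (a x)\<^sup>2) \<le> A\<^sup>2" and B2: "(LINT x|M. (b x)\<^sup>2) \<le> B\<^sup>2"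
    using A B by (auto intro: sqrt_le_D)
  have "(LINT x|M. (c x)\<^sup>2) \<le> (LINT x|M. (A + B) * ((a x)\<^sup>2 / A + (b x)\<^sup>2 / B))"
  proof (rule integral_mono')
    show "integrable M (\<lambda>x. (A + B) * ((a x)\<^sup>2 / A + (b x)\<^sup>2 / B))" using a b by simp
    fix x
    have "(c x)\<^sup>2 \<le> (a x + b x)\<^sup>2" using c[of x] by (simp add: abs_le_square_iff[symmetric])
    also have "\<dots> \<le> (A + B) * ((a x)\<^sup>2 / A + (b x)\<^sup>2 / B)"
    proof -
      have "(A + B) * ((a x)\<^sup>2 / A + (b x)\<^sup>2 / B) - (a x + b x)\<^sup>2 = (B * a x - A * b x)\<^sup>2 / (A * B)"
        using A B by (simp add: field_simps power2_eq_square)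
      moreover have "\<dots> \<ge> 0" using A B by simp
      ultimately show ?thesis by linarith
    qed
    finally show "(c x)\<^sup>2 \<le> (A + B) * ((a x)\<^sup>2 / A + (b x)\<^sup>2 / B)" .
    show "0 \<le> (A + B) * ((a x)\<^sup>2 / A + (b x)\<^sup>2 / B)" using A B by simp
  qed
  also have "\<dots> = (A + B) * ((LINT x|M. (a x)\<^sup>2) / A + (LINT x|M. (b x)\<^sup>2) / B)" using a b by simp
  also have "\<dots> \<le> (A + B) * (A\<^sup>2 / A + B\<^sup>2 / B)"
    using A B A2 B2 by (intro mult_left_mono add_mono divide_right_mono) auto
  also have "\<dots> = (A + B)\<^sup>2" using A B by (simp add: power2_eq_square)
  finally have "sqrt (LINT x|M. (c x)\<^sup>2) \<le> A + B" using A B by (intro real_le_lsqrt) auto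
  then show "sqrt (LINT x|M. (c x)\<^sup>2) \<le> sqrt (LINT x|M. (a x)\<^sup>2) + sqrt (LINT x|M. (b x)\<^sup>2) + e"
    unfolding A_def B_def by simp
qed

lemma L2_Cauchy_Schwarz:
  fixes a b :: "'a \<Rightarrow> real"
  assumes a: "integrable M (\<lambda>x. (a x)\<^sup>2)" and b: "integrable M (\<lambda>x. (b x)\<^sup>2)"
    and [measurable]: "a \<in> borel_measurable M" "b \<in> borel_measurable M"
    and nn: "\<And>x. 0 \<le> a x" "\<And>x. 0 \<le> b x"
  shows "integrable M (\<lambda>x. a x * b x)"
    and "(LINT x|M. a x * b x) \<le> sqrt (LINT x|M. (a x)\<^sup>2) * sqrt (LINT x|M. (b x)\<^sup>2)"
proof -
  show ab: "integrable M (\<lambda>x. a x * b x)"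
  proof (rule Bochner_Integration.integrable_bound)
    show "integrable M (\<lambda>x. (a x)\<^sup>2 + (b x)\<^sup>2)" using a b by simp
    have "\<bar>a x * b x\<bar> \<le> (a x)\<^sup>2 + (b x)\<^sup>2" for x
    proof -
      have "2 * (a x * b x) \<le> (a x)\<^sup>2 + (b x)\<^sup>2" using sum_squares_bound[of "a x" "b x"] by simp
      moreover have "0 \<le> a x * b x" using nn by simp
      ultimately show ?thesis by simp
    qed
    then show "AE x in M. norm (a x * b x) \<le> norm ((a x)\<^sup>2 + (b x)\<^sup>2)" by simp
  qed simp
  have "ennreal ((LINT x|M. a x * b x)\<^sup>2) = (\<integral>\<^sup>+x. ennreal (a x) * ennreal (b x) \<partial>M)\<^sup>2"
    using nn nn_integral_eq_integral[OF ab] by (simp add: ennreal_mult[symmetric] ennreal_power)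
  also have "\<dots> \<le> (\<integral>\<^sup>+x. (ennreal (a x))\<^sup>2 \<partial>M) * (\<integral>\<^sup>+x. (ennreal (b x))\<^sup>2 \<partial>M)"
    by (rule Cauchy_Schwarz_nn_integral) auto
  also have "\<dots> = ennreal ((LINT x|M. (a x)\<^sup>2) * (LINT x|M. (b x)\<^sup>2))"
    using nn nn_integral_eq_integral[OF a] nn_integral_eq_integral[OF b]
        by (simp add: ennreal_power ennreal_mult)
  finally have "(LINT x|M. a x * b x)\<^sup>2 \<le> (LINT x|M. (a x)\<^sup>2) * (LINT x|M. (b x)\<^sup>2)"
    by (subst (asm) ennreal_le_iff) (auto intro!: mult_nonneg_nonneg integral_nonneg_AE)
  then show "(LINT x|M. a x * b x) \<le> sqrt (LINT x|M. (a x)\<^sup>2) * sqrt (LINT x|M. (b x)\<^sup>2)"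
    by (subst real_sqrt_mult[symmetric]) (rule real_le_rsqrt)
qed

lemma wnorm_add:
  assumes m: "weight m" and f: "schwartz f" and g: "schwartz g"
  shows "wnorm m (\<lambda>z. f z + g z) \<le> wnorm m f + wnorm m g"
  unfolding wnorm_def
proof (rule L2_triangle)
  fix x show "\<bar>m x * cmod (fourier (\<lambda>z. f z + g z) x)\<bar> \<le> m x * cmod (fourier f x) + m x * cmod (fourier g x)"
    using weight_pos[OF m, of x] norm_triangle_ineq[of "fourier f x" "fourier g x"]
    by (simp add: fourier_add[OF f g] abs_mult distrib_left[symmetric])
qed (use assms weight_integrable in auto)

lemma wnorm_minus: "wnorm m (\<lambda>z. f z - g z) = wnorm m (\<lambda>z. g z - f z)"
proof -
  have "fourier (\<lambda>z. f z - g z) = (\<lambda>\<zeta>. - fourier (\<lambda>z. g z - f z) \<zeta>)"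
    using fourier_cmult[of "-1" "\<lambda>z. g z - f z"] by (auto simp: fun_eq_iff)
  then show ?thesis by (simp add: wnorm_def)
qed

lemma wnorm_triangle:
  assumes m: "weight m" and "schwartz f" "schwartz g" "schwartz h"
  shows "wnorm m (\<lambda>z. f z - h z) \<le> wnorm m (\<lambda>z. f z - g z) + wnorm m (\<lambda>z. g z - h z)"
  using wnorm_add[OF m, of "\<lambda>z. f z - g z" "\<lambda>z. g z - h z"] assms by (simp add: schwartz_diff)

lemma wnorm_le_diff:
  assumes m: "weight m" and "schwartz f" "schwartz g"
  shows "wnorm m f \<le> wnorm m (\<lambda>z. f z - g z) + wnorm m g"
  using wnorm_add[OF m, of "\<lambda>z. f z - g z" "g"] assms by (simp add: schwartz_diff)

lemma wnorm_abs_diff: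
  assumes m: "weight m" and "schwartz f" "schwartz g"
  shows "\<bar>wnorm m f - wnorm m g\<bar> \<le> wnorm m (\<lambda>z. f z - g z)"
  using wnorm_le_diff[OF assms] wnorm_le_diff[OF assms(1,3,2)] wnorm_minus[of m f g] by linarith

section \<open>Convergence of Schwartz functions in a weighted norm\<close>

text \<open>The pattern of \<open>X_tendsto\<close> for an arbitrary weight;
  \<open>X_tendsto_eq\<close> specialises it. The limit functional is the only link between
  sequences for different weights.\<close>

definition wtendsto :: "('a::euclidean_space \<Rightarrow> real) \<Rightarrow> (nat \<Rightarrow> 'a \<Rightarrow> complex) \<Rightarrow> (('a \<Rightarrow> complex) \<Rightarrow> complex) \<Rightarrow>
    bool" where
  "wtendsto m f u \<longleftrightarrow>
     (\<forall>k. schwartz (f k)) \<and>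
     (\<forall>e>0. \<exists>N. \<forall>j\<ge>N. \<forall>k\<ge>N. wnorm m (\<lambda>z. f j z - f k z) < e) \<and>
     (\<forall>\<psi>. schwartz \<psi> \<longrightarrow> (\<lambda>k. LINT z|lborel. f k z * \<psi> z) \<longlonglongrightarrow> u \<psi>)"

lemma wtendsto_schwartz: "wtendsto m f u \<Longrightarrow> schwartz (f k)" by (simp add: wtendsto_def)

lemma wtendsto_pairing: "wtendsto m f u \<Longrightarrow> schwartz \<psi> \<Longrightarrow> (\<lambda>k. LINT z|lborel. f k z * \<psi> z) \<longlonglongrightarrow> u \<psi>"
  by (simp add: wtendsto_def)

lemma wtendsto_Cauchy:
  assumes "wtendsto m f u" "e > 0"
  obtains N where "\<And>j k. j \<ge> N \<Longrightarrow> k \<ge> N \<Longrightarrow> wnorm m (\<lambda>z. f j z - f k z) < e"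
  using assms unfolding wtendsto_def by meson

lemma schwartz_pairing_integrable: "schwartz f \<Longrightarrow> schwartz g \<Longrightarrow> integrable lborel (\<lambda>z. f z * g z)"
  by (intro schwartz_integrable schwartz_mult)

text \<open>Expand the squared norm of the difference and drop the square of the norm of
  \<open>g\<close>. With \<open>g\<close> a fixed late term of a Cauchy sequence the first summand
  is small and the second is a pairing with a fixed function.\<close>

lemma wnorm_polarization:
  assumes m: "weight m" and f: "schwartz f" and g: "schwartz g"
  shows "(wnorm m f)\<^sup>2 \<le> (wnorm m (\<lambda>z. f z - g z))\<^sup>2
    + 2 * Re (LINT \<zeta>|lborel. fourier f \<zeta> * (complex_of_real (m \<zeta>) * complex_of_real (m \<zeta>)
        * cnj (fourier g \<zeta>)))"
proof -
  let ?i = "\<lambda>\<zeta>. fourier f \<zeta> * (complex_of_real (m \<zeta>) * complex_of_real (m \<zeta>) * cnj (fourier g \<zeta>))"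
  have "slow (\<lambda>z. complex_of_real (m z))" using m by (simp add: weight_def)
  then have I: "integrable lborel ?i"
    by (intro schwartz_integrable schwartz_mult schwartz_slow_mult slow_mult schwartz_cnj schwartz_fourier
        f g)
  have "(wnorm m f)\<^sup>2 \<le> (LINT \<zeta>|lborel. (m \<zeta> * cmod (fourier (\<lambda>z. f z - g z) \<zeta>))\<^sup>2 + 2 * Re (?i \<zeta>))"
    unfolding wnorm_square
  proof (rule integral_mono)
    show "integrable lborel (\<lambda>\<zeta>. (m \<zeta> * cmod (fourier (\<lambda>z. f z - g z) \<zeta>))\<^sup>2 + 2 * Re (?i \<zeta>))"
      by (intro Bochner_Integration.integrable_add integrable_mult_right integrable_Re
          weight_integrable[OF m] schwartz_diff f g I)
    fix \<zeta>
    have *: "(cmod (a - b))\<^sup>2 = (cmod a)\<^sup>2 + (cmod b)\<^sup>2 - 2 * Re (a * cnj b)" for a b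
      by (simp only: cmod_power2) (simp add: power2_eq_square algebra_simps)
    have "(m \<zeta> * cmod (fourier (\<lambda>z. f z - g z) \<zeta>))\<^sup>2
        = (m \<zeta>)\<^sup>2 * (cmod (fourier f \<zeta>))\<^sup>2 + (m \<zeta>)\<^sup>2 * (cmod (fourier g \<zeta>))\<^sup>2 - 2 * ((m \<zeta>)\<^sup>2
            * Re (fourier f \<zeta> * cnj (fourier g \<zeta>)))"
      unfolding fourier_diff[OF f g] power_mult_distrib *
      by (simp only: right_diff_distrib distrib_left mult.left_commute[of _ 2])
    moreover have "Re (?i \<zeta>) = (m \<zeta>)\<^sup>2 * Re (fourier f \<zeta> * cnj (fourier g \<zeta>))"
      by (simp add: power2_eq_square algebra_simps)
    ultimately show "(m \<zeta> * cmod (fourier f \<zeta>))\<^sup>2 \<le> (m \<zeta> * cmod (fourier (\<lambda>z. f z - g z) \<zeta>))\<^sup>2 + 2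
        * Re (?i \<zeta>)"
      by (simp add: power_mult_distrib)
  qed (rule weight_integrable[OF m f])
  also have "\<dots> = (LINT \<zeta>|lborel. (m \<zeta> * cmod (fourier (\<lambda>z. f z - g z) \<zeta>))\<^sup>2) + 2 * Re (LINT \<zeta>|lborel. ?i \<zeta>)"
    using weight_integrable[OF m schwartz_diff[OF f g]] I
    by (simp only: Bochner_Integration.integral_add integrable_mult_right integral_mult_right_zero
        integrable_Re integral_Re)
  finally show ?thesis by (simp only: wnorm_square)
qed

text \<open>Since \<open>m\<close> is smooth, the \<open>m\<close>-inner product with a fixed term of the sequence is the pairing
  with a Schwartz function, so it tends to zero.\<close>

lemma wtendsto_zero_norm:
  assumes m: "weight m" and h: "wtendsto m h (\<lambda>\<psi>. 0)"
  shows "(\<lambda>k. wnorm m (h k)) \<longlonglongrightarrow> 0"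
proof (rule LIMSEQ_I)
  fix e :: real assume e: "e > 0"
  note S = wtendsto_schwartz[OF h]
  obtain N where N: "\<And>j k. j \<ge> N \<Longrightarrow> k \<ge> N \<Longrightarrow> wnorm m (\<lambda>z. h j z - h k z) < e / 2"
    using wtendsto_Cauchy[OF h, of "e/2"] e by auto
  let ?\<psi> = "\<lambda>\<zeta>. complex_of_real (m \<zeta>) * complex_of_real (m \<zeta>) * cnj (fourier (h N) \<zeta>)"
  have "slow (\<lambda>z. complex_of_real (m z))" using m by (simp add: weight_def)
  then have \<psi>: "schwartz ?\<psi>"
    by (intro schwartz_slow_mult slow_mult schwartz_cnj schwartz_fourier S)
  have eq: "(LINT \<zeta>|lborel. fourier (h k) \<zeta> * ?\<psi> \<zeta>) = (LINT z|lborel. h k z * fourier ?\<psi> z)" for k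
    by (intro integral_fourier_mult schwartz_integrable S \<psi>)
  have "(\<lambda>k. LINT \<zeta>|lborel. fourier (h k) \<zeta> * ?\<psi> \<zeta>) \<longlonglongrightarrow> 0"
    unfolding eq by (rule wtendsto_pairing[OF h schwartz_fourier[OF \<psi>]])
  \<comment> \<open>The thresholds add up: \<open>e\<^sup>2 / 4\<close> from the Cauchy term and
    less than \<open>2 * (e\<^sup>2 / 4)\<close> from the pairing stay below
    \<open>e\<^sup>2\<close>.\<close>
  from LIMSEQ_D[OF this, of "e\<^sup>2 / 4"] e
  obtain M where M: "\<And>k. k \<ge> M \<Longrightarrow> cmod (LINT \<zeta>|lborel. fourier (h k) \<zeta> * ?\<psi> \<zeta>) < e\<^sup>2 / 4" by auto
  show "\<exists>no. \<forall>k\<ge>no. norm (wnorm m (h k) - 0) < e"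
  proof (intro exI allI impI)
    fix k assume k: "k \<ge> max N M"
    have "(wnorm m (h k))\<^sup>2 \<le> (wnorm m (\<lambda>z. h k z - h N z))\<^sup>2 + 2 * Re (LINT \<zeta>|lborel. fourier (h k) \<zeta>
        * ?\<psi> \<zeta>)"
      by (rule wnorm_polarization[OF m S S])
    moreover have "(wnorm m (\<lambda>z. h k z - h N z))\<^sup>2 < (e / 2)\<^sup>2"
      using N[of k N] k wnorm_nonneg by (intro power_strict_mono) auto
    moreover have "Re (LINT \<zeta>|lborel. fourier (h k) \<zeta> * ?\<psi> \<zeta>) < e\<^sup>2 / 4"
      by (rule order_le_less_trans[OF complex_Re_le_cmod M]) (use k in simp)
    moreover have "(e / 2)\<^sup>2 = e\<^sup>2 / 4" "e\<^sup>2 > 0" using e by (simp_all add: power_divide)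
    ultimately have "(wnorm m (h k))\<^sup>2 < e\<^sup>2" by linarith
    then have "wnorm m (h k) < e" using e by (simp add: power_less_imp_less_base)
    then show "norm (wnorm m (h k) - 0) < e" using wnorm_nonneg[of m "h k"] by simp
  qed
qed

lemma wtendsto_diff:
  assumes m: "weight m" and f: "wtendsto m f u" and g: "wtendsto m g v"
  shows "wtendsto m (\<lambda>k z. f k z - g k z) (\<lambda>\<psi>. u \<psi> - v \<psi>)"
  unfolding wtendsto_def
proof (intro conjI allI impI)
  note S = wtendsto_schwartz[OF f] wtendsto_schwartz[OF g]
  show "schwartz (\<lambda>z. f k z - g k z)" for k by (intro schwartz_diff S)
  fix e :: real assume e: "e > 0"
  obtain N where N: "\<And>j k. j \<ge> N \<Longrightarrow> k \<ge> N \<Longrightarrow> wnorm m (\<lambda>z. f j z - f k z) < e / 2"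
    using wtendsto_Cauchy[OF f, of "e/2"] e by auto
  obtain M where M: "\<And>j k. j \<ge> M \<Longrightarrow> k \<ge> M \<Longrightarrow> wnorm m (\<lambda>z. g j z - g k z) < e / 2"
    using wtendsto_Cauchy[OF g, of "e/2"] e by auto
  show "\<exists>N. \<forall>j\<ge>N. \<forall>k\<ge>N. wnorm m (\<lambda>z. f j z - g j z - (f k z - g k z)) < e"
  proof (intro exI allI impI)
    fix j k assume jk: "j \<ge> max N M" "k \<ge> max N M"
    have "wnorm m (\<lambda>z. (f j z - f k z) + (g k z - g j z)) \<le> wnorm m (\<lambda>z. f j z - f k z)
        + wnorm m (\<lambda>z. g k z - g j z)"
      by (intro wnorm_add m schwartz_diff S)
    also have "\<dots> < e" using N[of j k] M[of k j] jk by simp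
    finally show "wnorm m (\<lambda>z. f j z - g j z - (f k z - g k z)) < e" by (simp add: algebra_simps)
  qed
next
  fix \<psi> :: "'a \<Rightarrow> complex" assume \<psi>: "schwartz \<psi>"
  have "(\<lambda>k. (LINT z|lborel. f k z * \<psi> z) - (LINT z|lborel. g k z * \<psi> z)) \<longlonglongrightarrow> u \<psi> - v \<psi>"
    by (intro tendsto_diff wtendsto_pairing[OF f \<psi>] wtendsto_pairing[OF g \<psi>])
  moreover have "(LINT z|lborel. f k z * \<psi> z) - (LINT z|lborel. g k z * \<psi> z)
      = (LINT z|lborel. (f k z - g k z) * \<psi> z)" for k
    using schwartz_pairing_integrable[OF wtendsto_schwartz[OF f] \<psi>] schwartz_pairing_integrable[OF
        wtendsto_schwartz[OF g] \<psi>]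
    by (simp add: left_diff_distrib)
  ultimately show "(\<lambda>k. LINT z|lborel. (f k z - g k z) * \<psi> z) \<longlonglongrightarrow> u \<psi> - v \<psi>" by simp
qed

lemma wtendsto_same_limit:
  assumes m: "weight m" and f: "wtendsto m f u" and g: "wtendsto m g u"
  shows "(\<lambda>k. wnorm m (\<lambda>z. f k z - g k z)) \<longlonglongrightarrow> 0"
  using wtendsto_zero_norm[OF m] wtendsto_diff[OF m f g] by simp

definition wlim_norm :: "('a::euclidean_space \<Rightarrow> real) \<Rightarrow> (('a \<Rightarrow> complex) \<Rightarrow> complex) \<Rightarrow> real" where
  "wlim_norm m u = (THE r. \<exists>f. wtendsto m f u \<and> (\<lambda>k. wnorm m (f k)) \<longlonglongrightarrow> r)"

text \<open>Makes the definite description in \<open>wlim_norm\<close> meaningful: norms converge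
  along every approximating sequence, and two such sequences differ by a null sequence, hence have
  the same limit.\<close>

lemma wnorm_tendsto:
  assumes m: "weight m" and f: "wtendsto m f u"
  shows "(\<lambda>k. wnorm m (f k)) \<longlonglongrightarrow> wlim_norm m u"
proof -
  have "Cauchy (\<lambda>k. wnorm m (f k))"
  proof (rule CauchyI)
    fix e :: real assume "e > 0"
    then obtain N where N: "\<And>j k. j \<ge> N \<Longrightarrow> k \<ge> N \<Longrightarrow> wnorm m (\<lambda>z. f j z - f k z) < e"
      using wtendsto_Cauchy[OF f] by blast
    have "norm (wnorm m (f j) - wnorm m (f k)) < e" if "j \<ge> N" "k \<ge> N" for j k
      using wnorm_abs_diff[OF m wtendsto_schwartz[OF f, of j] wtendsto_schwartz[OF f, of k]] N[OF that]
          by simp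
    then show "\<exists>M. \<forall>j\<ge>M. \<forall>k\<ge>M. norm (wnorm m (f j) - wnorm m (f k)) < e" by blast
  qed
  then obtain r where r: "(\<lambda>k. wnorm m (f k)) \<longlonglongrightarrow> r"
    using Cauchy_convergent_iff convergent_def by blast
  have "wlim_norm m u = r"
    unfolding wlim_norm_def
  proof (rule the_equality)
    show "\<exists>f. wtendsto m f u \<and> (\<lambda>k. wnorm m (f k)) \<longlonglongrightarrow> r" using f r by blast
    fix r' assume "\<exists>f. wtendsto m f u \<and> (\<lambda>k. wnorm m (f k)) \<longlonglongrightarrow> r'"
    then obtain g where g: "wtendsto m g u" "(\<lambda>k. wnorm m (g k)) \<longlonglongrightarrow> r'" by blast
    have "(\<lambda>k. wnorm m (g k) - wnorm m (f k)) \<longlonglongrightarrow> 0"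
    proof (rule Lim_null_comparison[OF _ wtendsto_same_limit[OF m g(1) f]])
      show "\<forall>\<^sub>F k in sequentially. norm (wnorm m (g k) - wnorm m (f k)) \<le> wnorm m (\<lambda>z. g k z - f k z)"
        using wnorm_abs_diff[OF m wtendsto_schwartz[OF g(1)] wtendsto_schwartz[OF f]] by simp
    qed
    moreover have "(\<lambda>k. wnorm m (g k) - wnorm m (f k)) \<longlonglongrightarrow> r' - r" by (intro tendsto_diff g r)
    ultimately show "r' = r" using LIMSEQ_unique by fastforce
  qed
  then show ?thesis using r by simp
qed

text \<open>The two indices are independent, which allows both comparing different sequences and
  proving the Cauchy property in \<open>product_close\<close>.\<close>

lemma wtendsto_close:
  assumes m: "weight m" and f: "wtendsto m f u" and g: "wtendsto m g u" and "e > 0"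
  obtains N where "\<And>j k. j \<ge> N \<Longrightarrow> k \<ge> N \<Longrightarrow> wnorm m (\<lambda>z. f j z - g k z) < e"
proof -
  note S = wtendsto_schwartz[OF f] wtendsto_schwartz[OF g]
  obtain N where N: "\<And>j k. j \<ge> N \<Longrightarrow> k \<ge> N \<Longrightarrow> wnorm m (\<lambda>z. f j z - f k z) < e / 2"
    using wtendsto_Cauchy[OF f, of "e/2"] \<open>e > 0\<close> by auto
  obtain M where M: "\<And>k. k \<ge> M \<Longrightarrow> wnorm m (\<lambda>z. f k z - g k z) < e / 2"
    using LIMSEQ_D[OF wtendsto_same_limit[OF m f g], of "e/2"] \<open>e > 0\<close> by auto
  have "wnorm m (\<lambda>z. f j z - g k z) < e" if "j \<ge> max N M" "k \<ge> max N M" for j k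
    using wnorm_triangle[OF m S(1)[of j] S(1)[of k] S(2)[of k]] N[of j k] M[of k] that by simp
  then show ?thesis using that by blast
qed

lemma wnorm_fourier_triangle:
  assumes m: "weight m1" "weight m2" and S: "schwartz f" "schwartz g"
    and h: "\<And>\<zeta>. m \<zeta> * cmod (fourier h \<zeta>) \<le> m1 \<zeta> * cmod (fourier f \<zeta>) + m2 \<zeta> * cmod (fourier g \<zeta>)"
    and "\<And>\<zeta>. 0 \<le> m \<zeta>"
  shows "wnorm m h \<le> wnorm m1 f + wnorm m2 g"
  unfolding wnorm_def using assms weight_integrable by (intro L2_triangle) (auto simp: abs_mult)

text \<open>With \<open>a = 1 / (1 + (m2 / m1)\<^sup>2)\<close> and \<open>b = 1 - a\<close>, both \<open>a * m1\<close> and \<open>a * m2\<close> are at most \<open>m1\<close>, and both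
  \<open>b * m1\<close> and \<open>b * m2\<close> are at most \<open>m2\<close>. Hence applying the multipliers \<open>a\<close> and \<open>b\<close> to the two sequences
  and adding gives one sequence that converges in both spaces.\<close>

lemma wtendsto_common:
  fixes m1 m2 :: "'a::euclidean_space \<Rightarrow> real"
  assumes m1: "weight m1" and m2: "weight m2" and f: "wtendsto m1 f u" and g: "wtendsto m2 g u"
  shows "\<exists>h. wtendsto m1 h u \<and> wtendsto m2 h u"
proof -
  note S = wtendsto_schwartz[OF f] wtendsto_schwartz[OF g]
  define q where "q z = 1 + (m2 z * (1 / m1 z)) * (m2 z * (1 / m1 z))" for z
  have "slow (\<lambda>z. 1 + (complex_of_real (m2 z) * complex_of_real (1 / m1 z)) * (complex_of_real (m2 z)
      * complex_of_real (1 / m1 z)))"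
    using m1 m2 unfolding weight_def by (intro slow_add slow_mult slow_const) auto
  then have "slow (\<lambda>z. complex_of_real (q z))" unfolding q_def by simp
  moreover have q1: "q z \<ge> 1" for z by (simp add: q_def)
  ultimately have "slow (\<lambda>z. complex_of_real (q z powr (-1)))" by (rule slow_powr)
  moreover define a where "a z = 1 / q z" for z
  moreover have "q z powr (-1) = a z" for z using q1[of z] by (simp add: a_def powr_minus_divide)
  ultimately have a: "slow (\<lambda>z. complex_of_real (a z))" by simp
  define b where "b z = 1 - a z" for z
  have b: "slow (\<lambda>z. complex_of_real (b z))"
    using slow_add[OF slow_const[of 1] slow_mult[OF slow_const[of "-1"] a]] by (simp add: b_def)
  have pos: "m1 z > 0" "m2 z > 0" for z using m1 m2 by (auto simp: weight_pos)
  have ab0: "0 \<le> a z" "0 \<le> b z" for z using q1[of z] unfolding a_def b_def by auto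
  have bounds: "a z * m1 z \<le> m1 z" "a z * m2 z \<le> m1 z" "b z * m1 z \<le> m2 z" "b z * m2 z \<le> m2 z" for z
  proof -
    define r where "r = m2 z / m1 z"
    have r: "r > 0" "m2 z = r * m1 z" using pos[of z] by (auto simp: r_def)
    have az: "a z = 1 / (1 + r * r)" by (simp add: a_def q_def r_def)
    have p: "1 + r * r > 0" using r by (intro add_pos_pos mult_pos_pos) auto
    have bz: "b z = r * r / (1 + r * r)" unfolding b_def az using p by (simp add: field_simps)
    have r2: "r \<le> 1 + r * r" using sum_squares_bound[of r 1] r(1) by (simp add: power2_eq_square)
    show "a z * m1 z \<le> m1 z" using pos[of z] q1[of z] by (simp add: a_def divide_le_eq)
    show "a z * m2 z \<le> m1 z" unfolding az r(2) using p r2 pos[of z] by (simp add: divide_le_eq)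
    show "b z * m1 z \<le> m2 z" unfolding bz r(2) using p r2 r pos[of z] by (simp add: divide_le_eq mult_ac)
    show "b z * m2 z \<le> m2 z" using ab0[of z] pos[of z] by (simp add: b_def algebra_simps)
  qed
  define h where "h k = ifourier (\<lambda>\<zeta>. complex_of_real (a \<zeta>) * fourier (f k) \<zeta> + complex_of_real (b \<zeta>)
      * fourier (g k) \<zeta>)" for k
  have Sab: "schwartz (\<lambda>\<zeta>. complex_of_real (a \<zeta>) * fourier (f k) \<zeta> + complex_of_real (b \<zeta>)
      * fourier (g k) \<zeta>)" for k
    by (intro schwartz_add schwartz_slow_mult a b schwartz_fourier S)
  then have Sh: "schwartz (h k)" for k unfolding h_def by (rule schwartz_ifourier)
  have Fh: "fourier (h k) \<zeta> = complex_of_real (a \<zeta>) * fourier (f k) \<zeta> + complex_of_real (b \<zeta>)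
      * fourier (g k) \<zeta>" for k \<zeta>
    unfolding h_def fourier_ifourier[OF Sab] ..
  have h_diff: "wnorm m (\<lambda>z. h j z - h k z) \<le> wnorm m1 (\<lambda>z. f j z - f k z) + wnorm m2 (\<lambda>z. g j z - g k z)"
    if m: "m = m1 \<or> m = m2" for m j k
  proof (intro wnorm_fourier_triangle m1 m2 schwartz_diff S)
    fix \<zeta>
    show m0: "0 \<le> m \<zeta>" using m pos[of \<zeta>] by (auto intro: less_imp_le)
    have "m \<zeta> * cmod (fourier (\<lambda>z. h j z - h k z) \<zeta>)
       = m \<zeta> * cmod (complex_of_real (a \<zeta>) * fourier (\<lambda>z. f j z - f k z) \<zeta> + complex_of_real (b \<zeta>)
           * fourier (\<lambda>z. g j z - g k z) \<zeta>)"
      by (simp add: fourier_diff S Sh Fh algebra_simps)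
    also have "\<dots> \<le> m \<zeta> * (a \<zeta> * cmod (fourier (\<lambda>z. f j z - f k z) \<zeta>) + b \<zeta>
        * cmod (fourier (\<lambda>z. g j z - g k z) \<zeta>))"
      using ab0[of \<zeta>] by (intro mult_left_mono norm_triangle_le m0) (simp add: norm_mult)
    also have "\<dots> = (a \<zeta> * m \<zeta>) * cmod (fourier (\<lambda>z. f j z - f k z) \<zeta>) + (b \<zeta> * m \<zeta>)
        * cmod (fourier (\<lambda>z. g j z - g k z) \<zeta>)"
      by (simp add: algebra_simps)
    also have "\<dots> \<le> m1 \<zeta> * cmod (fourier (\<lambda>z. f j z - f k z) \<zeta>) + m2 \<zeta> * cmod (fourier (\<lambda>z. g j z - g k z) \<zeta>)"
      using m bounds[of \<zeta>] by (intro add_mono mult_right_mono) auto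
    finally show "m \<zeta> * cmod (fourier (\<lambda>z. h j z - h k z) \<zeta>)
       \<le> m1 \<zeta> * cmod (fourier (\<lambda>z. f j z - f k z) \<zeta>) + m2 \<zeta> * cmod (fourier (\<lambda>z. g j z - g k z) \<zeta>)" .
  qed
  \<comment> \<open>The multipliers are moved onto the test function: its inverse transform is
    multiplied by \<open>a\<close> and by \<open>b\<close>, which splits the test function into two
    Schwartz functions \<open>?A\<close> and \<open>?B\<close>.\<close>
  have h_pairing: "(\<lambda>k. LINT z|lborel. h k z * \<psi> z) \<longlonglongrightarrow> u \<psi>" if \<psi>: "schwartz \<psi>" for \<psi>
  proof -
    define \<theta> where "\<theta> = ifourier \<psi>"
    have \<theta>: "schwartz \<theta>" "fourier \<theta> = \<psi>" unfolding \<theta>_def by (auto intro: schwartz_ifourier \<psi> fourier_ifourier)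
    let ?A = "fourier (\<lambda>\<zeta>. complex_of_real (a \<zeta>) * \<theta> \<zeta>)" and ?B = "fourier (\<lambda>\<zeta>. complex_of_real (b \<zeta>) * \<theta> \<zeta>)"
    have Sa: "schwartz (\<lambda>\<zeta>. complex_of_real (a \<zeta>) * \<theta> \<zeta>)" and Sb: "schwartz (\<lambda>\<zeta>. complex_of_real (b \<zeta>) * \<theta> \<zeta>)"
      by (intro schwartz_slow_mult a b \<theta>)+
    have AB: "?A z + ?B z = \<psi> z" for z
      using fourier_add[OF Sa Sb, of z] by (simp add: distrib_right[symmetric] b_def \<theta>(2) of_real_diff)
    have "(LINT z|lborel. h k z * \<psi> z) = (LINT z|lborel. f k z * ?A z) + (LINT z|lborel. g k z * ?B z)" for k
    proof -
      have "(LINT z|lborel. h k z * \<psi> z) = (LINT \<zeta>|lborel. fourier (h k) \<zeta> * \<theta> \<zeta>)"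
        unfolding \<theta>(2)[symmetric] by (intro integral_fourier_mult[symmetric] schwartz_integrable Sh \<theta>)
      also have "\<dots> = (LINT \<zeta>|lborel. fourier (f k) \<zeta> * (complex_of_real (a \<zeta>) * \<theta> \<zeta>) + fourier (g k) \<zeta>
          * (complex_of_real (b \<zeta>) * \<theta> \<zeta>))"
        unfolding Fh by (simp add: algebra_simps)
      also have "\<dots> = (LINT \<zeta>|lborel. fourier (f k) \<zeta> * (complex_of_real (a \<zeta>) * \<theta> \<zeta>))
          + (LINT \<zeta>|lborel. fourier (g k) \<zeta> * (complex_of_real (b \<zeta>) * \<theta> \<zeta>))"
        by (intro Bochner_Integration.integral_add schwartz_pairing_integrable schwartz_fourier S Sa Sb)
      also have "\<dots> = (LINT z|lborel. f k z * ?A z) + (LINT z|lborel. g k z * ?B z)"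
        by (intro arg_cong2[where f="(+)"] integral_fourier_mult schwartz_integrable S Sa Sb)
      finally show ?thesis .
    qed
    moreover have "(\<lambda>k. (LINT z|lborel. f k z * ?A z) + (LINT z|lborel. g k z * ?B z)) \<longlonglongrightarrow> u ?A + u ?B"
      by (intro tendsto_add wtendsto_pairing[OF f] wtendsto_pairing[OF g] schwartz_fourier Sa Sb)
    \<comment> \<open>The functional \<open>u\<close> carries no linearity assumption, so additivity
      at these two functions is read off from the pairings with the single sequence
      \<open>f\<close>.\<close>
    moreover have "u ?A + u ?B = u \<psi>"
    proof (rule LIMSEQ_unique)
      show "(\<lambda>k. LINT z|lborel. f k z * \<psi> z) \<longlonglongrightarrow> u \<psi>" by (rule wtendsto_pairing[OF f \<psi>])
      have "(LINT z|lborel. f k z * ?A z) + (LINT z|lborel. f k z * ?B z) = (LINT z|lborel. f k z * \<psi> z)"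
          for k
        unfolding AB[symmetric] distrib_left
        by (intro Bochner_Integration.integral_add[symmetric] schwartz_pairing_integrable schwartz_fourier
            S Sa Sb)
      moreover have "(\<lambda>k. (LINT z|lborel. f k z * ?A z) + (LINT z|lborel. f k z * ?B z)) \<longlonglongrightarrow> u ?A + u ?B"
        by (intro tendsto_add wtendsto_pairing[OF f] schwartz_fourier Sa Sb)
      ultimately show "(\<lambda>k. LINT z|lborel. f k z * \<psi> z) \<longlonglongrightarrow> u ?A + u ?B" by simp
    qed
    ultimately show ?thesis by simp
  qed
  have "wtendsto m h u" if m: "m = m1 \<or> m = m2" for m
    unfolding wtendsto_def
  proof (intro conjI allI impI Sh h_pairing)
    fix e :: real assume e: "e > 0"
    obtain N where N: "\<And>j k. j \<ge> N \<Longrightarrow> k \<ge> N \<Longrightarrow> wnorm m1 (\<lambda>z. f j z - f k z) < e / 2"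
      using wtendsto_Cauchy[OF f, of "e/2"] e by auto
    obtain M where M: "\<And>j k. j \<ge> M \<Longrightarrow> k \<ge> M \<Longrightarrow> wnorm m2 (\<lambda>z. g j z - g k z) < e / 2"
      using wtendsto_Cauchy[OF g, of "e/2"] e by auto
    have "wnorm m (\<lambda>z. h j z - h k z) < e" if "j \<ge> max N M" "k \<ge> max N M" for j k
      using h_diff[OF m, of j k] N[of j k] M[of j k] that by simp
    then show "\<exists>N. \<forall>j\<ge>N. \<forall>k\<ge>N. wnorm m (\<lambda>z. h j z - h k z) < e" by blast
  qed
  then show ?thesis by blast
qed

text \<open>Cauchy-Schwarz on the frequency side, with \<open>m\<close> given to one factor and
  \<open>1 / m\<close> to the other.\<close>

lemma wnorm_pairing:
  fixes m :: "'a::euclidean_space \<Rightarrow> real"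
  assumes m: "weight m" and \<psi>: "schwartz \<psi>"
  obtains C where "C \<ge> 0" "\<And>h. schwartz h \<Longrightarrow> cmod (LINT z|lborel. h z * \<psi> z) \<le> C * wnorm m h"
proof
  define \<theta> where "\<theta> = ifourier \<psi>"
  have \<theta>: "schwartz \<theta>" "fourier \<theta> = \<psi>" unfolding \<theta>_def by (auto intro: schwartz_ifourier \<psi> fourier_ifourier)
  have [measurable]: "m \<in> borel_measurable borel" "\<theta> \<in> borel_measurable borel"
    using weight_measurable[OF m] schwartz_measurable[OF \<theta>(1)] by auto
  let ?C = "sqrt (LINT \<zeta>|lborel. (1 / m \<zeta> * cmod (\<theta> \<zeta>))\<^sup>2)"
  show "?C \<ge> 0" by (intro real_sqrt_ge_zero integral_nonneg_AE) auto
  fix h :: "'a \<Rightarrow> complex" assume h: "schwartz h"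
  have [measurable]: "h \<in> borel_measurable borel" by (rule schwartz_measurable[OF h])
  have I2: "integrable lborel (\<lambda>\<zeta>. (1 / m \<zeta> * cmod (\<theta> \<zeta>))\<^sup>2)"
    using m \<theta>(1) unfolding weight_def by (intro slow_integrable_square) auto
  have "(LINT z|lborel. h z * \<psi> z) = (LINT \<zeta>|lborel. fourier h \<zeta> * \<theta> \<zeta>)"
    unfolding \<theta>(2)[symmetric] by (intro integral_fourier_mult[symmetric] schwartz_integrable h \<theta>)
  also have "cmod \<dots> \<le> (LINT \<zeta>|lborel. cmod (fourier h \<zeta> * \<theta> \<zeta>))" by (rule integral_norm_bound)
  also have "\<dots> = (LINT \<zeta>|lborel. (m \<zeta> * cmod (fourier h \<zeta>)) * (1 / m \<zeta> * cmod (\<theta> \<zeta>)))"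
    using weight_pos[OF m] by (intro Bochner_Integration.integral_cong) (auto simp: norm_mult
        less_imp_neq[symmetric])
  also have "\<dots> \<le> sqrt (LINT \<zeta>|lborel. (m \<zeta> * cmod (fourier h \<zeta>))\<^sup>2) * ?C"
    using weight_integrable[OF m h] I2 less_imp_le[OF weight_pos[OF m]] by (intro L2_Cauchy_Schwarz(2)) auto
  finally show "cmod (LINT z|lborel. h z * \<psi> z) \<le> ?C * wnorm m h" by (simp add: wnorm_def mult.commute)
qed

text \<open>Completeness in distributional form: the pairings of a norm-Cauchy sequence are Cauchy
  numbers, and their limits define the functional.\<close>

lemma Cauchy_wtendsto:
  fixes m :: "'a::euclidean_space \<Rightarrow> real"
  assumes m: "weight m" and S: "\<And>k. schwartz (f k)"
    and C: "\<And>e. e > 0 \<Longrightarrow> \<exists>N. \<forall>j\<ge>N. \<forall>k\<ge>N. wnorm m (\<lambda>z. f j z - f k z) < e"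
  shows "\<exists>u. wtendsto m f u"
proof -
  have "convergent (\<lambda>k. LINT z|lborel. f k z * \<psi> z)" if \<psi>: "schwartz \<psi>" for \<psi>
    unfolding Cauchy_convergent_iff[symmetric]
  proof (rule CauchyI)
    fix e :: real assume e: "e > 0"
    obtain D where D: "D \<ge> 0" "\<And>h. schwartz h \<Longrightarrow> cmod (LINT z|lborel. h z * \<psi> z) \<le> D * wnorm m h"
      using wnorm_pairing[OF m \<psi>] by blast
    \<comment> \<open>The denominator \<open>D + 1\<close> is positive even for
      \<open>D = 0\<close>.\<close>
    obtain N where N: "\<And>j k. j \<ge> N \<Longrightarrow> k \<ge> N \<Longrightarrow> wnorm m (\<lambda>z. f j z - f k z) < e / (D + 1)"
      using C[of "e / (D + 1)"] e D(1) by auto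
    have "norm ((LINT z|lborel. f j z * \<psi> z) - (LINT z|lborel. f k z * \<psi> z)) < e" if "j \<ge> N" "k \<ge> N" for j k
    proof -
      have "(LINT z|lborel. f j z * \<psi> z) - (LINT z|lborel. f k z * \<psi> z) = (LINT z|lborel. (f j z - f k z)
          * \<psi> z)"
        using schwartz_pairing_integrable[OF S \<psi>] by (simp add: left_diff_distrib)
      also have "cmod \<dots> \<le> D * wnorm m (\<lambda>z. f j z - f k z)" by (intro D schwartz_diff S)
      also have "\<dots> \<le> (D + 1) * wnorm m (\<lambda>z. f j z - f k z)" using wnorm_nonneg[of m "\<lambda>z. f j z - f k z"]
          by (simp add: algebra_simps)
      also have "\<dots> < (D + 1) * (e / (D + 1))" using D(1) by (intro mult_strict_left_mono N that) auto
      finally show ?thesis using D(1) by simp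
    qed
    then show "\<exists>M. \<forall>j\<ge>M. \<forall>k\<ge>M. norm ((LINT z|lborel. f j z * \<psi> z) - (LINT z|lborel. f k z * \<psi> z)) < e"
        by blast
  qed
  then have "wtendsto m f (\<lambda>\<psi>. lim (\<lambda>k. LINT z|lborel. f k z * \<psi> z))"
    unfolding wtendsto_def using S C by (simp add: convergent_LIMSEQ_iff[symmetric])
  then show ?thesis by blast
qed

text \<open>A term \<open>f N\<close> between \<open>g j\<close> and \<open>g k\<close> gives the
  Cauchy property, and the bound on pairings carries the limit over. This yields independence of a
  product from the approximating sequences.\<close>

lemma wtendsto_perturb:
  fixes m :: "'a::euclidean_space \<Rightarrow> real"
  assumes m: "weight m" and f: "wtendsto m f u" and S: "\<And>k. schwartz (g k)"
    and close: "\<And>e. e > 0 \<Longrightarrow> \<exists>N. \<forall>j\<ge>N. \<forall>k\<ge>N. wnorm m (\<lambda>z. g j z - f k z) < e"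
  shows "wtendsto m g u"
  unfolding wtendsto_def
proof (intro conjI allI impI S)
  note Sf = wtendsto_schwartz[OF f]
  fix e :: real assume e: "e > 0"
  obtain N where N: "\<And>j k. j \<ge> N \<Longrightarrow> k \<ge> N \<Longrightarrow> wnorm m (\<lambda>z. g j z - f k z) < e / 2"
    using close[of "e/2"] e by auto
  have "wnorm m (\<lambda>z. g j z - g k z) < e" if "j \<ge> N" "k \<ge> N" for j k
    using wnorm_triangle[OF m S[of j] Sf[of N] S[of k]] N[of j N] N[of k N] wnorm_minus[of m "f N"
        "g k"] that by simp
  then show "\<exists>N. \<forall>j\<ge>N. \<forall>k\<ge>N. wnorm m (\<lambda>z. g j z - g k z) < e" by blast
next
  note Sf = wtendsto_schwartz[OF f]
  fix \<psi> :: "'a \<Rightarrow> complex" assume \<psi>: "schwartz \<psi>"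
  obtain D where D: "D \<ge> 0" "\<And>h. schwartz h \<Longrightarrow> cmod (LINT z|lborel. h z * \<psi> z) \<le> D * wnorm m h"
    using wnorm_pairing[OF m \<psi>] by blast
  have "(\<lambda>k. wnorm m (\<lambda>z. g k z - f k z)) \<longlonglongrightarrow> 0"
  proof (rule LIMSEQ_I)
    fix e :: real assume "e > 0"
    then obtain N where "\<And>j k. j \<ge> N \<Longrightarrow> k \<ge> N \<Longrightarrow> wnorm m (\<lambda>z. g j z - f k z) < e"
      using close by meson
    then show "\<exists>no. \<forall>n\<ge>no. norm (wnorm m (\<lambda>z. g n z - f n z) - 0) < e" by auto
  qed
  then have "(\<lambda>k. D * wnorm m (\<lambda>z. g k z - f k z)) \<longlonglongrightarrow> 0" by (rule tendsto_mult_right_zero)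
  then have "(\<lambda>k. LINT z|lborel. (g k z - f k z) * \<psi> z) \<longlonglongrightarrow> 0"
    by (rule Lim_null_comparison[rotated]) (intro always_eventually allI D schwartz_diff S Sf)
  then have "(\<lambda>k. (LINT z|lborel. (g k z - f k z) * \<psi> z) + (LINT z|lborel. f k z * \<psi> z)) \<longlonglongrightarrow> 0 + u \<psi>"
    by (rule tendsto_add) (rule wtendsto_pairing[OF f \<psi>])
  moreover have "(LINT z|lborel. (g k z - f k z) * \<psi> z) + (LINT z|lborel. f k z * \<psi> z)
      = (LINT z|lborel. g k z * \<psi> z)" for k
    using schwartz_pairing_integrable[OF S \<psi>] schwartz_pairing_integrable[OF Sf \<psi>]
        by (simp add: left_diff_distrib)
  ultimately show "(\<lambda>k. LINT z|lborel. g k z * \<psi> z) \<longlonglongrightarrow> u \<psi>" by simp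
qed

section \<open>Integrals of modulation weights\<close>

lemma japanese_ge_1: "1 \<le> japanese x" by (simp add: japanese_def)
lemma japanese_pos: "0 < japanese x" using japanese_ge_1[of x] by linarith
lemma japanese_neq_0 [simp]: "japanese x \<noteq> 0" using japanese_pos[of x] by simp
lemma japanese_square: "(japanese x)\<^sup>2 = 1 + (norm x)\<^sup>2" by (simp add: japanese_def)
lemma japanese_minus [simp]: "japanese (- x) = japanese x" by (simp add: japanese_def)
lemma japanese_minus_commute: "japanese (x - y) = japanese (y - x)"
    by (simp add: japanese_def norm_minus_commute)
lemma norm_le_japanese: "norm x \<le> japanese x" unfolding japanese_def by (rule real_le_rsqrt) simp
lemma japanese_le: "japanese x \<le> 1 + norm x"
  unfolding japanese_def by (rule real_le_lsqrt) (auto simp: power2_sum)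

lemma japanese_measurable [measurable]: "(japanese :: 'a::euclidean_space \<Rightarrow> real) \<in> borel_measurable borel"
  unfolding japanese_def by measurable

lemma cball_measurable [measurable]: "cball (x::'a::euclidean_space) r \<in> sets borel" by simp

lemma japanese_mono:
  assumes "norm x \<le> c * norm y" "1 \<le> c" shows "japanese x \<le> c * japanese y"
proof (rule power2_le_imp_le)
  have "(norm x)\<^sup>2 \<le> (c * norm y)\<^sup>2" using assms by (intro power_mono) auto
  moreover have "1 \<le> c\<^sup>2" using assms by simp
  ultimately show "(japanese x)\<^sup>2 \<le> (c * japanese y)\<^sup>2"
    by (simp add: japanese_square power_mult_distrib distrib_left)
  show "0 \<le> c * japanese y" using assms japanese_pos[of y] by simp
qed

lemma japanese_diff_le: "japanese (x - y) \<le> japanese x + japanese y"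
proof (rule power2_le_imp_le)
  have "(norm (x - y))\<^sup>2 \<le> (norm x + norm y)\<^sup>2" by (intro power_mono norm_triangle_ineq4) auto
  moreover have "norm x * norm y \<le> japanese x * japanese y"
    using japanese_pos[of x] by (intro mult_mono norm_le_japanese) auto
  ultimately show "(japanese (x - y))\<^sup>2 \<le> (japanese x + japanese y)\<^sup>2"
    by (simp add: japanese_square power2_sum)
  show "0 \<le> japanese x + japanese y" using japanese_pos[of y] japanese_pos[of x] by simp
qed

lemma norm_line_derivative:
  fixes x v :: "'a::real_inner"
  shows "((\<lambda>t. (norm (x + t *\<^sub>R v))\<^sup>2) has_real_derivative 2 * ((x + t *\<^sub>R v) \<bullet> v)) (at t)"
  unfolding power2_norm_eq_inner
  by (auto intro!: derivative_eq_intros simp: has_real_derivative_iff_has_vector_derivative inner_commute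
      algebra_simps
      has_vector_derivative_def has_field_derivative_def)

lemma japanese_line_derivative:
  fixes x v :: "'a::real_inner"
  shows "((\<lambda>t. japanese (x + t *\<^sub>R v)) has_real_derivative ((x + t *\<^sub>R v) \<bullet> v) / japanese (x
      + t *\<^sub>R v)) (at t)"
proof -
  define g where "g t = 1 + (norm (x + t *\<^sub>R v))\<^sup>2" for t
  have g: "(g has_real_derivative 0 + 2 * ((x + t *\<^sub>R v) \<bullet> v)) (at t)"
    unfolding g_def by (intro DERIV_add DERIV_const norm_line_derivative)
  have "0 < g t" unfolding g_def by (simp add: add_pos_nonneg)
  then have "(sqrt has_real_derivative inverse (sqrt (g t)) / 2) (at (g t))" by (rule DERIV_real_sqrt)
  from DERIV_chain[OF this g]
  have "(sqrt \<circ> g has_real_derivative inverse (sqrt (g t)) / 2 * (0 + 2 * ((x + t *\<^sub>R v) \<bullet> v))) (at t)" .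
  moreover have "inverse q / 2 * (0 + 2 * a) = a / q" for q a :: real by (cases "q
      = 0") (simp_all add: field_simps)
  ultimately have "(sqrt \<circ> g has_real_derivative ((x + t *\<^sub>R v) \<bullet> v) / sqrt (g t)) (at t)" by (simp only:)
  then show ?thesis unfolding japanese_def g_def o_def .
qed

text \<open>Keeps the Klein-Gordon part a bounded perturbation in every estimate of a phase
  derivative.\<close>

lemma japanese_derivative_bound:
  fixes x v :: "'a::real_inner"
  shows "\<bar>(x \<bullet> v) / japanese x\<bar> \<le> norm v"
proof -
  have "\<bar>x \<bullet> v\<bar> \<le> norm x * norm v" by (rule Cauchy_Schwarz_ineq2)
  also have "\<dots> \<le> norm v * japanese x" by (subst mult.commute) (rule mult_left_mono[OF norm_le_japanese
      norm_ge_zero])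
  finally show ?thesis using japanese_pos[of x] by (simp add: pos_divide_le_eq)
qed

section \<open>One-dimensional integrals of bracket powers\<close>

abbreviation jp :: "real \<Rightarrow> real \<Rightarrow> ennreal" where
  "jp p x \<equiv> ennreal (japanese x powr (- p))"

definition jpI :: "real \<Rightarrow> ennreal" where
  "jpI p = (\<integral>\<^sup>+x. jp p x \<partial>lborel)"

lemma jp_le_1: "0 \<le> p \<Longrightarrow> jp p x \<le> 1"
proof -
  assume "0 \<le> p"
  then have "japanese x powr (- p) \<le> japanese x powr 0" using japanese_ge_1[of x] by (intro powr_mono) auto
  then show "jp p x \<le> 1" using japanese_ge_1[of x] by simp
qed

text \<open>The bracket is comparable to \<open>1 + \<bar>x\<bar>\<close>, whose powers have
  explicit antiderivatives on each half line. The exponent used later is \<open>2 * b\<close> with b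
  > 1/2.\<close>

lemma jpI_finite:
  assumes p: "p > 1" shows "jpI p < \<top>"
proof -
  let ?f = "\<lambda>x::real. (1 + x) powr (- p)"
  let ?F = "\<lambda>x::real. - ((1 + x) powr (1 - p)) / (p - 1)"
  have half: "(\<integral>\<^sup>+x\<in>{0..}. ennreal (?f x) \<partial>lborel) = ennreal (0 - ?F 0)"
  proof (rule nn_integral_FTC_atLeast)
    fix x :: real assume x: "0 \<le> x"
    have "((\<lambda>x. (1 + x) powr (1 - p)) has_real_derivative (1 - p) * (1 + x) powr (- p)) (at x)"
      using x by (auto intro!: derivative_eq_intros)
    from DERIV_cdivide[OF DERIV_minus[OF this], of "p - 1"]
    have "(?F has_real_derivative - ((1 - p) * (1 + x) powr (- p)) / (p - 1)) (at x)" .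
    moreover have "- ((1 - p) * (1 + x) powr (- p)) / (p - 1) = ?f x"
      using p by (simp add: field_simps)
    ultimately show "(?F has_real_derivative ?f x) (at x)" by simp
  next
    have "((\<lambda>x. (1 + x) powr (1 - p)) \<longlongrightarrow> 0) at_top"
      using p by (intro tendsto_neg_powr filterlim_tendsto_add_at_top[OF tendsto_const] filterlim_ident) auto
    from tendsto_divide[OF tendsto_minus[OF this] tendsto_const[of "p - 1"]] p
    show "(?F \<longlongrightarrow> 0) at_top" by simp
  qed auto
  have pw: "japanese x powr (- p) \<le> 2 powr p * (1 + \<bar>x\<bar>) powr (- p)" for x :: real
  proof -
    have "1 + \<bar>x\<bar> \<le> 2 * japanese x" using japanese_ge_1[of x] norm_le_japanese[of x] by simp
    then have "(2 * japanese x) powr (- p) \<le> (1 + \<bar>x\<bar>) powr (- p)" using p by (intro powr_mono2') auto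
    then have "2 powr p * (2 powr (- p) * japanese x powr (- p)) \<le> 2 powr p * (1 + \<bar>x\<bar>) powr (- p)"
      using japanese_pos[of x] by (intro mult_left_mono) (auto simp: powr_mult)
    then show ?thesis by (simp add: mult.assoc[symmetric] powr_add[symmetric])
  qed
  have neg: "(\<integral>\<^sup>+x. ennreal (?f (- x)) * indicator {0..} (- x) \<partial>lborel)
      = (\<integral>\<^sup>+x\<in>{0..}. ennreal (?f x) \<partial>lborel)"
    using nn_integral_real_affine[of "\<lambda>x. ennreal (?f x) * indicator {0..} x" "-1" 0] by simp
  have "jpI p \<le> (\<integral>\<^sup>+x. ennreal (2 powr p) * (ennreal (?f x) * indicator {0..} x + ennreal (?f (- x))
      * indicator {0..} (- x)) \<partial>lborel)"
    unfolding jpI_def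
  proof (rule nn_integral_mono)
    fix x :: real
    have "jp p x \<le> ennreal (2 powr p * (1 + \<bar>x\<bar>) powr (- p))" using pw by (rule ennreal_leI)
    also have "\<dots> = ennreal (2 powr p) * ennreal (?f \<bar>x\<bar>)" by (simp add: ennreal_mult)
    also have "ennreal (?f \<bar>x\<bar>) \<le> ennreal (?f x) * indicator {0..} x + ennreal (?f (- x))
        * indicator {0..} (- x)"
      by (auto simp: indicator_def abs_if)
    finally show "jp p x \<le> ennreal (2 powr p) * (ennreal (?f x) * indicator {0..} x + ennreal (?f (- x))
        * indicator {0..} (- x))"
      by (simp add: mult_left_mono)
  qed
  also have "\<dots> = ennreal (2 powr p) * (ennreal (0 - ?F 0) + ennreal (0 - ?F 0))"
    by (subst nn_integral_cmult, measurable, subst nn_integral_add, measurable) (simp only: neg half)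
  also have "\<dots> < \<top>" by (simp add: ennreal_mult_less_top)
  finally show ?thesis .
qed

text \<open>The larger of the two brackets is at least half the bracket of the difference, so its
  weight is exchanged for one in \<open>u - v\<close>. Adding both weights on the right covers the
  two cases.\<close>

lemma jp_mult_bound:
  assumes p: "p \<ge> 0"
  shows "jp p u * jp p v \<le> ennreal (2 powr p) * jp p (u - v) * (jp p u + jp p v)"
proof -
  have key: "jp p v \<le> ennreal (2 powr p) * jp p (u - v)" if "japanese u \<le> japanese v" for u v :: real
  proof -
    have "japanese (u - v) \<le> 2 * japanese v" using japanese_diff_le[of u v] that by linarith
    then have "(2 * japanese v) powr (- p) \<le> japanese (u - v) powr (- p)"
      using p japanese_pos[of "u - v"] by (intro powr_mono2') auto
    then have "2 powr p * (2 powr (- p) * japanese v powr (- p)) \<le> 2 powr p * japanese (u - v) powr (- p)"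
      using japanese_pos[of v] by (intro mult_left_mono) (auto simp: powr_mult)
    then have "japanese v powr (- p) \<le> 2 powr p * japanese (u - v) powr (- p)"
      by (simp add: mult.assoc[symmetric] powr_add[symmetric])
    then show ?thesis by (simp add: ennreal_mult[symmetric])
  qed
  show ?thesis
  proof (cases "japanese u \<le> japanese v")
    case True
    have "jp p u * jp p v \<le> jp p u * (ennreal (2 powr p) * jp p (u - v))"
        by (intro mult_left_mono key True) auto
    also have "\<dots> \<le> ennreal (2 powr p) * jp p (u - v) * (jp p u + jp p v)" by (simp add: distrib_left mult_ac)
    finally show ?thesis .
  next
    case False
    then have "jp p u * jp p v \<le> (ennreal (2 powr p) * jp p (v - u)) * jp p v"
        by (intro mult_right_mono key) auto
    also have "\<dots> \<le> ennreal (2 powr p) * jp p (u - v) * (jp p u + jp p v)"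
      by (simp add: distrib_left mult_ac japanese_minus_commute[of v u])
    finally show ?thesis .
  qed
qed

text \<open>The time integration: two modulation weights sharing the variable \<open>x\<close> merge
  into one weight in which only the difference of the two phases survives.\<close>

lemma jp_convolution:
  assumes p: "p \<ge> 0"
  shows "(\<integral>\<^sup>+x. jp p (x + a) * jp p (x + c) \<partial>lborel) \<le> ennreal (2 powr p) * (jpI p + jpI p) * jp p (a - c)"
proof -
  have tr: "(\<integral>\<^sup>+x. jp p (x + a) \<partial>lborel) = jpI p" for a
    unfolding jpI_def using nn_integral_real_affine[of "jp p" 1 a] by (simp add: add.commute)
  have "(\<integral>\<^sup>+x. jp p (x + a) * jp p (x + c) \<partial>lborel)
      \<le> (\<integral>\<^sup>+x. ennreal (2 powr p) * jp p (a - c) * (jp p (x + a) + jp p (x + c)) \<partial>lborel)"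
  proof (rule nn_integral_mono)
    fix x
    show "jp p (x + a) * jp p (x + c) \<le> ennreal (2 powr p) * jp p (a - c) * (jp p (x + a) + jp p (x + c))"
      using jp_mult_bound[OF p, of "x + a" "x + c"] by simp
  qed
  also have "\<dots> = ennreal (2 powr p) * jp p (a - c) * (jpI p + jpI p)"
    by (subst nn_integral_cmult, measurable, subst nn_integral_add, measurable) (simp only: tr)
  finally show ?thesis by (simp only: mult_ac)
qed

text \<open>Taking the phase as new variable turns \<open>\<phi>'\<close> into the Jacobian, so the
  integral is at most that of the bracket power over the whole line. The bound does not depend on
  the phase or the interval; \<open>s\<close> is the direction of monotonicity.\<close>

lemma jp_substitution:
  assumes der: "\<And>t. l \<le> t \<Longrightarrow> t \<le> r \<Longrightarrow> (\<phi> has_real_derivative \<phi>' t) (at t)"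
    and cont: "continuous_on {l..r} \<phi>'" and s: "s = 1 \<or> s = -1"
    and w: "\<And>t. l \<le> t \<Longrightarrow> t \<le> r \<Longrightarrow> 0 \<le> w t \<and> w t \<le> s * \<phi>' t"
  shows "(\<integral>\<^sup>+t. jp p (\<phi> t) * ennreal (w t) * indicator {l..r} t \<partial>lborel) \<le> jpI p"
proof (cases "l \<le> r")
  case True
  let ?f = "\<lambda>x. japanese (x::real) powr (- p)" and ?g = "\<lambda>t. s * \<phi> t" and ?g' = "\<lambda>t. s * \<phi>' t"
  \<comment> \<open>The bracket is even, so a decreasing phase may be replaced by its
    negative.\<close>
  have js: "japanese (s * x) = japanese x" for x :: real using s by auto
  have "(\<integral>\<^sup>+t. jp p (\<phi> t) * ennreal (w t) * indicator {l..r} t \<partial>lborel)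
    \<le> (\<integral>\<^sup>+t. ennreal (?f (?g t) * ?g' t * indicator {l..r} t) \<partial>lborel)"
  proof (rule nn_integral_mono)
    fix t
    show "jp p (\<phi> t) * ennreal (w t) * indicator {l..r} t \<le> ennreal (?f (?g t) * ?g' t * indicator {l..r} t)"
      using w[of t] by (auto simp: indicator_def js ennreal_mult[symmetric] intro!: ennreal_leI
          mult_left_mono)
  qed
  also have "\<dots> = (\<integral>\<^sup>+x. ennreal (?f x * indicator {?g l..?g r} x) \<partial>lborel)"
  proof (rule nn_integral_substitution[symmetric])
    show "set_borel_measurable borel {?g l..?g r} ?f" unfolding set_borel_measurable_def by measurable
    show "(?g has_real_derivative ?g' t) (at t)" if "t \<in> {l..r}" for t
      using der that by (auto intro!: derivative_eq_intros)
    show "continuous_on {l..r} ?g'" by (intro continuous_intros cont)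
    show "0 \<le> ?g' t" if "t \<in> {l..r}" for t using w[of t] that by auto
  qed (rule True)
  also have "\<dots> \<le> jpI p" unfolding jpI_def by (intro nn_integral_mono) (auto simp: indicator_def)
  finally show ?thesis .
qed simp

text \<open>Monotone convergence over the intervals from \<open>l\<close> to \<open>l + i\<close>,
  on each of which the same bound holds.\<close>

lemma jp_substitution_atLeast:
  assumes der: "\<And>t. l \<le> t \<Longrightarrow> (\<phi> has_real_derivative \<phi>' t) (at t)"
    and cont: "continuous_on {l..} \<phi>'" and s: "s = 1 \<or> s = -1"
    and w: "\<And>t. l \<le> t \<Longrightarrow> 0 \<le> w t \<and> w t \<le> s * \<phi>' t"
    and [measurable]: "\<phi> \<in> borel_measurable borel" "w \<in> borel_measurable borel"
  shows "(\<integral>\<^sup>+t. jp p (\<phi> t) * ennreal (w t) * indicator {l..} t \<partial>lborel) \<le> jpI p"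
proof -
  let ?F = "\<lambda>t. jp p (\<phi> t) * ennreal (w t)"
  have "(\<integral>\<^sup>+t. ?F t * indicator {l..} t \<partial>lborel) \<le> (\<integral>\<^sup>+t. (SUP i. ?F t * indicator {l..l
      + real i} t) \<partial>lborel)"
  proof (rule nn_integral_mono)
    fix t
    obtain i :: nat where "t - l \<le> real i" using real_arch_simple by blast
    then have "?F t * indicator {l..} t \<le> ?F t * indicator {l..l + real i} t" by (auto simp: indicator_def)
    also have "\<dots> \<le> (SUP i. ?F t * indicator {l..l + real i} t)" by (rule SUP_upper) simp
    finally show "?F t * indicator {l..} t \<le> (SUP i. ?F t * indicator {l..l + real i} t)" .
  qed
  also have "\<dots> = (SUP i. \<integral>\<^sup>+t. ?F t * indicator {l..l + real i} t \<partial>lborel)"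
    by (rule nn_integral_monotone_convergence_SUP)
       (auto simp: incseq_def le_fun_def indicator_def)
  also have "\<dots> \<le> jpI p"
    using assms continuous_on_subset[OF cont] by (intro SUP_least jp_substitution[where \<phi>'=\<phi>' and s=s]) auto
  finally show ?thesis .
qed

text \<open>A substitute for polar coordinates: insert the integral of \<open>1 / \<mu>\<close> over
  \<open>norm x \<le> \<mu> \<le> 2 * norm x\<close>, which is at least \<open>1/2\<close>, and scale \<open>x = \<mu> \<eta>\<close>.\<close>

lemma nn_integral_polar_bound:
  fixes h :: "'a::euclidean_space \<Rightarrow> ennreal"
  assumes [measurable]: "h \<in> borel_measurable borel"
    and B: "\<And>\<eta>. 1/2 \<le> norm \<eta> \<Longrightarrow> norm \<eta> \<le> 1 \<Longrightarrow>
      (\<integral>\<^sup>+\<mu>. h (\<mu> *\<^sub>R \<eta>) * ennreal (\<mu> ^ (DIM('a) - 1)) * indicator {0<..} \<mu> \<partial>lborel) \<le> B"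
  shows "(\<integral>\<^sup>+x. h x \<partial>lborel) \<le> 2 * (B * emeasure lborel (cball (0::'a) 1))"
proof -
  let ?S = "{\<eta>::'a. 1/2 \<le> norm \<eta> \<and> norm \<eta> \<le> 1}"
  let ?k = "\<lambda>\<mu> x. indicator {0<..} \<mu> * ennreal (1 / \<mu>) * indicator ?S ((1 / \<mu>) *\<^sub>R x)"
  have S [measurable]: "?S \<in> sets borel" by measurable
  have k: "1 \<le> 2 * (\<integral>\<^sup>+\<mu>. ?k \<mu> x \<partial>lborel)" if "x \<noteq> 0" for x
  proof -
    have nx: "norm x > 0" using that by simp
    have "(\<integral>\<^sup>+\<mu>. ennreal (1 / (2 * norm x)) * indicator {norm x..2 * norm x} \<mu> \<partial>lborel) = ennreal (1 / (2
        * norm x)) * ennreal (norm x)"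
      by (subst nn_integral_cmult_indicator) auto
    also have "\<dots> = ennreal (1 / 2)" using nx by (subst ennreal_mult[symmetric]) auto
    finally have half: "(\<integral>\<^sup>+\<mu>. ennreal (1 / (2 * norm x)) * indicator {norm x..2 * norm x} \<mu> \<partial>lborel)
        = ennreal (1 / 2)" .
    have "ennreal 2 * ennreal (1 / 2) = ennreal 1" by (subst ennreal_mult[symmetric]) auto
    then have "(1::ennreal) = 2 * (\<integral>\<^sup>+\<mu>. ennreal (1 / (2 * norm x)) * indicator {norm x..2
        * norm x} \<mu> \<partial>lborel)"
      unfolding half by simp
    also have "\<dots> \<le> 2 * (\<integral>\<^sup>+\<mu>. ?k \<mu> x \<partial>lborel)"
    proof (intro mult_left_mono nn_integral_mono)
      fix \<mu> :: real
      show "ennreal (1 / (2 * norm x)) * indicator {norm x..2 * norm x} \<mu> \<le> ?k \<mu> x"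
        using nx by (auto simp: indicator_def divide_simps intro!: ennreal_leI)
    qed simp
    finally show ?thesis .
  qed
  have "(\<integral>\<^sup>+x. h x \<partial>lborel) \<le> (\<integral>\<^sup>+x. 2 * (\<integral>\<^sup>+\<mu>. h x * ?k \<mu> x \<partial>lborel) \<partial>lborel)"
  proof (rule nn_integral_mono_AE)
    show "AE x in lborel. h x \<le> 2 * (\<integral>\<^sup>+\<mu>. h x * ?k \<mu> x \<partial>lborel)"
      using AE_lborel_singleton[of 0]
    proof (rule AE_mp, intro AE_I2 impI)
      fix x :: 'a assume "x \<noteq> 0"
      have "h x * 1 \<le> h x * (2 * (\<integral>\<^sup>+\<mu>. ?k \<mu> x \<partial>lborel))" by (intro mult_left_mono k \<open>x \<noteq> 0\<close>) simp
      also have "\<dots> = 2 * (\<integral>\<^sup>+\<mu>. h x * ?k \<mu> x \<partial>lborel)"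
          by (subst nn_integral_cmult) (measurable, simp add: mult_ac)
      finally show "h x \<le> 2 * (\<integral>\<^sup>+\<mu>. h x * ?k \<mu> x \<partial>lborel)" by simp
    qed
  qed
  also have "\<dots> = 2 * (\<integral>\<^sup>+x. \<integral>\<^sup>+\<mu>. h x * ?k \<mu> x \<partial>lborel \<partial>lborel)" by (rule nn_integral_cmult) measurable
  also have "(\<integral>\<^sup>+x. \<integral>\<^sup>+\<mu>. h x * ?k \<mu> x \<partial>lborel \<partial>lborel) = (\<integral>\<^sup>+\<mu>. \<integral>\<^sup>+x. h x * ?k \<mu> x \<partial>lborel \<partial>lborel)"
    by (rule lborel_pair.Fubini') measurable
  also have "\<dots> = (\<integral>\<^sup>+\<mu>. \<integral>\<^sup>+\<eta>. h (\<mu> *\<^sub>R \<eta>) * ennreal (\<mu> ^ (DIM('a) - 1)) * indicator {0<..} \<mu>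
      * indicator ?S \<eta> \<partial>lborel \<partial>lborel)"
  proof (rule nn_integral_cong)
    fix \<mu> :: real
    show "(\<integral>\<^sup>+x. h x * ?k \<mu> x \<partial>lborel) = (\<integral>\<^sup>+\<eta>. h (\<mu> *\<^sub>R \<eta>) * ennreal (\<mu> ^ (DIM('a) - 1))
        * indicator {0<..} \<mu> * indicator ?S \<eta> \<partial>lborel)"
    proof (cases "\<mu> > 0")
      case True
      \<comment> \<open>The Jacobian of the dilation and the averaging density
        \<open>1 / \<mu>\<close> combine to the radial weight of polar coordinates.\<close>
      have pw: "ennreal (\<mu> ^ DIM('a)) * ennreal (1 / \<mu>) = ennreal (\<mu> ^ (DIM('a) - 1))"
        using True DIM_positive[where 'a='a] by (simp add: ennreal_mult[symmetric] power_diff)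
      have "(\<integral>\<^sup>+x. h x * ?k \<mu> x \<partial>lborel) = ennreal (\<bar>\<mu>\<bar> ^ DIM('a)) * (\<integral>\<^sup>+\<eta>. h (0 + \<mu> *\<^sub>R \<eta>) * ?k \<mu> (0
          + \<mu> *\<^sub>R \<eta>) \<partial>lborel)"
        using True by (intro nn_integral_lborel_affine) auto
      also have "\<dots> = (\<integral>\<^sup>+\<eta>. ennreal (\<mu> ^ DIM('a)) * (h (\<mu> *\<^sub>R \<eta>) * (ennreal (1 / \<mu>)
          * indicator ?S \<eta>)) \<partial>lborel)"
        using True by (subst nn_integral_cmult) auto
      also have "\<dots> = (\<integral>\<^sup>+\<eta>. h (\<mu> *\<^sub>R \<eta>) * ennreal (\<mu> ^ (DIM('a) - 1)) * indicator {0<..} \<mu>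
          * indicator ?S \<eta> \<partial>lborel)"
        unfolding pw[symmetric] using True by (simp add: mult_ac)
      finally show ?thesis .
    qed simp
  qed
  also have "\<dots> = (\<integral>\<^sup>+\<eta>. \<integral>\<^sup>+\<mu>. h (\<mu> *\<^sub>R \<eta>) * ennreal (\<mu> ^ (DIM('a) - 1)) * indicator {0<..} \<mu>
      * indicator ?S \<eta> \<partial>lborel \<partial>lborel)"
    by (rule lborel_pair.Fubini'[symmetric]) measurable
  also have "\<dots> \<le> (\<integral>\<^sup>+\<eta>. B * indicator (cball 0 1) \<eta> \<partial>(lborel :: 'a measure))"
  proof (rule nn_integral_mono)
    fix \<eta> :: 'a
    show "(\<integral>\<^sup>+\<mu>. h (\<mu> *\<^sub>R \<eta>) * ennreal (\<mu> ^ (DIM('a) - 1)) * indicator {0<..} \<mu> * indicator ?S \<eta> \<partial>lborel)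
        \<le> B * indicator (cball 0 1) \<eta>"
      using B[of \<eta>] by (cases "\<eta> \<in> ?S") auto
  qed
  also have "\<dots> = B * emeasure lborel (cball (0::'a) 1)" by (rule nn_integral_cmult_indicator) simp
  finally show ?thesis by (simp add: mult_left_mono)
qed

text \<open>Along a ray the quadratic part makes the phase grow at a rate proportional to \<mu>, and
  the factor \<open>1 / japanese \<xi>\<close> lowers the radial weight \<open>\<mu>\<^sup>2\<close>
  to that same order. Bounded \<mu> is estimated trivially.\<close>

lemma jp_polar:
  fixes \<xi>0 :: "real^3"
  assumes p: "p \<ge> 0" and \<alpha>: "\<alpha> = 1 \<or> \<alpha> = -1" and \<beta>: "\<bar>\<beta>\<bar> \<le> 1"
  shows "(\<integral>\<^sup>+\<xi>. ennreal (1 / japanese \<xi>) * jp p (T + \<alpha> * (norm \<xi>)\<^sup>2 + \<beta> * japanese (\<xi>0 - \<xi>)) \<partial>lborel)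
    \<le> 2 * ((64 + 8 * jpI p) * emeasure lborel (cball (0::real^3) 1))"
proof (rule nn_integral_polar_bound)
  fix \<eta> :: "real^3" assume \<eta>: "1/2 \<le> norm \<eta>" "norm \<eta> \<le> 1"
  define \<phi> where "\<phi> \<mu> = T + \<alpha> * (norm (0 + \<mu> *\<^sub>R \<eta>))\<^sup>2 + \<beta> * japanese (- \<xi>0 + \<mu> *\<^sub>R \<eta>)" for \<mu>
  define \<phi>' where "\<phi>' \<mu> = \<alpha> * (2 * ((0 + \<mu> *\<^sub>R \<eta>) \<bullet> \<eta>)) + \<beta> * (((- \<xi>0 + \<mu> *\<^sub>R \<eta>) \<bullet> \<eta>) / japanese (- \<xi>0
      + \<mu> *\<^sub>R \<eta>))" for \<mu>
  have [measurable]: "\<phi> \<in> borel_measurable borel" unfolding \<phi>_def by measurable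
  have der: "(\<phi> has_real_derivative \<phi>' \<mu>) (at \<mu>)" for \<mu>
    unfolding \<phi>_def \<phi>'_def
    by (rule derivative_eq_intros norm_line_derivative japanese_line_derivative refl)+ simp
  have cont: "continuous_on A \<phi>'" for A
    unfolding \<phi>'_def japanese_def by (intro continuous_intros) (auto simp: add_pos_nonneg
        sum_power2_eq_zero_iff add_nonneg_eq_0_iff)
  \<comment> \<open>As \<open>norm \<eta>\<close> is at least 1/2, the quadratic part contributes at
    least \<mu>/2 and the bracket takes away at most 1, which is at most \<mu>/4 once \<mu> is at
    least 4.\<close>
  have low: "\<mu> / 4 \<le> \<alpha> * \<phi>' \<mu>" if "4 \<le> \<mu>" for \<mu>
  proof -
    have "(1/2)\<^sup>2 \<le> (norm \<eta>)\<^sup>2" using \<eta> by (intro power_mono) auto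
    then have "\<mu> / 4 \<le> \<mu> * (norm \<eta>)\<^sup>2" using that by (simp add: power2_eq_square)
    moreover have "\<bar>\<alpha> * (\<beta> * (((- \<xi>0 + \<mu> *\<^sub>R \<eta>) \<bullet> \<eta>) / japanese (- \<xi>0 + \<mu> *\<^sub>R \<eta>)))\<bar> \<le> 1 * (1 * 1)"
      unfolding abs_mult using \<alpha> \<beta> \<eta>(2) order_trans[OF japanese_derivative_bound \<eta>(2)]
      by (intro mult_mono) auto
    moreover have "\<alpha> * \<phi>' \<mu> = 2 * (\<mu> * (norm \<eta>)\<^sup>2) + \<alpha> * (\<beta> * (((- \<xi>0 + \<mu> *\<^sub>R \<eta>) \<bullet> \<eta>) / japanese (- \<xi>0
        + \<mu> *\<^sub>R \<eta>)))"
      using \<alpha> unfolding \<phi>'_def power2_norm_eq_inner by auto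
    ultimately show ?thesis using that by linarith
  qed
  \<comment> \<open>For \<mu> up to 4 the integrand is at most 16, which integrates to 64. Beyond
    that \<open>japanese (\<mu> *\<^sub>R \<eta>)\<close> is at least \<mu>/2, so the radial weight
    is at most \<open>2 * \<mu>\<close>, written as \<open>8 * (\<mu> / 4)\<close> to match
    \<open>low\<close>.\<close>
  have pw: "ennreal (1 / japanese (\<mu> *\<^sub>R \<eta>)) * jp p (\<phi> \<mu>) * ennreal (\<mu> ^ 2) * indicator {0<..} \<mu>
      \<le> 16 * indicator {0..4} \<mu> + 8 * (jp p (\<phi> \<mu>) * ennreal (\<mu> / 4) * indicator {4..} \<mu>)" for \<mu>
  proof (cases "\<mu> \<le> 4")
    case True
    have "ennreal (1 / japanese (\<mu> *\<^sub>R \<eta>)) * jp p (\<phi> \<mu>) * ennreal (\<mu> ^ 2) \<le> 1 * 1 * 16" if "0 < \<mu>"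
    proof (intro mult_mono jp_le_1 p)
      show "ennreal (1 / japanese (\<mu> *\<^sub>R \<eta>)) \<le> 1" using japanese_ge_1[of "\<mu> *\<^sub>R \<eta>"]
          by (simp add: divide_le_eq)
      have "\<mu> ^ 2 \<le> 4 ^ 2" using True that by (intro power_mono) auto
      then show "ennreal (\<mu>\<^sup>2) \<le> 16" by (simp add: ennreal_numeral[symmetric] del: ennreal_numeral)
    qed auto
    then show ?thesis using True by (auto simp: indicator_def intro: add_increasing2)
  next
    case False
    have "\<mu> / 2 \<le> norm (\<mu> *\<^sub>R \<eta>)" using False \<eta> by (simp add: mult_left_mono)
    also have "\<dots> \<le> japanese (\<mu> *\<^sub>R \<eta>)" by (rule norm_le_japanese)
    finally have "(1 / japanese (\<mu> *\<^sub>R \<eta>)) * \<mu>\<^sup>2 \<le> 8 * (\<mu> / 4)"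
      using False japanese_pos[of "\<mu> *\<^sub>R \<eta>"] by (simp add: divide_le_eq power2_eq_square mult_left_mono)
    then have "ennreal ((1 / japanese (\<mu> *\<^sub>R \<eta>)) * \<mu>\<^sup>2) \<le> ennreal (8 * (\<mu> / 4))" by (rule ennreal_leI)
    moreover have "ennreal ((1 / japanese (\<mu> *\<^sub>R \<eta>)) * \<mu>\<^sup>2) = ennreal (1 / japanese (\<mu> *\<^sub>R \<eta>))
        * ennreal (\<mu>\<^sup>2)"
      using japanese_pos[of "\<mu> *\<^sub>R \<eta>"] by (intro ennreal_mult) auto
    moreover have "ennreal (8 * (\<mu> / 4)) = ennreal 8 * ennreal (\<mu> / 4)"
      using False by (intro ennreal_mult) auto
    ultimately have "ennreal (1 / japanese (\<mu> *\<^sub>R \<eta>)) * ennreal (\<mu>\<^sup>2) \<le> 8 * ennreal (\<mu> / 4)"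
      by (simp only: ennreal_numeral)
    from mult_left_mono[OF this, of "jp p (\<phi> \<mu>)"] False show ?thesis
      by (simp add: indicator_def mult_ac)
  qed
  have "(\<integral>\<^sup>+\<mu>. ennreal (1 / japanese (\<mu> *\<^sub>R \<eta>)) * jp p (\<phi> \<mu>) * ennreal (\<mu> ^ 2) * indicator {0<..} \<mu> \<partial>lborel)
      \<le> (\<integral>\<^sup>+\<mu>. 16 * indicator {0..4} \<mu> + 8 * (jp p (\<phi> \<mu>) * ennreal (\<mu> / 4) * indicator {4..} \<mu>) \<partial>lborel)"
    by (intro nn_integral_mono pw)
  also have "\<dots> = 64 + 8 * (\<integral>\<^sup>+\<mu>. jp p (\<phi> \<mu>) * ennreal (\<mu> / 4) * indicator {4..} \<mu> \<partial>lborel)"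
    by (simp add: nn_integral_add nn_integral_cmult ennreal_numeral[symmetric] ennreal_mult[symmetric]
        del: ennreal_numeral)
  also have "\<dots> \<le> 64 + 8 * jpI p"
    using der cont \<alpha> low by (intro add_left_mono mult_left_mono jp_substitution_atLeast) auto
  finally have fin: "(\<integral>\<^sup>+\<mu>. ennreal (1 / japanese (\<mu> *\<^sub>R \<eta>)) * jp p (\<phi> \<mu>) * ennreal (\<mu> ^ 2)
      * indicator {0<..} \<mu> \<partial>lborel)
    \<le> 64 + 8 * jpI p" .
  have dim: "DIM(real^3) - 1 = 2" by simp
  have \<phi>: "T + \<alpha> * (norm (\<mu> *\<^sub>R \<eta>))\<^sup>2 + \<beta> * japanese (\<xi>0 - \<mu> *\<^sub>R \<eta>) = \<phi> \<mu>" for \<mu>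
    unfolding \<phi>_def by (subst japanese_minus_commute) simp
  show "(\<integral>\<^sup>+\<mu>. ennreal (1 / japanese (\<mu> *\<^sub>R \<eta>)) * jp p (T + \<alpha> * (norm (\<mu> *\<^sub>R \<eta>))\<^sup>2 + \<beta>
      * japanese (\<xi>0 - \<mu> *\<^sub>R \<eta>))
      * ennreal (\<mu> ^ (DIM(real^3) - 1)) * indicator {0<..} \<mu> \<partial>lborel) \<le> 64 + 8 * jpI p"
    unfolding dim \<phi> by (rule fin)
qed measurable

text \<open>Averaging over the translations by \<open>t e\<close>, \<open>0 \<le> t \<le> \<rho>\<close>, reduces the integral to line integrals.\<close>

lemma jp_slab:
  fixes F :: "real^3 \<Rightarrow> real"
  assumes \<rho>: "\<rho> > 0" and L: "L > 0" and e: "norm e = 1"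
    and [measurable]: "F \<in> borel_measurable borel"
    and der: "\<And>x t. ((\<lambda>t. F (x + t *\<^sub>R e)) has_real_derivative D (x + t *\<^sub>R e)) (at t)"
    and cont: "continuous_on UNIV D"
    and low: "\<And>y. norm y \<le> 3 * \<rho> \<Longrightarrow> L \<le> D y"
  shows "(\<integral>\<^sup>+x. jp p (F x) * indicator (cball 0 \<rho>) x \<partial>lborel) \<le> ennreal (8 * unit_ball_vol 3 * \<rho>\<^sup>2 / L)
      * jpI p"
proof -
  let ?X = "\<integral>\<^sup>+x. jp p (F x) * indicator (cball 0 \<rho>) x \<partial>lborel"
  \<comment> \<open>The averaged points start in the ball of radius \<open>2 * \<rho>\<close> and
    move by at most \<rho>, hence the radius \<open>3 * \<rho>\<close> in the assumption on
    \<open>D\<close>.\<close>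
  have inner: "(\<integral>\<^sup>+t. jp p (F (x + t *\<^sub>R e)) * indicator {0..\<rho>} t \<partial>lborel) \<le> ennreal (1 / L) * jpI p"
    if x: "norm x \<le> 2 * \<rho>" for x
  proof -
    have "(\<integral>\<^sup>+t. jp p (F (x + t *\<^sub>R e)) * ennreal L * indicator {0..\<rho>} t \<partial>lborel) \<le> jpI p"
    proof (rule jp_substitution[where s=1 and \<phi>'="\<lambda>t. D (x + t *\<^sub>R e)", OF der])
      show "continuous_on {0..\<rho>} (\<lambda>t. D (x + t *\<^sub>R e))"
        by (intro continuous_on_compose2[OF cont] continuous_intros) auto
      fix t assume t: "0 \<le> t" "t \<le> \<rho>"
      have "norm (x + t *\<^sub>R e) \<le> norm x + norm (t *\<^sub>R e)" by (rule norm_triangle_ineq)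
      also have "\<dots> \<le> 3 * \<rho>" using x t e by simp
      finally show "0 \<le> L \<and> L \<le> 1 * D (x + t *\<^sub>R e)" using low L by simp
    qed simp
    then have "ennreal (1 / L) * (\<integral>\<^sup>+t. jp p (F (x + t *\<^sub>R e)) * ennreal L * indicator {0..\<rho>} t \<partial>lborel)
        \<le> ennreal (1 / L) * jpI p"
      by (rule mult_left_mono) simp
    moreover have "ennreal (1 / L) * (\<integral>\<^sup>+t. jp p (F (x + t *\<^sub>R e)) * ennreal L * indicator {0..\<rho>} t \<partial>lborel)
       = (\<integral>\<^sup>+t. (ennreal (1 / L) * ennreal L) * (jp p (F (x + t *\<^sub>R e)) * indicator {0..\<rho>} t) \<partial>lborel)"
      by (subst nn_integral_cmult[symmetric]) (measurable, simp add: mult_ac)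
    moreover have "ennreal (1 / L) * ennreal L = 1" using L by (simp add: ennreal_mult[symmetric])
    ultimately show ?thesis by simp
  qed
  have [measurable]: "(\<lambda>x. jp p (F x) * indicator (cball 0 \<rho>) x) \<in> borel_measurable borel" by measurable
  have tr: "?X = (\<integral>\<^sup>+x. jp p (F (x + t *\<^sub>R e)) * indicator (cball 0 \<rho>) (x + t *\<^sub>R e) \<partial>lborel)" for t
    using nn_integral_lborel_affine[of "\<lambda>x. jp p (F x) * indicator (cball 0 \<rho>) x" 1 "t *\<^sub>R e"]
        by (simp add: add.commute)
  have "ennreal \<rho> * ?X = (\<integral>\<^sup>+t. ?X * indicator {0..\<rho>} t \<partial>lborel)"
    using \<rho> by (subst nn_integral_cmult_indicator) (auto simp: mult.commute)
  also have "\<dots> \<le> (\<integral>\<^sup>+t. \<integral>\<^sup>+x. jp p (F (x + t *\<^sub>R e)) * indicator {0..\<rho>} t * indicator (cball 0 (2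
      * \<rho>)) x \<partial>lborel \<partial>lborel)"
  proof (rule nn_integral_mono)
    fix t
    have "(\<integral>\<^sup>+x. jp p (F (x + t *\<^sub>R e)) * indicator (cball 0 \<rho>) (x + t *\<^sub>R e) \<partial>lborel) * indicator {0..\<rho>} t
        = (\<integral>\<^sup>+x. jp p (F (x + t *\<^sub>R e)) * indicator (cball 0 \<rho>) (x + t *\<^sub>R e) * indicator {0..\<rho>} t \<partial>lborel)"
      by (rule nn_integral_multc[symmetric]) measurable
    also have "\<dots> \<le> (\<integral>\<^sup>+x. jp p (F (x + t *\<^sub>R e)) * indicator {0..\<rho>} t * indicator (cball 0 (2
        * \<rho>)) x \<partial>lborel)"
    proof (rule nn_integral_mono)
      fix x
      have "norm x \<le> 2 * \<rho>" if "norm (x + t *\<^sub>R e) \<le> \<rho>" "0 \<le> t" "t \<le> \<rho>"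
        using norm_triangle_ineq4[of "x + t *\<^sub>R e" "t *\<^sub>R e"] that e by simp
      then show "jp p (F (x + t *\<^sub>R e)) * indicator (cball 0 \<rho>) (x + t *\<^sub>R e) * indicator {0..\<rho>} t
        \<le> jp p (F (x + t *\<^sub>R e)) * indicator {0..\<rho>} t * indicator (cball 0 (2 * \<rho>)) x"
        by (auto simp: indicator_def)
    qed
    finally show "?X * indicator {0..\<rho>} t \<le> (\<integral>\<^sup>+x. jp p (F (x + t *\<^sub>R e)) * indicator {0..\<rho>} t
        * indicator (cball 0 (2 * \<rho>)) x \<partial>lborel)"
      unfolding tr[of t] .
  qed
  also have "\<dots> = (\<integral>\<^sup>+x. \<integral>\<^sup>+t. jp p (F (x + t *\<^sub>R e)) * indicator {0..\<rho>} t * indicator (cball 0 (2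
      * \<rho>)) x \<partial>lborel \<partial>lborel)"
    by (rule lborel_pair.Fubini'[symmetric]) measurable
  also have "\<dots> \<le> (\<integral>\<^sup>+x. (ennreal (1 / L) * jpI p) * indicator (cball 0 (2
      * \<rho>)) x \<partial>(lborel :: (real^3) measure))"
  proof (rule nn_integral_mono)
    fix x
    show "(\<integral>\<^sup>+t. jp p (F (x + t *\<^sub>R e)) * indicator {0..\<rho>} t * indicator (cball 0 (2 * \<rho>)) x \<partial>lborel)
       \<le> (ennreal (1 / L) * jpI p) * indicator (cball 0 (2 * \<rho>)) x"
      using inner[of x] by (cases "norm x \<le> 2 * \<rho>") auto
  qed
  also have "\<dots> = (ennreal (1 / L) * jpI p) * emeasure lborel (cball (0::real^3) (2 * \<rho>))"
    by (rule nn_integral_cmult_indicator) simp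
  also have "emeasure lborel (cball (0::real^3) (2 * \<rho>)) = ennreal (unit_ball_vol 3 * (2 * \<rho>) ^ 3)"
    using \<rho> by (simp add: emeasure_cball)
  \<comment> \<open>Dividing by the length \<rho> of the averaging interval turns the volume of the
    ball of radius \<open>2 * \<rho>\<close> into
    \<open>8 * unit_ball_vol 3 * \<rho>\<^sup>2\<close>.\<close>
  finally have "ennreal (1 / \<rho>) * (ennreal \<rho> * ?X) \<le> ennreal (1 / \<rho>) * ((ennreal (1 / L) * jpI p)
      * ennreal (unit_ball_vol 3 * (2 * \<rho>) ^ 3))"
    by (rule mult_left_mono) simp
  moreover have "ennreal (1 / \<rho>) * ennreal \<rho> = 1" using \<rho> by (simp add: ennreal_mult[symmetric])
  moreover have "ennreal (1 / \<rho>) * ((ennreal (1 / L) * jpI p) * ennreal (unit_ball_vol 3 * (2 * \<rho>) ^ 3))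
     = ennreal (8 * unit_ball_vol 3 * \<rho>\<^sup>2 / L) * jpI p"
  proof -
    have "ennreal (1 / \<rho>) * (ennreal (1 / L) * ennreal (unit_ball_vol 3 * (2 * \<rho>) ^ 3)) = ennreal ((1 / \<rho>)
        * ((1 / L) * (unit_ball_vol 3 * (2 * \<rho>) ^ 3)))"
      using \<rho> L by (subst ennreal_mult[symmetric], simp, simp, subst ennreal_mult[symmetric]) auto
    also have "(1 / \<rho>) * ((1 / L) * (unit_ball_vol 3 * (2 * \<rho>) ^ 3)) = 8 * unit_ball_vol 3 * \<rho>\<^sup>2 / L"
      using \<rho> by (simp add: power_mult_distrib power2_eq_square power3_eq_cube)
    finally show ?thesis by (metis mult.assoc mult.commute)
  qed
  ultimately show ?thesis by (simp add: mult.assoc[symmetric])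
qed

lemma unit_vector:
  fixes y :: "'a::real_inner"
  assumes "y \<noteq> 0"
  shows "norm (y /\<^sub>R norm y) = 1" "y \<bullet> (y /\<^sub>R norm y) = norm y"
  using assms by (simp_all add: power2_norm_eq_inner[symmetric] power2_eq_square)

text \<open>In the direction of \<open>y\<close> the phase has derivative at least
  \<open>norm y / 2\<close> throughout the small ball, while the slab has cross section of order
  \<open>(norm y)\<^sup>2\<close>. The factor \<open>1 / japanese y\<close> absorbs the remaining
  power of \<open>norm y\<close>. For \<open>norm y\<close> at most 1 the volume of a unit ball
  suffices.\<close>

lemma jp_resonant_slab:
  fixes y :: "real^3"
  assumes p: "p \<ge> 0" and \<alpha>: "\<alpha> = 1 \<or> \<alpha> = -1"
  shows "(\<integral>\<^sup>+x. ennreal (1 / japanese y) * indicator (cball 0 (norm y / 8)) x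
        * jp p (T + (norm (x + y))\<^sup>2 - \<alpha> * (norm x)\<^sup>2) \<partial>lborel)
    \<le> emeasure lborel (cball (0::real^3) 1) + ennreal (unit_ball_vol 3) * jpI p"
proof (cases "norm y \<le> 1")
  case True
  have "(\<integral>\<^sup>+x. ennreal (1 / japanese y) * indicator (cball 0 (norm y / 8)) x
        * jp p (T + (norm (x + y))\<^sup>2 - \<alpha> * (norm x)\<^sup>2) \<partial>lborel)
            \<le> (\<integral>\<^sup>+x. indicator (cball (0::real^3) 1) x \<partial>lborel)"
  proof (rule nn_integral_mono)
    fix x :: "real^3"
    have "ennreal (1 / japanese y) * indicator (cball 0 (norm y / 8)) x * jp p (T + (norm (x + y))\<^sup>2 - \<alpha>
        * (norm x)\<^sup>2)
      \<le> 1 * indicator (cball 0 1) x * 1"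
    proof (intro mult_mono jp_le_1 p)
      show "ennreal (1 / japanese y) \<le> 1" using japanese_ge_1[of y] by (simp add: divide_le_eq)
    qed (use True in \<open>auto simp: indicator_def\<close>)
    then show "ennreal (1 / japanese y) * indicator (cball 0 (norm y / 8)) x * jp p (T + (norm (x
        + y))\<^sup>2 - \<alpha> * (norm x)\<^sup>2)
      \<le> indicator (cball 0 1) x" by simp
  qed
  also have "\<dots> = emeasure lborel (cball (0::real^3) 1)" by simp
  finally show ?thesis by (rule order_trans) simp
next
  case False
  define e where "e = y /\<^sub>R norm y"
  have y: "norm y > 1" "y \<noteq> 0" using False by auto
  have e: "norm e = 1" "y \<bullet> e = norm y" using unit_vector[OF y(2)] by (auto simp: e_def)
  let ?F = "\<lambda>x. T + (norm (x + y))\<^sup>2 - \<alpha> * (norm x)\<^sup>2"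
  let ?D = "\<lambda>x. 2 * ((x + y) \<bullet> e) - \<alpha> * (2 * (x \<bullet> e))"
  have "(\<integral>\<^sup>+x. jp p (?F x) * indicator (cball 0 (norm y / 8)) x \<partial>lborel)
     \<le> ennreal (8 * unit_ball_vol 3 * (norm y / 8)\<^sup>2 / (norm y / 2)) * jpI p"
  proof (rule jp_slab[where D="?D", OF _ _ e(1)])
    show "((\<lambda>t. ?F (x + t *\<^sub>R e)) has_real_derivative ?D (x + t *\<^sub>R e)) (at t)" for x t
    proof -
      have "((\<lambda>t. T + (norm ((x + y) + t *\<^sub>R e))\<^sup>2 - \<alpha> * (norm (x + t *\<^sub>R e))\<^sup>2) has_real_derivative
         0 + 2 * (((x + y) + t *\<^sub>R e) \<bullet> e) - \<alpha> * (2 * ((x + t *\<^sub>R e) \<bullet> e))) (at t)"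
        by (intro DERIV_add DERIV_diff DERIV_const DERIV_cmult norm_line_derivative)
      then show ?thesis by (simp add: add_ac)
    qed
    show "continuous_on UNIV ?D" by (intro continuous_intros)
    fix x :: "real^3" assume x: "norm x \<le> 3 * (norm y / 8)"
    have "\<bar>x \<bullet> e\<bar> \<le> norm x * norm e" by (rule Cauchy_Schwarz_ineq2)
    then have "\<bar>x \<bullet> e\<bar> \<le> 3 * (norm y / 8)" using x e by simp
    \<comment> \<open>For \<alpha> = 1 the terms in \<open>x\<close> cancel and leave
      \<open>2 * norm y\<close>. For \<alpha> = -1 they can cost \<open>4 * (3/8) * norm y\<close>,
      leaving exactly \<open>norm y / 2\<close>.\<close>
    then show "norm y / 2 \<le> ?D x" using \<alpha> by (auto simp: inner_add_left e abs_le_iff)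
  qed (use y in auto)
  then have "ennreal (1 / japanese y) * (\<integral>\<^sup>+x. jp p (?F x) * indicator (cball 0 (norm y / 8)) x \<partial>lborel)
     \<le> ennreal (1 / japanese y) * (ennreal (8 * unit_ball_vol 3 * (norm y / 8)\<^sup>2 / (norm y / 2)) * jpI p)"
    by (rule mult_left_mono) simp
  also have "\<dots> = ennreal ((1 / japanese y) * (8 * unit_ball_vol 3 * (norm y / 8)\<^sup>2 / (norm y / 2))) * jpI p"
    using japanese_pos[of y] unit_ball_vol_nonneg[of 3]
    by (subst ennreal_mult) (auto simp: mult.assoc)
  also have "\<dots> \<le> ennreal (unit_ball_vol 3) * jpI p"
  proof (intro mult_right_mono ennreal_leI)
    have "(1 / japanese y) * (8 * unit_ball_vol 3 * (norm y / 8)\<^sup>2 / (norm y / 2)) = unit_ball_vol 3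
        * (norm y / japanese y) / 4"
      using y by (simp add: power2_eq_square)
    also have "\<dots> \<le> unit_ball_vol 3 * 1 / 4"
      using japanese_pos[of y] norm_le_japanese[of y] unit_ball_vol_nonneg[of 3]
      by (intro divide_right_mono mult_left_mono) (auto simp: divide_le_eq)
    also have "\<dots> \<le> unit_ball_vol 3" using unit_ball_vol_nonneg[of 3] by simp
    finally show "(1 / japanese y) * (8 * unit_ball_vol 3 * (norm y / 8)\<^sup>2 / (norm y / 2))
        \<le> unit_ball_vol 3" .
  qed simp
  finally have "ennreal (1 / japanese y) * (\<integral>\<^sup>+x. jp p (?F x) * indicator (cball 0 (norm y / 8)) x \<partial>lborel)
    \<le> ennreal (unit_ball_vol 3) * jpI p" .
  moreover have "(\<integral>\<^sup>+x. ennreal (1 / japanese y) * indicator (cball 0 (norm y / 8)) x * jp p (?F x) \<partial>lborel)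
      = ennreal (1 / japanese y) * (\<integral>\<^sup>+x. jp p (?F x) * indicator (cball 0 (norm y / 8)) x \<partial>lborel)"
    by (subst nn_integral_cmult[symmetric]) (measurable, simp add: mult_ac)
  ultimately show ?thesis by (auto intro: order_trans)
qed

text \<open>Take the least \<open>n\<close> with \<open>R / 2 ^ n < r\<close>. Since r is at most R
  it is not 0, and its predecessor is the required scale.\<close>

lemma dyadic_scale:
  fixes r R :: real
  assumes "0 < r" "r \<le> R"
  obtains k :: nat where "R / 2 ^ Suc k < r" "r \<le> R / 2 ^ k"
proof -
  obtain m where "R / r < 2 ^ m" using real_arch_pow[of 2 "R / r"] by auto
  then have m: "R / 2 ^ m < r" using assms(1) by (simp add: divide_less_eq mult.commute)
  define n where "n = (LEAST n. R / 2 ^ n < r)"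
  have n: "R / 2 ^ n < r" unfolding n_def by (rule LeastI[of "\<lambda>n. R / 2 ^ n < r", OF m])
  have "n \<noteq> 0" using n assms by (intro notI) auto
  then obtain k where k: "n = Suc k" using not0_implies_Suc by blast
  have "\<not> R / 2 ^ k < r" using not_less_Least[of k "\<lambda>n. R / 2 ^ n < r"] k unfolding n_def by auto
  then show ?thesis using that[of k] n unfolding k by simp
qed

text \<open>On the dyadic shell of radius \<open>R / 2 ^ k\<close> the weight is about \<open>(R / 2 ^ k) powr (- (1 + 2 * \<sigma>))\<close>,
  while the slab estimate contributes \<open>(R / 2 ^ k)\<^sup>2 / R\<close>: the sum over \<open>k\<close> converges because \<open>\<sigma> < 1/2\<close>.\<close>

lemma jp_layers:
  fixes \<xi> :: "real^3"
  assumes p: "p \<ge> 0" and \<sigma>: "0 \<le> \<sigma>" "\<sigma> < 1/2" and \<beta>: "\<bar>\<beta>\<bar> \<le> 1"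
  defines "C \<equiv> 5 * emeasure lborel (cball (0::real^3) 1)
     + ennreal (64 * unit_ball_vol 3 * 2 powr (1 + 2 * \<sigma>) / (1 - 2 powr (1 + 2 * \<sigma>) / 4)) * jpI p"
  shows "(\<integral>\<^sup>+y. ennreal (japanese \<xi> powr (2 * \<sigma>) * japanese y powr (- (1 + 2 * \<sigma>)))
       * indicator (cball 0 (norm \<xi> / 4)) y * jp p (T + (norm (\<xi> + y))\<^sup>2 + \<beta> * japanese y) \<partial>lborel) \<le> C"
    (is "(\<integral>\<^sup>+y. ?h y \<partial>lborel) \<le> C")
proof (cases "norm \<xi> \<le> 4")
  case True
  have "(\<integral>\<^sup>+y. ?h y \<partial>lborel) \<le> (\<integral>\<^sup>+y. 5 * indicator (cball (0::real^3) 1) y \<partial>lborel)"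
  proof (rule nn_integral_mono)
    fix y :: "real^3"
    \<comment> \<open>The exponent is below 1 and the bracket is at most 1 + 4, whence the constant
      5.\<close>
    have "japanese \<xi> powr (2 * \<sigma>) \<le> japanese \<xi> powr 1" using \<sigma> japanese_ge_1[of \<xi>] by (intro powr_mono) auto
    also have "\<dots> \<le> 5" using japanese_le[of \<xi>] True japanese_pos[of \<xi>] by simp
    finally have "japanese \<xi> powr (2 * \<sigma>) * japanese y powr (- (1 + 2 * \<sigma>)) \<le> 5 * japanese y powr 0"
      using \<sigma> japanese_ge_1[of y] by (intro mult_mono powr_mono) auto
    then have "ennreal (japanese \<xi> powr (2 * \<sigma>) * japanese y powr (- (1 + 2 * \<sigma>))) \<le> ennreal 5"
      using japanese_pos[of y] by (intro ennreal_leI) simp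
    then have "?h y \<le> ennreal 5 * indicator (cball 0 1) y * 1"
      using True by (intro mult_mono jp_le_1 p) (auto simp: indicator_def)
    then show "?h y \<le> 5 * indicator (cball (0::real^3) 1) y" by simp
  qed
  also have "\<dots> = 5 * emeasure lborel (cball (0::real^3) 1)" by (simp add: nn_integral_cmult_indicator)
  also have "\<dots> \<le> C" unfolding C_def by simp
  finally show ?thesis .
next
  case False
  define q where "q = 1 + 2 * \<sigma>"
  define R where "R = norm \<xi> / 4"
  define e where "e = \<xi> /\<^sub>R norm \<xi>"
  let ?V = "unit_ball_vol 3"
  have V: "?V \<ge> 0" by simp
  have R: "R > 1" using False by (simp add: R_def)
  have \<xi>0: "\<xi> \<noteq> 0" using False by auto
  have e: "norm e = 1" "\<xi> \<bullet> e = norm \<xi>" using unit_vector[OF \<xi>0] by (auto simp: e_def)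
  let ?F = "\<lambda>y. T + (norm (\<xi> + y))\<^sup>2 + \<beta> * japanese y"
  let ?D = "\<lambda>y. 2 * ((\<xi> + y) \<bullet> e) + \<beta> * ((y \<bullet> e) / japanese y)"
  have q: "1 \<le> q" "q < 2" using \<sigma> by (auto simp: q_def)
  have slab: "(\<integral>\<^sup>+y. jp p (?F y) * indicator (cball 0 (R / 2 ^ k)) y \<partial>lborel) \<le> ennreal (8 * ?V
      * (R / 2 ^ k)\<^sup>2 / R) * jpI p" for k :: nat
  proof (rule jp_slab[where D="?D", OF _ _ e(1)])
    show "((\<lambda>t. ?F (y + t *\<^sub>R e)) has_real_derivative ?D (y + t *\<^sub>R e)) (at t)" for y t
    proof -
      have "((\<lambda>t. T + (norm ((\<xi> + y) + t *\<^sub>R e))\<^sup>2 + \<beta> * japanese (y + t *\<^sub>R e)) has_real_derivative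
         0 + 2 * (((\<xi> + y) + t *\<^sub>R e) \<bullet> e) + \<beta> * (((y + t *\<^sub>R e) \<bullet> e) / japanese (y + t *\<^sub>R e))) (at t)"
        by (intro DERIV_add DERIV_const DERIV_cmult norm_line_derivative japanese_line_derivative)
      then show ?thesis by (simp add: add_ac)
    qed
    have jpz: "japanese y \<noteq> 0" for y :: "real^3" using japanese_pos[of y] by simp
    have "continuous_on UNIV (japanese :: real^3 \<Rightarrow> real)" unfolding japanese_def by (intro continuous_intros)
    then show "continuous_on UNIV ?D" using jpz by (intro continuous_intros) auto
    fix y :: "real^3" assume y: "norm y \<le> 3 * (R / 2 ^ k)"
    \<comment> \<open>All radii are at most R, and \<open>norm \<xi>\<close> is
      \<open>4 * R\<close>. The derivative is thus at least \<open>2 * (4 * R - 3 * R) - 1\<close>,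
      and this is at least R because R > 1.\<close>
    have "R / 2 ^ k \<le> R / 1" using R by (intro divide_left_mono) auto
    with y have y: "norm y \<le> 3 * R" by simp
    have "\<bar>y \<bullet> e\<bar> \<le> norm y * norm e" by (rule Cauchy_Schwarz_ineq2)
    then have "\<bar>y \<bullet> e\<bar> \<le> 3 * R" using y e by simp
    moreover have "\<bar>\<beta> * ((y \<bullet> e) / japanese y)\<bar> \<le> 1 * 1"
      unfolding abs_mult using \<beta> japanese_derivative_bound[of y e] e by (intro mult_mono) auto
    moreover have "(\<xi> + y) \<bullet> e = 4 * R + y \<bullet> e" by (simp add: inner_add_left e R_def)
    ultimately show "R \<le> ?D y" using R by linarith
  qed (use R in \<open>auto intro: divide_pos_pos\<close>)
  \<comment> \<open>The part of \<open>c k\<close> times the slab bound that does not depend on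
    \<open>k\<close>. What depends on \<open>k\<close> is the growth \<open>(2 powr q) ^ k\<close>
    of the weight against the decay \<open>1 / 4 ^ k\<close> of the slab bound.\<close>
  define a where "a = 8 * ?V * (2 powr q * R powr (- q) * (japanese \<xi> powr (2 * \<sigma>)) * R)"
  define c where "c k = japanese \<xi> powr (2 * \<sigma>) * (2 powr q * R powr (- q) * (2 powr q) ^ k)" for k :: nat
  have c0: "c k \<ge> 0" for k by (simp add: c_def)
  \<comment> \<open>The shell containing \<open>y\<close> is enlarged to the full ball of the same
    radius, to which the slab estimate applies; summing over all scales only increases the
    bound.\<close>
  have pw: "?h y \<le> (\<Sum>k. ennreal (c k) * (jp p (?F y) * indicator (cball 0 (R / 2 ^ k)) y))" if "y \<noteq> 0" for y
  proof (cases "norm y \<le> R")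
    case True
    have "0 < norm y" using that by simp
    then obtain k :: nat where k: "R / 2 ^ Suc k < norm y" "norm y \<le> R / 2 ^ k"
      using True by (rule dyadic_scale)
    have "japanese y powr (- q) \<le> (R / 2 ^ Suc k) powr (- q)"
      using k(1) norm_le_japanese[of y] q R by (intro powr_mono2') auto
    also have "\<dots> = 2 powr q * R powr (- q) * (2 powr q) ^ k"
      using R by (simp add: powr_divide powr_minus powr_mult powr_realpow[symmetric] powr_powr
          divide_simps mult_ac)
    finally have "japanese \<xi> powr (2 * \<sigma>) * japanese y powr (- q) \<le> c k"
      unfolding c_def by (intro mult_left_mono) auto
    then have "?h y \<le> ennreal (c k) * indicator (cball 0 R) y * jp p (?F y)"
      unfolding q_def[symmetric] R_def[symmetric] by (intro mult_right_mono ennreal_leI) auto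
    also have "\<dots> = ennreal (c k) * (jp p (?F y) * indicator (cball 0 (R / 2 ^ k)) y)"
      using True k by (simp add: indicator_def)
    also have "\<dots> \<le> (\<Sum>k. ennreal (c k) * (jp p (?F y) * indicator (cball 0 (R / 2 ^ k)) y))"
      using sum_le_suminf[of "\<lambda>k. ennreal (c k) * (jp p (?F y) * indicator (cball 0 (R / 2 ^ k)) y)"
          "{k}"] by simp
    finally show ?thesis .
  qed (simp add: R_def[symmetric])
  have "(\<integral>\<^sup>+y. ?h y \<partial>lborel) \<le> (\<integral>\<^sup>+y. (\<Sum>k. ennreal (c k) * (jp p (?F y)
      * indicator (cball 0 (R / 2 ^ k)) y)) \<partial>lborel)"
    by (rule nn_integral_mono_AE, rule AE_mp[OF AE_lborel_singleton[of
        "0::real^3"]], rule AE_I2, rule impI, rule pw)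
  also have "\<dots> = (\<Sum>k. \<integral>\<^sup>+y. ennreal (c k) * (jp p (?F y) * indicator (cball 0 (R / 2 ^ k)) y) \<partial>lborel)"
    by (rule nn_integral_suminf) measurable
  also have "\<dots> = (\<Sum>k. ennreal (c k) * (\<integral>\<^sup>+y. jp p (?F y) * indicator (cball 0 (R / 2 ^ k)) y \<partial>lborel))"
    by (intro suminf_cong nn_integral_cmult) measurable
  also have "\<dots> \<le> (\<Sum>k. ennreal (c k) * (ennreal (8 * ?V * (R / 2 ^ k)\<^sup>2 / R) * jpI p))"
    by (intro suminf_le mult_left_mono slab) auto
  also have "\<dots> = (\<Sum>k. ennreal (a * (2 powr q / 4) ^ k) * jpI p)"
  proof (rule suminf_cong)
    fix k
    have "c k * (8 * ?V * (R / 2 ^ k)\<^sup>2 / R) = a * (2 powr q / 4) ^ k"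
    proof -
      have "(R / 2 ^ k)\<^sup>2 / R = R / 4 ^ k"
        using R by (simp add: power_divide power2_eq_square power_mult_distrib[symmetric])
      then have "c k * (8 * ?V * (R / 2 ^ k)\<^sup>2 / R) = c k * (8 * ?V * (R / 4 ^ k))"
        by (simp only: times_divide_eq_right[symmetric] mult.assoc)
      also have "\<dots> = a * (2 powr q / 4) ^ k" unfolding c_def a_def power_divide
          by (simp only: times_divide_eq_right times_divide_eq_left mult_ac)
      finally show ?thesis .
    qed
    then show "ennreal (c k) * (ennreal (8 * ?V * (R / 2 ^ k)\<^sup>2 / R) * jpI p) = ennreal (a
        * (2 powr q / 4) ^ k) * jpI p"
      using c0[of k] R V by (metis ennreal_mult' mult.assoc)
  qed
  also have "\<dots> = (\<Sum>k. ennreal (a * (2 powr q / 4) ^ k)) * jpI p" by simp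
  also have "(\<Sum>k. ennreal (a * (2 powr q / 4) ^ k)) = ennreal (a * (1 / (1 - 2 powr q / 4)))"
  proof -
    have "2 powr q < 2 powr 2" using q by (intro powr_less_mono) auto
    then have r: "norm (2 powr q / 4 :: real) < 1" by simp
    have "a \<ge> 0" unfolding a_def using R V by simp
    then show ?thesis using r
      by (subst suminf_ennreal2) (auto simp: suminf_mult[OF summable_geometric[OF r]] suminf_geometric[OF
          r] intro!: summable_mult summable_geometric)
  qed
  also have "\<dots> \<le> ennreal (64 * ?V * 2 powr q / (1 - 2 powr q / 4))"
  proof (rule ennreal_leI)
    have "2 powr q < 2 powr 2" using q by (intro powr_less_mono) auto
    then have r: "1 - 2 powr q / 4 > 0" by simp
    \<comment> \<open>From 1 + 4R with R > 1. Together with the 8 of the slab estimate this accounts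
      for the 64.\<close>
    have "japanese \<xi> \<le> 8 * R" using japanese_le[of \<xi>] False by (simp add: R_def)
    then have "japanese \<xi> powr (2 * \<sigma>) \<le> (8 * R) powr (2 * \<sigma>)" using \<sigma> japanese_pos[of \<xi>]
        by (intro powr_mono2) auto
    also have "\<dots> = 8 powr (2 * \<sigma>) * R powr (2 * \<sigma>)" using R by (simp add: powr_mult)
    also have "\<dots> \<le> 8 powr 1 * R powr (2 * \<sigma>)" using \<sigma> by (intro mult_right_mono powr_mono) auto
    finally have j: "japanese \<xi> powr (2 * \<sigma>) \<le> 8 * R powr (2 * \<sigma>)" by simp
    \<comment> \<open>The exponents -q, 2\<sigma> and 1 cancel, which makes the bound uniform in
      \<xi>.\<close>
    have RR: "R powr (- q) * R powr (2 * \<sigma>) * R = 1"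
    proof -
      have "R powr (- q) * R powr (2 * \<sigma>) * R powr 1 = 1" unfolding powr_add[symmetric] using R
          by (simp add: q_def)
      then show ?thesis using R by simp
    qed
    have "a = 8 * ?V * 2 powr q * R powr (- q) * R * (japanese \<xi> powr (2 * \<sigma>))" unfolding a_def
        by (simp only: mult_ac)
    also have "\<dots> \<le> 8 * ?V * 2 powr q * R powr (- q) * R * (8 * R powr (2 * \<sigma>))"
      using R V by (intro mult_left_mono j) auto
    also have "\<dots> = 8 * ?V * 2 powr q * 8 * (R powr (- q) * R powr (2 * \<sigma>) * R)" by (simp only: mult_ac)
    also have "\<dots> = 64 * ?V * 2 powr q" unfolding RR by simp
    finally have "a \<le> 64 * ?V * 2 powr q" .
    then show "a * (1 / (1 - 2 powr q / 4)) \<le> 64 * ?V * 2 powr q / (1 - 2 powr q / 4)"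
      using r by (simp add: divide_right_mono)
  qed
  finally have "(\<integral>\<^sup>+y. ?h y \<partial>lborel) \<le> ennreal (64 * ?V * 2 powr q / (1 - 2 powr q / 4)) * jpI p"
      by (simp add: mult_right_mono)
  also have "\<dots> \<le> C" unfolding C_def q_def by simp
  finally show ?thesis .
qed

section \<open>Cauchy-Schwarz bounds for convolutions with a kernel\<close>

lemma nn_integral_convolution_translate:
  fixes g :: "'a::euclidean_space \<Rightarrow> ennreal"
  assumes [measurable]: "g \<in> borel_measurable borel"
  shows "(\<integral>\<^sup>+\<eta>. g (\<zeta> - \<eta>) \<partial>lborel) = (\<integral>\<^sup>+\<eta>. g \<eta> \<partial>lborel)"
    and "(\<integral>\<^sup>+\<zeta>. g (\<zeta> - \<eta>) \<partial>lborel) = (\<integral>\<^sup>+\<eta>. g \<eta> \<partial>lborel)"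
    and "(\<integral>\<^sup>+\<zeta>. g (\<zeta> + \<eta>) \<partial>lborel) = (\<integral>\<^sup>+\<eta>. g \<eta> \<partial>lborel)"
  using nn_integral_lborel_affine[of g "-1" \<zeta>] nn_integral_lborel_affine[of g "1" "-\<eta>"]
    nn_integral_lborel_affine[of g "1" "\<eta>"] by (simp_all add: add.commute)

context
  fixes K :: "'a::euclidean_space \<Rightarrow> 'a \<Rightarrow> ennreal" and f g :: "'a \<Rightarrow> ennreal"
  assumes K [measurable]: "case_prod K \<in> borel_measurable (borel \<Otimes>\<^sub>M borel)"
    and fg [measurable]: "f \<in> borel_measurable borel" "g \<in> borel_measurable borel"
begin

text \<open>Cauchy-Schwarz in \<eta> separates the kernel from the product
  \<open>f \<eta> * g (\<zeta> - \<eta>)\<close>, whose square integrates to the product of the two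
  norms.\<close>

lemma schur_output:
  assumes C: "\<And>\<zeta>. (\<integral>\<^sup>+\<eta>. (K \<zeta> \<eta>)\<^sup>2 \<partial>lborel) \<le> C"
  shows "(\<integral>\<^sup>+\<zeta>. (\<integral>\<^sup>+\<eta>. K \<zeta> \<eta> * (f \<eta> * g (\<zeta> - \<eta>)) \<partial>lborel)\<^sup>2 \<partial>lborel) \<le> C * ((\<integral>\<^sup>+\<eta>. (f \<eta>)\<^sup>2 \<partial>lborel)
      * (\<integral>\<^sup>+\<eta>. (g \<eta>)\<^sup>2 \<partial>lborel))"
proof -
  have "(\<integral>\<^sup>+\<zeta>. (\<integral>\<^sup>+\<eta>. K \<zeta> \<eta> * (f \<eta> * g (\<zeta> - \<eta>)) \<partial>lborel)\<^sup>2 \<partial>lborel)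
     \<le> (\<integral>\<^sup>+\<zeta>. C * (\<integral>\<^sup>+\<eta>. (f \<eta>)\<^sup>2 * (g (\<zeta> - \<eta>))\<^sup>2 \<partial>lborel) \<partial>lborel)"
  proof (rule nn_integral_mono)
    fix \<zeta>
    have "(\<integral>\<^sup>+\<eta>. K \<zeta> \<eta> * (f \<eta> * g (\<zeta> - \<eta>)) \<partial>lborel)\<^sup>2
       \<le> (\<integral>\<^sup>+\<eta>. (K \<zeta> \<eta>)\<^sup>2 \<partial>lborel) * (\<integral>\<^sup>+\<eta>. (f \<eta> * g (\<zeta> - \<eta>))\<^sup>2 \<partial>lborel)"
      by (rule Cauchy_Schwarz_nn_integral) measurable
    also have "\<dots> \<le> C * (\<integral>\<^sup>+\<eta>. (f \<eta>)\<^sup>2 * (g (\<zeta> - \<eta>))\<^sup>2 \<partial>lborel)"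
      unfolding power_mult_distrib by (intro mult_right_mono C) simp
    finally show "(\<integral>\<^sup>+\<eta>. K \<zeta> \<eta> * (f \<eta> * g (\<zeta> - \<eta>)) \<partial>lborel)\<^sup>2 \<le> C * (\<integral>\<^sup>+\<eta>. (f \<eta>)\<^sup>2 * (g (\<zeta> - \<eta>))\<^sup>2 \<partial>lborel)" .
  qed
  also have "\<dots> = C * (\<integral>\<^sup>+\<zeta>. \<integral>\<^sup>+\<eta>. (f \<eta>)\<^sup>2 * (g (\<zeta> - \<eta>))\<^sup>2 \<partial>lborel \<partial>lborel)"
    by (rule nn_integral_cmult) measurable
  also have "(\<integral>\<^sup>+\<zeta>. \<integral>\<^sup>+\<eta>. (f \<eta>)\<^sup>2 * (g (\<zeta> - \<eta>))\<^sup>2 \<partial>lborel \<partial>lborel) = (\<integral>\<^sup>+\<eta>. \<integral>\<^sup>+\<zeta>. (f \<eta>)\<^sup>2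
      * (g (\<zeta> - \<eta>))\<^sup>2 \<partial>lborel \<partial>lborel)"
    by (rule lborel_pair.Fubini') measurable
  also have "\<dots> = (\<integral>\<^sup>+\<eta>. (f \<eta>)\<^sup>2 * (\<integral>\<^sup>+\<eta>. (g \<eta>)\<^sup>2 \<partial>lborel) \<partial>lborel)"
  proof (rule nn_integral_cong)
    fix \<eta>
    show "(\<integral>\<^sup>+\<zeta>. (f \<eta>)\<^sup>2 * (g (\<zeta> - \<eta>))\<^sup>2 \<partial>lborel) = (f \<eta>)\<^sup>2 * (\<integral>\<^sup>+\<eta>. (g \<eta>)\<^sup>2 \<partial>lborel)"
      using nn_integral_convolution_translate(2)[of "\<lambda>\<eta>. (g \<eta>)\<^sup>2" \<eta>] by (simp add: nn_integral_cmult)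
  qed
  also have "\<dots> = (\<integral>\<^sup>+\<eta>. (f \<eta>)\<^sup>2 \<partial>lborel) * (\<integral>\<^sup>+\<eta>. (g \<eta>)\<^sup>2 \<partial>lborel)" by (rule nn_integral_multc) measurable
  finally show ?thesis .
qed

text \<open>Here the kernel is grouped with \<open>f\<close>: the integral of the square of
  \<open>g\<close> is independent of \<zeta> and leaves the inequality, and the kernel is then
  integrated over \<zeta> with \<eta> fixed.\<close>

lemma schur_left:
  assumes C: "\<And>\<eta>. (\<integral>\<^sup>+\<zeta>. (K \<zeta> \<eta>)\<^sup>2 \<partial>lborel) \<le> C"
  shows "(\<integral>\<^sup>+\<zeta>. (\<integral>\<^sup>+\<eta>. K \<zeta> \<eta> * (f \<eta> * g (\<zeta> - \<eta>)) \<partial>lborel)\<^sup>2 \<partial>lborel) \<le> C * ((\<integral>\<^sup>+\<eta>. (f \<eta>)\<^sup>2 \<partial>lborel)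
      * (\<integral>\<^sup>+\<eta>. (g \<eta>)\<^sup>2 \<partial>lborel))"
proof -
  let ?G = "\<integral>\<^sup>+\<eta>. (g \<eta>)\<^sup>2 \<partial>lborel"
  have "(\<integral>\<^sup>+\<zeta>. (\<integral>\<^sup>+\<eta>. K \<zeta> \<eta> * (f \<eta> * g (\<zeta> - \<eta>)) \<partial>lborel)\<^sup>2 \<partial>lborel)
     \<le> (\<integral>\<^sup>+\<zeta>. (\<integral>\<^sup>+\<eta>. (K \<zeta> \<eta>)\<^sup>2 * (f \<eta>)\<^sup>2 \<partial>lborel) * ?G \<partial>lborel)"
  proof (rule nn_integral_mono)
    fix \<zeta>
    have "(\<integral>\<^sup>+\<eta>. (K \<zeta> \<eta> * f \<eta>) * g (\<zeta> - \<eta>) \<partial>lborel)\<^sup>2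
       \<le> (\<integral>\<^sup>+\<eta>. (K \<zeta> \<eta> * f \<eta>)\<^sup>2 \<partial>lborel) * (\<integral>\<^sup>+\<eta>. (g (\<zeta> - \<eta>))\<^sup>2 \<partial>lborel)"
      by (rule Cauchy_Schwarz_nn_integral) measurable
    then show "(\<integral>\<^sup>+\<eta>. K \<zeta> \<eta> * (f \<eta> * g (\<zeta> - \<eta>)) \<partial>lborel)\<^sup>2 \<le> (\<integral>\<^sup>+\<eta>. (K \<zeta> \<eta>)\<^sup>2 * (f \<eta>)\<^sup>2 \<partial>lborel) * ?G"
      using nn_integral_convolution_translate(1)[of "\<lambda>\<eta>. (g \<eta>)\<^sup>2" \<zeta>]
          by (simp add: power_mult_distrib mult.assoc)
  qed
  also have "\<dots> = (\<integral>\<^sup>+\<zeta>. \<integral>\<^sup>+\<eta>. (K \<zeta> \<eta>)\<^sup>2 * (f \<eta>)\<^sup>2 \<partial>lborel \<partial>lborel) * ?G"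
    by (rule nn_integral_multc) measurable
  also have "(\<integral>\<^sup>+\<zeta>. \<integral>\<^sup>+\<eta>. (K \<zeta> \<eta>)\<^sup>2 * (f \<eta>)\<^sup>2 \<partial>lborel \<partial>lborel) = (\<integral>\<^sup>+\<eta>. \<integral>\<^sup>+\<zeta>. (K \<zeta> \<eta>)\<^sup>2
      * (f \<eta>)\<^sup>2 \<partial>lborel \<partial>lborel)"
    by (rule lborel_pair.Fubini') measurable
  also have "\<dots> \<le> (\<integral>\<^sup>+\<eta>. C * (f \<eta>)\<^sup>2 \<partial>lborel)"
    using C by (intro nn_integral_mono) (simp add: nn_integral_multc mult_right_mono)
  also have "\<dots> = C * (\<integral>\<^sup>+\<eta>. (f \<eta>)\<^sup>2 \<partial>lborel)" by (rule nn_integral_cmult) measurable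
  finally show ?thesis by (simp add: mult_right_mono mult.assoc)
qed

end

text \<open>The reflection of \<eta> to \<open>\<zeta> - \<eta>\<close> exchanges the two factors
  and reduces this to \<open>schur_left\<close>.\<close>

lemma schur_right:
  fixes K :: "'a::euclidean_space \<Rightarrow> 'a \<Rightarrow> ennreal"
  assumes K [measurable]: "case_prod K \<in> borel_measurable (borel \<Otimes>\<^sub>M borel)"
    and fg [measurable]: "f \<in> borel_measurable borel" "g \<in> borel_measurable borel"
    and C: "\<And>y. (\<integral>\<^sup>+\<zeta>. (K \<zeta> (\<zeta> - y))\<^sup>2 \<partial>lborel) \<le> C"
  shows "(\<integral>\<^sup>+\<zeta>. (\<integral>\<^sup>+\<eta>. K \<zeta> \<eta> * (f \<eta> * g (\<zeta> - \<eta>)) \<partial>lborel)\<^sup>2 \<partial>lborel) \<le> C * ((\<integral>\<^sup>+\<eta>. (f \<eta>)\<^sup>2 \<partial>lborel)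
      * (\<integral>\<^sup>+\<eta>. (g \<eta>)\<^sup>2 \<partial>lborel))"
proof -
  have "(\<integral>\<^sup>+\<eta>. K \<zeta> \<eta> * (f \<eta> * g (\<zeta> - \<eta>)) \<partial>lborel) = (\<integral>\<^sup>+y. K \<zeta> (\<zeta> - y) * (g y * f (\<zeta> - y)) \<partial>lborel)" for \<zeta>
    using nn_integral_convolution_translate(1)[of "\<lambda>\<eta>. K \<zeta> \<eta> * (f \<eta> * g (\<zeta> - \<eta>))" \<zeta>]
        by (simp add: mult.commute)
  then show ?thesis
    using schur_left[of "\<lambda>\<zeta> y. K \<zeta> (\<zeta> - y)" g f C] C by (simp add: mult.commute)
qed

section \<open>The bilinear kernel estimate\<close>

text \<open>Complex conjugation of a factor reflects its Fourier transform and so only flips the sign of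
  \<open>\<alpha>\<close> or \<open>\<beta>\<close>. The output always has modulation \<open>modS 1\<close>.\<close>

abbreviation modS :: "real \<Rightarrow> spacetime \<Rightarrow> real" where
  "modS \<alpha> \<zeta> \<equiv> japanese (snd \<zeta> + \<alpha> * (norm (fst \<zeta>))\<^sup>2)"

abbreviation modW :: "real \<Rightarrow> spacetime \<Rightarrow> real" where
  "modW \<beta> \<zeta> \<equiv> japanese (snd \<zeta> + \<beta> * japanese (fst \<zeta>))"

text \<open>The resonance gain: a modulation of order \<open>j\<^sup>2\<close>, raised to a power of
  at least 1/2, is worth a full factor \<open>j\<close>.\<close>

lemma powr_ge_base:
  fixes j L b :: real
  assumes "1 \<le> j" "j\<^sup>2 \<le> 12 * L" "1/2 \<le> b"
  shows "j \<le> 12 powr b * L powr b"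
proof -
  have L: "L > 0" using assms by (smt (verit) one_le_power)
  have "j = j powr 1" using assms by simp
  also have "\<dots> \<le> j powr (2 * b)" using assms by (intro powr_mono) auto
  also have "\<dots> = (j\<^sup>2) powr b" using assms by (simp add: powr_powr[symmetric])
  also have "\<dots> \<le> (12 * L) powr b" using assms by (intro powr_mono2) auto
  also have "\<dots> = 12 powr b * L powr b" using L by (simp add: powr_mult)
  finally show ?thesis .
qed

lemma powr_scale_le:
  fixes x y c s :: real
  assumes "1 \<le> x" "x \<le> c * y" "0 \<le> s" "0 < c" "0 < y"
  shows "x powr s \<le> c powr s * y powr s"
  using powr_mono2[of s x "c * y"] assms by (simp add: powr_mult)

lemma powr_cancel: "0 < (L::real) \<Longrightarrow> L powr (- b) * L powr b = 1"
  by (simp add: powr_add[symmetric])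

text \<open>In the application \<open>j\<close>, \<open>j1\<close>, \<open>j2\<close> are the
  brackets of the output, first and second frequency, and \<open>L0\<close>, \<open>L1\<close>,
  \<open>L2\<close> their modulations. The factor \<open>j2\<close> is isolated here so that it can
  be paid by a large modulation, leaving -1/2 for a kernel and s - 1/2 for the norm.\<close>

lemma powr_split_le:
  fixes j L0 :: real
  assumes "1 \<le> j" "1 \<le> j2" "0 \<le> s" "j \<le> 2 * j2"
  shows "j powr s * L0 powr (- b) \<le> 2 powr s * (j2 powr (s - 1/2) * (j2 powr (-1/2) * (j2 * L0 powr (- b))))"
proof -
  have "j2 powr (s - 1/2) * (j2 powr (-1/2) * j2 powr 1) = j2 powr ((s - 1/2) + (-1/2 + 1))"
      by (simp only: powr_add)
  then have "j2 powr s = j2 powr (s - 1/2) * (j2 powr (-1/2) * j2)" using assms by simp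
  moreover have "j powr s * L0 powr (- b) \<le> (2 powr s * j2 powr s) * L0 powr (- b)"
    using assms by (intro mult_right_mono powr_scale_le) auto
  ultimately show ?thesis by (simp only: mult_ac)
qed

context
  fixes j j2 L0 L1 L2 s b :: real
  assumes ge1: "1 \<le> j" "1 \<le> j2" "1 \<le> L0" "1 \<le> L1" "1 \<le> L2"
    and s: "0 \<le> s" and b: "1/2 \<le> b" and j: "j \<le> 2 * j2"
begin

text \<open>The output modulation pays for \<open>j2\<close> and is used up. The negative half power
  moves to the smaller \<open>j1\<close>, because the kernel is later integrated over the first
  frequency.\<close>

lemma kernel_case_output:
  assumes "1 \<le> j1" "j1 \<le> j2" and L: "j2\<^sup>2 \<le> 12 * L0"
  shows "j powr s * L0 powr (- b) \<le> (2 powr s * 12 powr b) *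
    ((j1 powr (-1/2) * L1 powr (- b) * L2 powr (- b)) * (L1 powr b * (j2 powr (s - 1/2) * L2 powr b)))"
proof -
  have "j powr s * L0 powr (- b) \<le> 2 powr s * (j2 powr (s - 1/2) * (j2 powr (-1/2) * (j2 * L0 powr (- b))))"
    using ge1 s j by (intro powr_split_le) auto
  also have "\<dots> \<le> 2 powr s * (j2 powr (s - 1/2) * (j1 powr (-1/2) * 12 powr b))"
  proof (intro mult_left_mono mult_mono)
    show "j2 powr (-1/2) \<le> j1 powr (-1/2)" using assms by (intro powr_mono2') auto
    have "j2 * L0 powr (- b) \<le> (12 powr b * L0 powr b) * L0 powr (- b)"
      using ge1 b L by (intro mult_right_mono powr_ge_base) auto
    also have "\<dots> = 12 powr b * (L0 powr (- b) * L0 powr b)" by (simp only: mult_ac)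
    finally show "j2 * L0 powr (- b) \<le> 12 powr b" using powr_cancel[of L0 b] ge1 by simp
  qed (use ge1 in auto)
  also have "\<dots> = (2 powr s * 12 powr b) * (j1 powr (-1/2) * (L1 powr (- b) * L1 powr b)
      * (j2 powr (s - 1/2) * (L2 powr (- b) * L2 powr b)))"
    using powr_cancel[of L1 b] powr_cancel[of L2 b] ge1 by simp
  finally show ?thesis by (simp only: mult_ac)
qed

text \<open>The modulation of the first factor pays. The kernel is then integrated over the output
  frequency, so the half power passes from \<open>j2\<close> to \<open>j\<close> at the cost of a
  factor 2.\<close>

lemma kernel_case_left:
  assumes L: "j2\<^sup>2 \<le> 12 * L1"
  shows "j powr s * L0 powr (- b) \<le> (2 powr s * 12 powr b * 2) *
    ((j powr (-1/2) * L0 powr (- b) * L2 powr (- b)) * (L1 powr b * (j2 powr (s - 1/2) * L2 powr b)))"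
proof -
  have "j powr s * L0 powr (- b) \<le> 2 powr s * (j2 powr (s - 1/2) * (j2 powr (-1/2) * (j2 * L0 powr (- b))))"
    using ge1 s j by (intro powr_split_le) auto
  also have "\<dots> \<le> 2 powr s * (j2 powr (s - 1/2) * ((2 * j powr (-1/2)) * ((12 powr b * L1 powr b)
      * L0 powr (- b))))"
  proof (intro mult_left_mono mult_mono mult_right_mono)
    have "(2 * j2) powr (-1/2) \<le> j powr (-1/2)" using ge1 j by (intro powr_mono2') auto
    then have "2 powr (1/2) * (2 powr (-1/2) * j2 powr (-1/2)) \<le> 2 powr (1/2) * j powr (-1/2)"
      using ge1 by (intro mult_left_mono) (auto simp: powr_mult)
    then have "j2 powr (-1/2) \<le> 2 powr (1/2) * j powr (-1/2)"
        by (simp add: mult.assoc[symmetric] powr_add[symmetric])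
    also have "\<dots> \<le> 2 powr 1 * j powr (-1/2)" by (intro mult_right_mono powr_mono) auto
    finally show "j2 powr (-1/2) \<le> 2 * j powr (-1/2)" by simp
    show "j2 \<le> 12 powr b * L1 powr b" using ge1 b L by (intro powr_ge_base) auto
  qed (use ge1 in auto)
  also have "\<dots> = (2 powr s * 12 powr b * 2) * (j powr (-1/2) * L0 powr (- b) * L1 powr b
      * (j2 powr (s - 1/2) * (L2 powr (- b) * L2 powr b)))"
    using powr_cancel[of L2 b] ge1 by (simp only: mult_ac)
  finally show ?thesis by (simp only: mult_ac)
qed

text \<open>The modulation of the second factor pays. The half power may stay on \<open>j2\<close>,
  the frequency that is fixed when this kernel is integrated.\<close>

lemma kernel_case_right:
  assumes L: "j2\<^sup>2 \<le> 12 * L2"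
  shows "j powr s * L0 powr (- b) \<le> (2 powr s * 12 powr b) *
    ((j2 powr (-1/2) * L0 powr (- b) * L1 powr (- b)) * (L1 powr b * (j2 powr (s - 1/2) * L2 powr b)))"
proof -
  have "j powr s * L0 powr (- b) \<le> 2 powr s * (j2 powr (s - 1/2) * (j2 powr (-1/2) * (j2 * L0 powr (- b))))"
    using ge1 s j by (intro powr_split_le) auto
  also have "\<dots> \<le> 2 powr s * (j2 powr (s - 1/2) * (j2 powr (-1/2) * ((12 powr b * L2 powr b)
      * L0 powr (- b))))"
    using ge1 b L by (intro mult_left_mono mult_right_mono powr_ge_base) auto
  also have "\<dots> = (2 powr s * 12 powr b) * (j2 powr (-1/2) * L0 powr (- b) * (L1 powr (- b) * L1 powr b)
      * (j2 powr (s - 1/2) * L2 powr b))"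
    using powr_cancel[of L1 b] ge1 by (simp only: mult_ac)
  finally show ?thesis by (simp only: mult_ac)
qed

end

text \<open>All s derivatives are put on the first frequency, and \<sigma> of them are kept in the
  kernel. The balancing negative power of \<open>j2\<close> is compensated in the norm of the second
  factor.\<close>

lemma kernel_case_low_high:
  fixes j j1 j2 L0 L1 L2 :: real
  assumes "1 \<le> j" "1 \<le> j1" "1 \<le> j2" "1 \<le> L0" "1 \<le> L2" "0 \<le> s" "0 \<le> \<epsilon>" and "j \<le> 9 * j1"
  shows "j powr s * L0 powr (- b) \<le> 9 powr s *
    ((j1 powr \<sigma> * j2 powr (- (\<sigma> + 1/2)) * L0 powr (- b) * L2 powr (- b)) * (j1 powr (s - \<sigma>) * (j2 powr (\<sigma>
        + 1/2 + \<epsilon>) * L2 powr b)))"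
proof -
  have "j powr s * L0 powr (- b) \<le> (9 powr s * j1 powr s) * L0 powr (- b) * 1"
    using powr_scale_le[of j 9 j1 s] assms by (simp add: mult_right_mono)
  also have "\<dots> \<le> (9 powr s * j1 powr s) * L0 powr (- b) * j2 powr \<epsilon>"
    using assms by (intro mult_left_mono ge_one_powr_ge_zero) auto
  also have "j1 powr s = j1 powr \<sigma> * j1 powr (s - \<sigma>)" by (simp add: powr_add[symmetric])
  also have "j2 powr \<epsilon> = j2 powr (- (\<sigma> + 1/2)) * j2 powr (\<sigma> + 1/2 + \<epsilon>)" by (simp add: powr_add[symmetric])
  also have "9 powr s * (j1 powr \<sigma> * j1 powr (s - \<sigma>)) * L0 powr (- b) * (j2 powr (- (\<sigma> + 1/2))
      * j2 powr (\<sigma> + 1/2 + \<epsilon>))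
     = 9 powr s * ((j1 powr \<sigma> * j1 powr (s - \<sigma>)) * L0 powr (- b) * (j2 powr (- (\<sigma> + 1/2)) * j2 powr (\<sigma>
         + 1/2 + \<epsilon>)) * (L2 powr (- b) * L2 powr b))"
    using powr_cancel[of L2 b] assms by simp
  finally show ?thesis by (simp only: mult_ac)
qed

text \<open>Here \<open>j2\<close> controls both other brackets, so \<sigma> derivatives and the
  missing half power can be charged to it. The 3 is a bound for the square root of 5.\<close>

lemma kernel_case_comparable:
  fixes j j1 j2 L0 L1 L2 :: real
  assumes "1 \<le> j" "1 \<le> j1" "1 \<le> j2" "1 \<le> L0" "1 \<le> L2" "0 \<le> s" "0 \<le> \<sigma>" "0 \<le> \<epsilon>"
    and "j \<le> 9 * j1" "j1 \<le> 4 * j2" "j \<le> 5 * j2"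
  shows "j powr s * L0 powr (- b) \<le> (9 powr s * 4 powr \<sigma> * 3) *
    ((j powr (-1/2) * L0 powr (- b) * L2 powr (- b)) * (j1 powr (s - \<sigma>) * (j2 powr (\<sigma> + 1/2 + \<epsilon>)
        * L2 powr b)))"
proof -
  have "j powr s * L0 powr (- b) \<le> (9 powr s * j1 powr s) * L0 powr (- b)"
    using powr_scale_le[of j 9 j1 s] assms by (simp add: mult_right_mono)
  also have "j1 powr s = j1 powr (s - \<sigma>) * j1 powr \<sigma>" by (simp add: powr_add[symmetric])
  also have "9 powr s * (j1 powr (s - \<sigma>) * j1 powr \<sigma>) * L0 powr (- b) = (9 powr s * j1 powr (s - \<sigma>)
      * L0 powr (- b)) * (j1 powr \<sigma> * 1)"
    by (simp only: mult_ac mult_1_right)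
  also have "\<dots> \<le> (9 powr s * j1 powr (s - \<sigma>) * L0 powr (- b)) * ((4 powr \<sigma> * j2 powr \<sigma>) * (j powr (-1/2)
      * (3 * j2 powr (1/2 + \<epsilon>))))"
  proof (intro mult_left_mono mult_mono)
    show "j1 powr \<sigma> \<le> 4 powr \<sigma> * j2 powr \<sigma>" using assms by (intro powr_scale_le) auto
    have "(5::real) powr (1/2) \<le> 9 powr (1/2)" by (intro powr_mono2) auto
    also have "(9::real) powr (1/2) = 3"
      using powr_powr[of "3::real" 2 "1/2"] by simp
    finally have 5: "(5::real) powr (1/2) \<le> 3" .
    have "j powr (1/2) \<le> 5 powr (1/2) * j2 powr (1/2)" using assms by (intro powr_scale_le) auto
    also have "\<dots> \<le> 3 * j2 powr (1/2 + \<epsilon>)" using assms 5 by (intro mult_mono powr_mono) auto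
    finally have "j powr (-1/2) * j powr (1/2) \<le> j powr (-1/2) * (3 * j2 powr (1/2 + \<epsilon>))"
        by (rule mult_left_mono) simp
    moreover have "j powr (-1/2) * j powr (1/2) = 1" using powr_cancel[of j "1/2"] assms by simp
    ultimately show "1 \<le> j powr (-1/2) * (3 * j2 powr (1/2 + \<epsilon>))" by simp
  qed (use assms in auto)
  also have "\<dots> = (9 powr s * 4 powr \<sigma> * 3) * (j powr (-1/2) * L0 powr (- b) * j1 powr (s - \<sigma>) * (j2 powr \<sigma>
      * j2 powr (1/2 + \<epsilon>)))"
    by (simp only: mult_ac)
  also have "j2 powr \<sigma> * j2 powr (1/2 + \<epsilon>) = j2 powr (\<sigma> + 1/2 + \<epsilon>) * (L2 powr (- b) * L2 powr b)"
    using powr_cancel[of L2 b] assms by (simp add: powr_add[symmetric] add.assoc)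
  finally show ?thesis by (simp only: mult_ac)
qed

text \<open>Let r and r1 be the norms of the second and first frequency. The modulations combine so
  that \<tau> and \<tau>1 cancel, leaving
  \<open>(norm \<xi>)\<^sup>2 - \<alpha> * r1\<^sup>2\<close> up to 1 + r. By
  \<open>8 * r1 \<le> r\<close> this main term is at least
  \<open>(r - r1)\<^sup>2 - r1\<^sup>2\<close>, hence at least three quarters of
  \<open>r\<^sup>2\<close>. Absorbing r into \<open>r\<^sup>2 / 4 + 1\<close> gives
  \<open>1 + r\<^sup>2\<close> at most 4 times the sum of the three brackets, and the largest
  bracket is at least a third of the sum.\<close>

lemma resonance:
  fixes \<xi> \<xi>1 :: "real^3" and \<tau> \<tau>1 :: real
  assumes \<alpha>: "\<alpha> = 1 \<or> \<alpha> = -1" and \<beta>: "\<bar>\<beta>\<bar> \<le> 1" and small: "8 * norm \<xi>1 \<le> norm (\<xi> - \<xi>1)"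
  shows "(japanese (\<xi> - \<xi>1))\<^sup>2 \<le> 12 * japanese (\<tau> + (norm \<xi>)\<^sup>2)
    \<or> (japanese (\<xi> - \<xi>1))\<^sup>2 \<le> 12 * japanese (\<tau>1 + \<alpha> * (norm \<xi>1)\<^sup>2)
    \<or> (japanese (\<xi> - \<xi>1))\<^sup>2 \<le> 12 * japanese ((\<tau> - \<tau>1) + \<beta> * japanese (\<xi> - \<xi>1))"
proof -
  define r where "r = norm (\<xi> - \<xi>1)"
  define r1 where "r1 = norm \<xi>1"
  define x0 where "x0 = \<tau> + (norm \<xi>)\<^sup>2"
  define x1 where "x1 = \<tau>1 + \<alpha> * (norm \<xi>1)\<^sup>2"
  define x2 where "x2 = (\<tau> - \<tau>1) + \<beta> * japanese (\<xi> - \<xi>1)"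
  have r: "0 \<le> r" "0 \<le> r1" "8 * r1 \<le> r" using small by (auto simp: r_def r1_def)
  have "r - r1 \<le> norm \<xi>" using norm_triangle_ineq4[of \<xi> \<xi>1] by (simp add: r_def r1_def)
  then have "(r - r1)\<^sup>2 \<le> (norm \<xi>)\<^sup>2" using r by (intro power_mono) auto
  moreover have "(r - r1)\<^sup>2 - r1\<^sup>2 = r\<^sup>2 - 2 * (r * r1)" by (simp add: power2_diff)
  moreover have "r * (8 * r1) \<le> r * r" using r by (intro mult_left_mono) auto
  moreover have "\<alpha> * r1\<^sup>2 \<le> r1\<^sup>2" using \<alpha> by auto
  ultimately have 1: "3 / 4 * r\<^sup>2 \<le> (norm \<xi>)\<^sup>2 - \<alpha> * r1\<^sup>2" by (simp add: power2_eq_square)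
  have "\<bar>\<beta> * japanese (\<xi> - \<xi>1)\<bar> \<le> 1 * japanese (\<xi> - \<xi>1)"
    unfolding abs_mult using \<beta> japanese_pos[of "\<xi> - \<xi>1"] by (intro mult_mono) auto
  also have "\<dots> \<le> 1 + r" using japanese_le[of "\<xi> - \<xi>1"] by (simp add: r_def)
  finally have 2: "\<bar>\<beta> * japanese (\<xi> - \<xi>1)\<bar> \<le> 1 + r" .
  have "x0 - x1 - x2 = (norm \<xi>)\<^sup>2 - \<alpha> * r1\<^sup>2 - \<beta> * japanese (\<xi> - \<xi>1)"
      by (simp add: x0_def x1_def x2_def r1_def)
  then have "3 / 4 * r\<^sup>2 - (1 + r) \<le> \<bar>x0\<bar> + \<bar>x1\<bar> + \<bar>x2\<bar>" using 1 2 by linarith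
  moreover have "\<bar>x0\<bar> \<le> japanese x0" "\<bar>x1\<bar> \<le> japanese x1" "\<bar>x2\<bar> \<le> japanese x2"
    using norm_le_japanese[of x0] norm_le_japanese[of x1] norm_le_japanese[of x2] by auto
  moreover have "r \<le> r\<^sup>2 / 4 + 1" using zero_le_power2[of "r / 2 - 1"]
      by (simp add: power2_eq_square algebra_simps)
  moreover have "1 \<le> japanese x0" "1 \<le> japanese x1" "1 \<le> japanese x2" by (rule japanese_ge_1)+
  ultimately have "1 + r\<^sup>2 \<le> 4 * (japanese x0 + japanese x1 + japanese x2)" by argo
  then show ?thesis unfolding x0_def[symmetric] x1_def[symmetric] x2_def[symmetric] japanese_square
      r_def[symmetric] by argo
qed

lemma ennreal_add_square_le: "(x + y)\<^sup>2 \<le> 4 * (x\<^sup>2 + y\<^sup>2)" for x y :: ennreal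
proof -
  have *: "(x + y)\<^sup>2 \<le> 4 * (x\<^sup>2 + y\<^sup>2)" if "x \<le> y" for x y :: ennreal
  proof -
    have "(x + y)\<^sup>2 \<le> (2 * y)\<^sup>2" using that by (intro power_mono) (auto simp: mult_2 add_right_mono)
    also have "\<dots> = 4 * y\<^sup>2" by (simp add: power_mult_distrib)
    also have "\<dots> \<le> 4 * (x\<^sup>2 + y\<^sup>2)" by (intro mult_left_mono) auto
    finally show ?thesis .
  qed
  show ?thesis using *[of x y] *[of y x] by (cases "x \<le> y") (auto simp: add.commute)
qed

lemma ennreal_add5_square_le:
  "(x1 + x2 + x3 + (x4 + x5))\<^sup>2 \<le> 64 * (x1\<^sup>2 + x2\<^sup>2 + x3\<^sup>2 + (x4\<^sup>2 + x5\<^sup>2))" for x1 x2 x3 x4 x5 :: ennreal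
proof -
  have "(x1 + x2 + x3 + (x4 + x5))\<^sup>2 \<le> 4 * ((x1 + x2 + x3)\<^sup>2 + (x4 + x5)\<^sup>2)" by (rule ennreal_add_square_le)
  also have "\<dots> \<le> 4 * (4 * (4 * (x1\<^sup>2 + x2\<^sup>2) + 4 * x3\<^sup>2) + 16 * (x4\<^sup>2 + x5\<^sup>2))"
  proof (intro mult_left_mono add_mono)
    have "(x1 + x2 + x3)\<^sup>2 \<le> 4 * ((x1 + x2)\<^sup>2 + x3\<^sup>2)" by (rule ennreal_add_square_le)
    also have "\<dots> \<le> 4 * (4 * (x1\<^sup>2 + x2\<^sup>2) + 4 * x3\<^sup>2)"
    proof (intro mult_left_mono add_mono ennreal_add_square_le)
      have "1 * x3\<^sup>2 \<le> 4 * x3\<^sup>2" by (intro mult_right_mono) auto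
      then show "x3\<^sup>2 \<le> 4 * x3\<^sup>2" by simp
    qed simp
    finally show "(x1 + x2 + x3)\<^sup>2 \<le> 4 * (4 * (x1\<^sup>2 + x2\<^sup>2) + 4 * x3\<^sup>2)" .
    have "4 * (x4\<^sup>2 + x5\<^sup>2) \<le> 16 * (x4\<^sup>2 + x5\<^sup>2)" by (intro mult_right_mono) auto
    then show "(x4 + x5)\<^sup>2 \<le> 16 * (x4\<^sup>2 + x5\<^sup>2)" by (rule order_trans[OF ennreal_add_square_le])
  qed simp
  also have "\<dots> = 64 * (x1\<^sup>2 + x2\<^sup>2 + x3\<^sup>2 + (x4\<^sup>2 + x5\<^sup>2))" by (simp add: distrib_left mult.assoc[symmetric])
  finally show ?thesis .
qed

lemma spacetime_measurable [measurable (raw)]: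
  fixes f :: "'a \<Rightarrow> spacetime"
  assumes "f \<in> borel_measurable M"
  shows "(\<lambda>x. fst (f x)) \<in> borel_measurable M" "(\<lambda>x. snd (f x)) \<in> borel_measurable M"
proof -
  have "(fst :: spacetime \<Rightarrow> real^3) \<in> borel_measurable borel"
      "(snd :: spacetime \<Rightarrow> real) \<in> borel_measurable borel"
    by (intro borel_measurable_continuous_onI continuous_intros)+
  from measurable_compose[OF assms this(1)] measurable_compose[OF assms this(2)]
  show "(\<lambda>x. fst (f x)) \<in> borel_measurable M" "(\<lambda>x. snd (f x)) \<in> borel_measurable M" .
qed

lemma nn_integral_spacetime:
  fixes F :: "spacetime \<Rightarrow> ennreal"
  assumes "F \<in> borel_measurable borel"
  shows "(\<integral>\<^sup>+\<zeta>. F \<zeta> \<partial>lborel) = (\<integral>\<^sup>+\<xi>. \<integral>\<^sup>+\<tau>. F (\<xi>, \<tau>) \<partial>lborel \<partial>lborel)"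
proof -
  have "F \<in> borel_measurable (lborel \<Otimes>\<^sub>M lborel)" using assms by (simp add: lborel_prod)
  from lborel.nn_integral_fst[OF this] show ?thesis by (simp add: lborel_prod)
qed

lemma japanese_powr_square: "(japanese x powr a)\<^sup>2 = japanese x powr (2 * a)"
  by (simp add: power2_eq_square powr_add[symmetric])

lemma japanese_powr_inverse: "japanese x powr (- 1) = 1 / japanese x"
  using japanese_pos[of x] by (simp add: powr_minus_divide)

context
  fixes b \<sigma> \<alpha> \<beta> :: real
  assumes b: "b > 1/2" and \<sigma>: "0 \<le> \<sigma>" "\<sigma> < 1/2" and \<alpha>: "\<alpha> = 1 \<or> \<alpha> = -1" and \<beta>: "\<bar>\<beta>\<bar> \<le> 1"
begin

text \<open>The kernels are named after the variable that is held fixed when their squares are integrated: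
  the output frequency \<open>\<zeta>\<close>, the left factor's \<open>\<eta>\<close> or the right factor's \<open>\<zeta> - \<eta>\<close>
  (for \<open>k_low\<close> it is \<open>\<eta>\<close> again).\<close>

definition k_output :: "spacetime \<Rightarrow> spacetime \<Rightarrow> real" where
  "k_output \<zeta> \<eta> = japanese (fst \<eta>) powr (-1/2) * modS \<alpha> \<eta> powr (- b) * modW \<beta> (\<zeta> - \<eta>) powr (- b)"

definition k_left :: "spacetime \<Rightarrow> spacetime \<Rightarrow> real" where
  "k_left \<zeta> \<eta> = japanese (fst \<zeta>) powr (-1/2) * modS 1 \<zeta> powr (- b) * modW \<beta> (\<zeta> - \<eta>) powr (- b)"

definition k_right :: "spacetime \<Rightarrow> spacetime \<Rightarrow> real" where
  "k_right \<zeta> \<eta> = japanese (fst (\<zeta> - \<eta>)) powr (-1/2) * modS 1 \<zeta> powr (- b) * modS \<alpha> \<eta> powr (- b)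
     * indicator (cball 0 (norm (fst (\<zeta> - \<eta>)) / 8)) (fst \<eta>)"

definition k_low :: "spacetime \<Rightarrow> spacetime \<Rightarrow> real" where
  "k_low \<zeta> \<eta> = japanese (fst \<eta>) powr \<sigma> * japanese (fst (\<zeta> - \<eta>)) powr (- (\<sigma> + 1/2)) * modS 1 \<zeta> powr (- b)
      * modW \<beta> (\<zeta> - \<eta>) powr (- b)
     * indicator (cball 0 (norm (fst \<eta>) / 4)) (fst (\<zeta> - \<eta>))"

lemma kernel_nonneg: "0 \<le> k_output \<zeta> \<eta>" "0 \<le> k_left \<zeta> \<eta>" "0 \<le> k_right \<zeta> \<eta>" "0 \<le> k_low \<zeta> \<eta>"
  unfolding k_output_def k_left_def k_right_def k_low_def by (auto simp: indicator_def)

text \<open>Each pair of frequencies falls into one of five regimes, and in each a single kernel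
  times the matching weights dominates. Adding all kernels avoids carrying indicator functions of
  the regimes into the integrals.\<close>

lemma kernel_pointwise:
  fixes \<zeta> \<eta> :: spacetime
  assumes s: "0 \<le> s" and \<epsilon>: "0 \<le> \<epsilon>"
  shows "japanese (fst \<zeta>) powr s * modS 1 \<zeta> powr (- b) \<le> (9 powr s * 12 powr b * 4 powr \<sigma> * 3) *
    ((k_output \<zeta> \<eta> + k_left \<zeta> \<eta> + k_right \<zeta> \<eta>)
        * (modS \<alpha> \<eta> powr b * (japanese (fst (\<zeta> - \<eta>)) powr (s - 1/2) * modW \<beta> (\<zeta> - \<eta>) powr b))
     + (k_left \<zeta> \<eta> + k_low \<zeta> \<eta>)
        * (japanese (fst \<eta>) powr (s - \<sigma>) * (japanese (fst (\<zeta> - \<eta>)) powr (\<sigma> + 1/2 + \<epsilon>)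
            * modW \<beta> (\<zeta> - \<eta>) powr b)))"
    (is "?lhs \<le> ?C * ((_ + _ + _) * ?P + (_ + _) * ?Q)")
proof -
  obtain \<xi> \<tau> \<xi>1 \<tau>1 where \<zeta>: "\<zeta> = (\<xi>, \<tau>)" and \<eta>: "\<eta> = (\<xi>1, \<tau>1)" by (metis surj_pair)
  have PQ: "0 \<le> ?P" "0 \<le> ?Q" by auto
  have one: "1 \<le> 9 powr s" "1 \<le> 12 powr b" "1 \<le> 4 powr \<sigma>" "2 powr s \<le> 9 powr s"
    using s b \<sigma> by (auto intro!: ge_one_powr_ge_zero powr_mono2)
  \<comment> \<open>All summands are nonnegative, so a bound by any one of them, with any constant
    below \<open>?C\<close>, is enough.\<close>
  have concl: "?lhs \<le> ?C * ((k_output \<zeta> \<eta> + k_left \<zeta> \<eta> + k_right \<zeta> \<eta>) * ?P + (k_left \<zeta> \<eta> + k_low \<zeta> \<eta>) * ?Q)"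
    if lhs: "?lhs \<le> c * t" and c: "c \<le> ?C" and t: "0 \<le> t" "t \<in> {k_output \<zeta> \<eta> * ?P, k_left \<zeta> \<eta>
        * ?P, k_right \<zeta> \<eta> * ?P, k_left \<zeta> \<eta> * ?Q, k_low \<zeta> \<eta> * ?Q}" for c t
  proof -
    have "?lhs \<le> ?C * t" using lhs mult_right_mono[OF c t(1)] by linarith
    also have "\<dots> \<le> ?C * ((k_output \<zeta> \<eta> + k_left \<zeta> \<eta> + k_right \<zeta> \<eta>) * ?P + (k_left \<zeta> \<eta> + k_low \<zeta> \<eta>) * ?Q)"
    proof (rule mult_left_mono)
      have "0 \<le> k_output \<zeta> \<eta> * ?P" "0 \<le> k_left \<zeta> \<eta> * ?P" "0 \<le> k_right \<zeta> \<eta> * ?P" "0 \<le> k_left \<zeta> \<eta> * ?Q" "0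
          \<le> k_low \<zeta> \<eta> * ?Q"
        using kernel_nonneg PQ by (auto simp del: fst_diff snd_diff)
      then show "t \<le> (k_output \<zeta> \<eta> + k_left \<zeta> \<eta> + k_right \<zeta> \<eta>) * ?P + (k_left \<zeta> \<eta> + k_low \<zeta> \<eta>) * ?Q"
        unfolding distrib_right using t(2) by (auto simp del: fst_diff snd_diff)
    qed simp
    finally show ?thesis .
  qed
  have C: "2 powr s * 12 powr b \<le> ?C" "2 powr s * 12 powr b * 2 \<le> ?C" "9 powr s \<le> ?C" "9 powr s * 4 powr \<sigma>
      * 3 \<le> ?C"
  proof -
    have c1: "2 powr s * 12 powr b * 1 \<le> 9 powr s * 12 powr b * (4 powr \<sigma> * 3)"
      using one by (intro mult_mono) auto
    have c2: "2 powr s * 12 powr b * 2 \<le> 9 powr s * 12 powr b * (4 powr \<sigma> * 3)"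
      using one by (intro mult_mono) auto
    have c3: "9 powr s * (1 * (1 * 1)) \<le> 9 powr s * (12 powr b * (4 powr \<sigma> * 3))"
      using one by (intro mult_mono) auto
    have c4: "9 powr s * (1 * (4 powr \<sigma> * 3)) \<le> 9 powr s * (12 powr b * (4 powr \<sigma> * 3))"
      using one by (intro mult_mono) auto
    show "2 powr s * 12 powr b \<le> ?C" "2 powr s * 12 powr b * 2 \<le> ?C" "9 powr s \<le> ?C" "9 powr s * 4 powr \<sigma>
        * 3 \<le> ?C"
      using c1 c2 c3 c4 by (simp_all only: mult.assoc mult_1_left mult_1_right)
  qed
  have ge1: "1 \<le> japanese x" for x :: "real^3" by (rule japanese_ge_1)
  have ge1r: "1 \<le> japanese x" for x :: real by (rule japanese_ge_1)
  have tri: "norm \<xi> \<le> norm \<xi>1 + norm (\<xi> - \<xi>1)" using norm_triangle_ineq[of \<xi>1 "\<xi> - \<xi>1"] by simp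
  note unf = \<zeta> \<eta> fst_diff snd_diff fst_conv snd_conv mult_1_left
  show ?thesis
  proof (cases "8 * norm \<xi>1 \<le> norm (\<xi> - \<xi>1)")
    case True
    have j: "japanese \<xi> \<le> 2 * japanese (\<xi> - \<xi>1)" using True tri norm_ge_zero[of "\<xi> - \<xi>1"]
        by (intro japanese_mono) linarith+
    have j1: "japanese \<xi>1 \<le> japanese (\<xi> - \<xi>1)" using True japanese_mono[of \<xi>1 1
        "\<xi> - \<xi>1"] norm_ge_zero[of \<xi>1] by linarith
    consider "(japanese (\<xi> - \<xi>1))\<^sup>2 \<le> 12 * japanese (\<tau> + (norm \<xi>)\<^sup>2)"
      | "(japanese (\<xi> - \<xi>1))\<^sup>2 \<le> 12 * japanese (\<tau>1 + \<alpha> * (norm \<xi>1)\<^sup>2)"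
      | "(japanese (\<xi> - \<xi>1))\<^sup>2 \<le> 12 * japanese ((\<tau> - \<tau>1) + \<beta> * japanese (\<xi> - \<xi>1))"
      using resonance[OF \<alpha> \<beta> True] by blast
    then show ?thesis
    proof cases
      case 1
      show ?thesis
      proof (rule concl[OF _ C(1)])
        show "?lhs \<le> 2 powr s * 12 powr b * (k_output \<zeta> \<eta> * ?P)"
          unfolding k_output_def unf using b s j j1 1 by (intro kernel_case_output ge1 ge1r) auto
      qed (use kernel_nonneg(1) PQ(1) in \<open>auto simp del: fst_diff snd_diff\<close>)
    next
      case 2
      show ?thesis
      proof (rule concl[OF _ C(2)])
        show "?lhs \<le> 2 powr s * 12 powr b * 2 * (k_left \<zeta> \<eta> * ?P)"
          unfolding k_left_def unf using b s j 2 by (intro kernel_case_left ge1 ge1r) auto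
      qed (use kernel_nonneg(2) PQ(1) in \<open>auto simp del: fst_diff snd_diff\<close>)
    next
      case 3
      have ind: "indicator (cball 0 (norm (\<xi> - \<xi>1) / 8)) \<xi>1 = (1::real)" using True
          by (simp add: indicator_def)
      show ?thesis
      proof (rule concl[OF _ C(1)])
        show "?lhs \<le> 2 powr s * 12 powr b * (k_right \<zeta> \<eta> * ?P)"
          unfolding k_right_def unf ind mult_1_right using b s j 3 by (intro kernel_case_right ge1 ge1r) auto
      qed (use kernel_nonneg(3) PQ(1) in \<open>auto simp del: fst_diff snd_diff\<close>)
    qed
  next
    case False
    \<comment> \<open>The second frequency is less than 8 times the first, so the output is at most
      9 times the first.\<close>
    have j: "japanese \<xi> \<le> 9 * japanese \<xi>1" using False tri by (intro japanese_mono) linarith+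
    \<comment> \<open>The threshold 4 separates a small second frequency, where the half power on
      the output cannot be charged to it, from the regime where it controls both other
      frequencies.\<close>
    show ?thesis
    proof (cases "4 * norm (\<xi> - \<xi>1) \<le> norm \<xi>1")
      case True
      have ind: "indicator (cball 0 (norm \<xi>1 / 4)) (\<xi> - \<xi>1) = (1::real)" using True
          by (simp add: indicator_def)
      show ?thesis
      proof (rule concl[OF _ C(3)])
        show "?lhs \<le> 9 powr s * (k_low \<zeta> \<eta> * ?Q)"
          unfolding k_low_def unf ind mult_1_right using s \<epsilon> j by (intro kernel_case_low_high ge1 ge1r) auto
      qed (use kernel_nonneg(4) PQ(2) in \<open>auto simp del: fst_diff snd_diff\<close>)
    next
      case 4: False
      \<comment> \<open>The first frequency is less than 4 times the second, and the triangle
        inequality gives 5 for the output.\<close>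
      have j1: "japanese \<xi>1 \<le> 4 * japanese (\<xi> - \<xi>1)" using 4 by (intro japanese_mono) linarith+
      have j5: "japanese \<xi> \<le> 5 * japanese (\<xi> - \<xi>1)" using 4 tri by (intro japanese_mono) linarith+
      show ?thesis
      proof (rule concl[OF _ C(4)])
        show "?lhs \<le> 9 powr s * 4 powr \<sigma> * 3 * (k_left \<zeta> \<eta> * ?Q)"
          unfolding k_left_def unf using s \<epsilon> \<sigma> j j1 j5 by (intro kernel_case_comparable ge1 ge1r) auto
      qed (use kernel_nonneg(2) PQ(2) in \<open>auto simp del: fst_diff snd_diff\<close>)
    qed
  qed
qed


lemma kernel_measurable [measurable]:
  "(\<lambda>(\<zeta>, \<eta>). k_output \<zeta> \<eta>) \<in> borel_measurable (borel \<Otimes>\<^sub>M borel)"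
  "(\<lambda>(\<zeta>, \<eta>). k_left \<zeta> \<eta>) \<in> borel_measurable (borel \<Otimes>\<^sub>M borel)"
  "(\<lambda>(\<zeta>, \<eta>). k_right \<zeta> \<eta>) \<in> borel_measurable (borel \<Otimes>\<^sub>M borel)"
  "(\<lambda>(\<zeta>, \<eta>). k_low \<zeta> \<eta>) \<in> borel_measurable (borel \<Otimes>\<^sub>M borel)"
proof -
  show "(\<lambda>(\<zeta>, \<eta>). k_output \<zeta> \<eta>) \<in> borel_measurable (borel \<Otimes>\<^sub>M borel)"
    unfolding k_output_def by measurable
  show "(\<lambda>(\<zeta>, \<eta>). k_left \<zeta> \<eta>) \<in> borel_measurable (borel \<Otimes>\<^sub>M borel)"
    unfolding k_left_def by measurable
  show "(\<lambda>(\<zeta>, \<eta>). k_right \<zeta> \<eta>) \<in> borel_measurable (borel \<Otimes>\<^sub>M borel)"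
    unfolding k_right_def indicator_def mem_cball dist_0_norm by measurable
  show "(\<lambda>(\<zeta>, \<eta>). k_low \<zeta> \<eta>) \<in> borel_measurable (borel \<Otimes>\<^sub>M borel)"
    unfolding k_low_def indicator_def mem_cball dist_0_norm by measurable
qed

definition conv_const :: ennreal where
  "conv_const = ennreal (2 powr (2 * b)) * (jpI (2 * b) + jpI (2 * b))"

lemma time_integral:
  "(\<integral>\<^sup>+\<tau>. W * (jp (2 * b) (\<tau> + a) * jp (2 * b) (\<tau> + c)) \<partial>lborel) \<le> conv_const * (W * jp (2 * b) (a - c))"
proof -
  have "(\<integral>\<^sup>+\<tau>. W * (jp (2 * b) (\<tau> + a) * jp (2 * b) (\<tau> + c)) \<partial>lborel)
     = W * (\<integral>\<^sup>+\<tau>. jp (2 * b) (\<tau> + a) * jp (2 * b) (\<tau> + c) \<partial>lborel)" by (rule nn_integral_cmult) measurable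
  also have "\<dots> \<le> W * (conv_const * jp (2 * b) (a - c))"
    unfolding conv_const_def using b by (intro mult_left_mono jp_convolution) auto
  finally show ?thesis by (simp only: mult_ac)
qed

text \<open>The spatial bounds of \<open>jp_polar\<close>, \<open>jp_resonant_slab\<close> and
  \<open>jp_layers\<close> are added, so that one constant serves all four kernels.\<close>

definition kernel_const :: ennreal where
  "kernel_const = conv_const * (2 * ((64 + 8 * jpI (2 * b)) * emeasure lborel (cball (0::real^3) 1))
    + (emeasure lborel (cball (0::real^3) 1) + ennreal (unit_ball_vol 3) * jpI (2 * b))
    + (5 * emeasure lborel (cball (0::real^3) 1)
     + ennreal (64 * unit_ball_vol 3 * 2 powr (1 + 2 * \<sigma>) / (1 - 2 powr (1 + 2 * \<sigma>) / 4)) * jpI (2 * b)))"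

lemma kernel_const_finite: "kernel_const < \<top>"
proof -
  have "jpI (2 * b) < \<top>" using b by (intro jpI_finite) simp
  moreover have "emeasure lborel (cball (0::real^3) 1) < \<top>" by (simp add: emeasure_cball)
  ultimately show ?thesis unfolding kernel_const_def conv_const_def
    by (auto simp: ennreal_mult_less_top)
qed

text \<open>A squared kernel is a spatial weight times two modulation weights in \<tau>. Integrating
  in \<tau> first leaves the difference \<open>x \<xi> - y \<xi>\<close> of the phases, and only the
  spatial integral remains to be checked for each kernel.\<close>

lemma kernel_slice:
  fixes k :: "spacetime \<Rightarrow> real"
  assumes "\<And>\<xi> \<tau>. (ennreal (k (\<xi>, \<tau>)))\<^sup>2 = W \<xi> * (jp (2 * b) (\<tau> + x \<xi>) * jp (2 * b) (\<tau> + y \<xi>))"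
    and [measurable]: "k \<in> borel_measurable borel" "W \<in> borel_measurable borel"
        "x \<in> borel_measurable borel" "y \<in> borel_measurable borel"
    and C: "(\<integral>\<^sup>+\<xi>. W \<xi> * jp (2 * b) (x \<xi> - y \<xi>) \<partial>lborel) \<le> C" and "conv_const * C \<le> D"
  shows "(\<integral>\<^sup>+\<zeta>. (ennreal (k \<zeta>))\<^sup>2 \<partial>lborel) \<le> D"
proof -
  have "(\<integral>\<^sup>+\<zeta>. (ennreal (k \<zeta>))\<^sup>2 \<partial>lborel) = (\<integral>\<^sup>+\<xi>. \<integral>\<^sup>+\<tau>. W \<xi> * (jp (2 * b) (\<tau> + x \<xi>) * jp (2 * b) (\<tau>
      + y \<xi>)) \<partial>lborel \<partial>lborel)"
    unfolding assms(1)[symmetric] by (rule nn_integral_spacetime) measurable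
  also have "\<dots> \<le> (\<integral>\<^sup>+\<xi>. conv_const * (W \<xi> * jp (2 * b) (x \<xi> - y \<xi>)) \<partial>lborel)"
    by (intro nn_integral_mono time_integral)
  also have "\<dots> \<le> conv_const * C" by (subst nn_integral_cmult) (measurable, intro mult_left_mono C, simp)
  finally show ?thesis using assms(7) by (rule order_trans)
qed

text \<open>The remaining phase is \<open>\<alpha> * (norm \<xi>1)\<^sup>2\<close> plus \<beta>
  times the bracket of \<open>\<xi> - \<xi>1\<close>, up to a constant: the situation of
  \<open>jp_polar\<close> in the first frequency.\<close>

lemma k_output_bound: "(\<integral>\<^sup>+\<eta>. (ennreal (k_output \<zeta> \<eta>))\<^sup>2 \<partial>lborel) \<le> kernel_const"
proof -
  obtain \<xi> \<tau> where \<zeta>: "\<zeta> = (\<xi>, \<tau>)" by (metis surj_pair)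
  show ?thesis
  proof (rule kernel_slice)
    fix \<xi>1 \<tau>1
    \<comment> \<open>Evenness of the bracket turns the coefficient of \<tau>1 from -1 to 1, the
      form required by \<open>kernel_slice\<close>.\<close>
    have e: "japanese ((\<tau> - \<tau>1) + \<beta> * japanese (\<xi> - \<xi>1)) = japanese (\<tau>1 + (- \<tau> - \<beta> * japanese (\<xi> - \<xi>1)))"
      using japanese_minus[of "\<tau>1 + (- \<tau> - \<beta> * japanese (\<xi> - \<xi>1))"] by (simp add: algebra_simps)
    show "(ennreal (k_output \<zeta> (\<xi>1, \<tau>1)))\<^sup>2 = ennreal (1 / japanese \<xi>1)
      * (jp (2 * b) (\<tau>1 + \<alpha> * (norm \<xi>1)\<^sup>2) * jp (2 * b) (\<tau>1 + (- \<tau> - \<beta> * japanese (\<xi> - \<xi>1))))"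
      using japanese_powr_inverse[of \<xi>1]
      by (simp add: k_output_def \<zeta> ennreal_power power_mult_distrib japanese_powr_square e ennreal_mult
          less_imp_le[OF japanese_pos] mult_ac)
  next
    show "(\<integral>\<^sup>+\<xi>1. ennreal (1 / japanese \<xi>1) * jp (2 * b) (\<alpha> * (norm \<xi>1)\<^sup>2 - (- \<tau> - \<beta>
        * japanese (\<xi> - \<xi>1))) \<partial>lborel)
       \<le> 2 * ((64 + 8 * jpI (2 * b)) * emeasure lborel (cball (0::real^3) 1))"
      using jp_polar[of "2 * b" \<alpha> \<beta> \<tau> \<xi>] b \<alpha> \<beta> by (simp add: algebra_simps)
    show "conv_const * (2 * ((64 + 8 * jpI (2 * b)) * emeasure lborel (cball (0::real^3) 1))) \<le> kernel_const"
      unfolding kernel_const_def by (intro mult_left_mono) (auto simp: add.assoc)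
  qed measurable
qed

text \<open>Again \<open>jp_polar\<close>, now in the output frequency, with quadratic sign 1 and
  \<beta> negated because the two phases are subtracted.\<close>

lemma k_left_bound: "(\<integral>\<^sup>+\<zeta>. (ennreal (k_left \<zeta> \<eta>))\<^sup>2 \<partial>lborel) \<le> kernel_const"
proof -
  obtain \<xi>1 \<tau>1 where \<eta>: "\<eta> = (\<xi>1, \<tau>1)" by (metis surj_pair)
  show ?thesis
  proof (rule kernel_slice)
    fix \<xi> \<tau>
    show "(ennreal (k_left (\<xi>, \<tau>) \<eta>))\<^sup>2 = ennreal (1 / japanese \<xi>)
      * (jp (2 * b) (\<tau> + (norm \<xi>)\<^sup>2) * jp (2 * b) (\<tau> + (- \<tau>1 + \<beta> * japanese (\<xi> - \<xi>1))))"
      using japanese_powr_inverse[of \<xi>]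
      by (simp add: diff_add_eq add_diff_eq k_left_def \<eta> ennreal_power power_mult_distrib
          japanese_powr_square ennreal_mult less_imp_le[OF japanese_pos] mult_ac)
  next
    show "(\<integral>\<^sup>+\<xi>. ennreal (1 / japanese \<xi>) * jp (2 * b) ((norm \<xi>)\<^sup>2 - (- \<tau>1 + \<beta> * japanese (\<xi> - \<xi>1))) \<partial>lborel)
       \<le> 2 * ((64 + 8 * jpI (2 * b)) * emeasure lborel (cball (0::real^3) 1))"
      using jp_polar[of "2 * b" 1 "- \<beta>" \<tau>1 \<xi>1] b \<beta> by (simp add: algebra_simps japanese_minus_commute[of \<xi>1])
    show "conv_const * (2 * ((64 + 8 * jpI (2 * b)) * emeasure lborel (cball (0::real^3) 1))) \<le> kernel_const"
      unfolding kernel_const_def by (intro mult_left_mono) (auto simp: add.assoc)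
  qed measurable
qed

text \<open>With the first frequency as variable, obtained by translating by \<xi>2, the phase is a
  difference or sum of two squares and \<open>jp_resonant_slab\<close> applies with \<open>y\<close>
  the fixed second frequency.\<close>

lemma k_right_bound: "(\<integral>\<^sup>+\<zeta>. (ennreal (k_right \<zeta> (\<zeta> - y)))\<^sup>2 \<partial>lborel) \<le> kernel_const"
proof -
  obtain \<xi>2 \<tau>2 where y: "y = (\<xi>2, \<tau>2)" by (metis surj_pair)
  let ?W = "\<lambda>\<xi>. ennreal (1 / japanese \<xi>2) * indicator (cball 0 (norm \<xi>2 / 8)) \<xi>"
  show ?thesis
  proof (rule kernel_slice)
    fix \<xi> \<tau>
    show "(ennreal (k_right (\<xi>, \<tau>) ((\<xi>, \<tau>) - y)))\<^sup>2 = ?W (\<xi> - \<xi>2)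
      * (jp (2 * b) (\<tau> + (norm \<xi>)\<^sup>2) * jp (2 * b) (\<tau> + (- \<tau>2 + \<alpha> * (norm (\<xi> - \<xi>2))\<^sup>2)))"
      using japanese_powr_inverse[of \<xi>2]
      by (simp add: diff_add_eq add_diff_eq k_right_def y ennreal_power power_mult_distrib
          japanese_powr_square ennreal_mult less_imp_le[OF japanese_pos] mult_ac indicator_def)
  next
    let ?f = "\<lambda>x. ?W x * jp (2 * b) (\<tau>2 + (norm (x + \<xi>2))\<^sup>2 - \<alpha> * (norm x)\<^sup>2)"
    have "(\<integral>\<^sup>+\<xi>. ?W (\<xi> - \<xi>2) * jp (2 * b) ((norm \<xi>)\<^sup>2 - (- \<tau>2 + \<alpha> * (norm (\<xi> - \<xi>2))\<^sup>2)) \<partial>lborel)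
        = (\<integral>\<^sup>+x. ?f x \<partial>lborel)"
      using nn_integral_convolution_translate(2)[of ?f \<xi>2] by (simp add: algebra_simps)
    then show "(\<integral>\<^sup>+\<xi>. ?W (\<xi> - \<xi>2) * jp (2 * b) ((norm \<xi>)\<^sup>2 - (- \<tau>2 + \<alpha> * (norm (\<xi> - \<xi>2))\<^sup>2)) \<partial>lborel)
       \<le> emeasure lborel (cball (0::real^3) 1) + ennreal (unit_ball_vol 3) * jpI (2 * b)"
      using jp_resonant_slab[of "2 * b" \<alpha> \<xi>2 \<tau>2] b \<alpha> by simp
    show "conv_const * (emeasure lborel (cball (0::real^3) 1) + ennreal (unit_ball_vol 3) * jpI (2 * b))
        \<le> kernel_const"
      unfolding kernel_const_def
      by (intro mult_left_mono order_trans[OF add_increasing[OF zero_le order_refl] add_increasing2[OF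
          zero_le order_refl]]) auto
  qed measurable
qed

text \<open>With the small second frequency as variable, obtained by translating by \<xi>1, this is
  the dyadic estimate \<open>jp_layers\<close>.\<close>

lemma k_low_bound: "(\<integral>\<^sup>+\<zeta>. (ennreal (k_low \<zeta> \<eta>))\<^sup>2 \<partial>lborel) \<le> kernel_const"
proof -
  obtain \<xi>1 \<tau>1 where \<eta>: "\<eta> = (\<xi>1, \<tau>1)" by (metis surj_pair)
  let ?w = "\<lambda>y. ennreal (japanese \<xi>1 powr (2 * \<sigma>) * japanese y powr (- (1 + 2 * \<sigma>)))
      * indicator (cball 0 (norm \<xi>1 / 4)) y"
  let ?C = "5 * emeasure lborel (cball (0::real^3) 1)
     + ennreal (64 * unit_ball_vol 3 * 2 powr (1 + 2 * \<sigma>) / (1 - 2 powr (1 + 2 * \<sigma>) / 4)) * jpI (2 * b)"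
  show ?thesis
  proof (rule kernel_slice)
    fix \<xi> \<tau>
    have "2 * (- (\<sigma> + 1/2)) = - (1 + 2 * \<sigma>)" by simp
    then show "(ennreal (k_low (\<xi>, \<tau>) \<eta>))\<^sup>2 = ?w (\<xi> - \<xi>1)
      * (jp (2 * b) (\<tau> + (norm \<xi>)\<^sup>2) * jp (2 * b) (\<tau> + (- \<tau>1 + \<beta> * japanese (\<xi> - \<xi>1))))"
      by (simp add: diff_add_eq add_diff_eq add.commute[of "\<sigma>
          * 2"] k_low_def \<eta> ennreal_power power_mult_distrib japanese_powr_square ennreal_mult mult_ac
          indicator_def del: minus_add_distrib)
  next
    let ?f = "\<lambda>y. ?w y * jp (2 * b) (\<tau>1 + (norm (\<xi>1 + y))\<^sup>2 + (- \<beta>) * japanese y)"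
    have "(\<integral>\<^sup>+\<xi>. ?w (\<xi> - \<xi>1) * jp (2 * b) ((norm \<xi>)\<^sup>2 - (- \<tau>1 + \<beta> * japanese (\<xi> - \<xi>1))) \<partial>lborel)
        = (\<integral>\<^sup>+y. ?f y \<partial>lborel)"
      using nn_integral_convolution_translate(2)[of ?f \<xi>1] by (simp add: algebra_simps)
    also have "\<dots> \<le> ?C" using b \<beta> \<sigma> by (intro jp_layers) auto
    finally show "(\<integral>\<^sup>+\<xi>. ?w (\<xi> - \<xi>1) * jp (2 * b) ((norm \<xi>)\<^sup>2 - (- \<tau>1 + \<beta> * japanese (\<xi> - \<xi>1))) \<partial>lborel)
        \<le> ?C" .
    show "conv_const * ?C \<le> kernel_const" unfolding kernel_const_def
      by (intro mult_left_mono add_increasing[OF _ order_refl]) auto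
  qed measurable
qed

text \<open>The pointwise bound splits the weighted convolution into five kernel operators, each
  bounded by the Cauchy-Schwarz lemma for the variable its kernel keeps fixed. Working with squares
  in \<open>ennreal\<close> defers every finiteness question to the application.\<close>

lemma bilinear_kernel_estimate:
  fixes f g :: "spacetime \<Rightarrow> ennreal"
  assumes s: "0 \<le> s" and \<epsilon>: "0 \<le> \<epsilon>" and [measurable]: "f \<in> borel_measurable borel"
      "g \<in> borel_measurable borel"
  shows "(\<integral>\<^sup>+\<zeta>. (ennreal (japanese (fst \<zeta>) powr s * modS 1 \<zeta> powr (- b)) * (\<integral>\<^sup>+\<eta>. f \<eta>
      * g (\<zeta> - \<eta>) \<partial>lborel))\<^sup>2 \<partial>lborel)
    \<le> (ennreal (9 powr s * 12 powr b * 4 powr \<sigma> * 3))\<^sup>2 * (192 * kernel_const) *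
      ((\<integral>\<^sup>+\<eta>. (ennreal (modS \<alpha> \<eta> powr b) * f \<eta>)\<^sup>2 \<partial>lborel)
         * (\<integral>\<^sup>+\<eta>. (ennreal (japanese (fst \<eta>) powr (s - 1/2) * modW \<beta> \<eta> powr b) * g \<eta>)\<^sup>2 \<partial>lborel)
     + (\<integral>\<^sup>+\<eta>. (ennreal (japanese (fst \<eta>) powr (s - \<sigma>)) * f \<eta>)\<^sup>2 \<partial>lborel)
         * (\<integral>\<^sup>+\<eta>. (ennreal (japanese (fst \<eta>) powr (\<sigma> + 1/2 + \<epsilon>) * modW \<beta> \<eta> powr b) * g \<eta>)\<^sup>2 \<partial>lborel))"
proof -
  \<comment> \<open>The norm weights are absorbed into the functions, so that only unweighted square
    integrals remain next to the kernels.\<close>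
  define F1 where "F1 \<eta> = ennreal (modS \<alpha> \<eta> powr b) * f \<eta>" for \<eta>
  define G1 where "G1 \<eta> = ennreal (japanese (fst \<eta>) powr (s - 1/2) * modW \<beta> \<eta> powr b) * g \<eta>" for \<eta>
  define F2 where "F2 \<eta> = ennreal (japanese (fst \<eta>) powr (s - \<sigma>)) * f \<eta>" for \<eta>
  define G2 where "G2 \<eta> = ennreal (japanese (fst \<eta>) powr (\<sigma> + 1/2 + \<epsilon>) * modW \<beta> \<eta> powr b) * g \<eta>" for \<eta>
  define C where "C = ennreal (9 powr s * 12 powr b * 4 powr \<sigma> * 3)"
  have [measurable]: "F1 \<in> borel_measurable borel" "G1 \<in> borel_measurable borel"
      "F2 \<in> borel_measurable borel" "G2 \<in> borel_measurable borel"
    unfolding F1_def G1_def F2_def G2_def by measurable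
  define T where "T K F G \<zeta> = (\<integral>\<^sup>+\<eta>. ennreal (K \<zeta> \<eta>) * (F \<eta> * G (\<zeta> - \<eta>)) \<partial>lborel)"
    for K :: "spacetime \<Rightarrow> spacetime \<Rightarrow> real" and F G :: "spacetime \<Rightarrow> ennreal" and \<zeta>
  define A where "A = (\<integral>\<^sup>+\<eta>. (F1 \<eta>)\<^sup>2 \<partial>lborel) * (\<integral>\<^sup>+\<eta>. (G1 \<eta>)\<^sup>2 \<partial>lborel)"
  define B where "B = (\<integral>\<^sup>+\<eta>. (F2 \<eta>)\<^sup>2 \<partial>lborel) * (\<integral>\<^sup>+\<eta>. (G2 \<eta>)\<^sup>2 \<partial>lborel)"
  have meas: "(\<lambda>(\<zeta>, \<eta>). ennreal (k_output \<zeta> \<eta>)) \<in> borel_measurable (borel \<Otimes>\<^sub>M borel)"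
    "(\<lambda>(\<zeta>, \<eta>). ennreal (k_left \<zeta> \<eta>)) \<in> borel_measurable (borel \<Otimes>\<^sub>M borel)"
    "(\<lambda>(\<zeta>, \<eta>). ennreal (k_right \<zeta> \<eta>)) \<in> borel_measurable (borel \<Otimes>\<^sub>M borel)"
    "(\<lambda>(\<zeta>, \<eta>). ennreal (k_low \<zeta> \<eta>)) \<in> borel_measurable (borel \<Otimes>\<^sub>M borel)"
    by measurable
  have Tm [measurable]: "T k_output F1 G1 \<in> borel_measurable borel" "T k_left F1 G1 \<in> borel_measurable borel"
    "T k_right F1 G1 \<in> borel_measurable borel" "T k_left F2 G2 \<in> borel_measurable borel"
        "T k_low F2 G2 \<in> borel_measurable borel"
    unfolding T_def by measurable
  let ?w = "\<lambda>\<zeta>. ennreal (japanese (fst \<zeta>) powr s * modS 1 \<zeta> powr (- b))"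
  let ?S = "\<lambda>\<zeta>. T k_output F1 G1 \<zeta> + T k_left F1 G1 \<zeta> + T k_right F1 G1 \<zeta> + (T k_left F2 G2 \<zeta>
      + T k_low F2 G2 \<zeta>)"
  let ?S2 = "\<lambda>\<zeta>. (T k_output F1 G1 \<zeta>)\<^sup>2 + (T k_left F1 G1 \<zeta>)\<^sup>2 + (T k_right F1 G1 \<zeta>)\<^sup>2
      + ((T k_left F2 G2 \<zeta>)\<^sup>2 + (T k_low F2 G2 \<zeta>)\<^sup>2)"
  have pw: "?w \<zeta> * (\<integral>\<^sup>+\<eta>. f \<eta> * g (\<zeta> - \<eta>) \<partial>lborel) \<le> C * ?S \<zeta>" for \<zeta>
  proof -
    let ?FG1 = "\<lambda>\<eta>. F1 \<eta> * G1 (\<zeta> - \<eta>)" and ?FG2 = "\<lambda>\<eta>. F2 \<eta> * G2 (\<zeta> - \<eta>)"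
    let ?R = "\<lambda>\<eta>. C * (ennreal (k_output \<zeta> \<eta>) * ?FG1 \<eta> + ennreal (k_left \<zeta> \<eta>) * ?FG1 \<eta>
        + ennreal (k_right \<zeta> \<eta>) * ?FG1 \<eta>
        + (ennreal (k_left \<zeta> \<eta>) * ?FG2 \<eta> + ennreal (k_low \<zeta> \<eta>) * ?FG2 \<eta>))"
    have "?w \<zeta> * (\<integral>\<^sup>+\<eta>. f \<eta> * g (\<zeta> - \<eta>) \<partial>lborel) = (\<integral>\<^sup>+\<eta>. ?w \<zeta> * (f \<eta> * g (\<zeta> - \<eta>)) \<partial>lborel)"
      by (rule nn_integral_cmult[symmetric]) measurable
    also have "\<dots> \<le> (\<integral>\<^sup>+\<eta>. ?R \<eta> \<partial>lborel)"
    proof (rule nn_integral_mono)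
      fix \<eta>
      define p1 q1 p2 q2 where pq: "p1 = modS \<alpha> \<eta> powr b"
        "q1 = japanese (fst (\<zeta> - \<eta>)) powr (s - 1/2) * modW \<beta> (\<zeta> - \<eta>) powr b"
        "p2 = japanese (fst \<eta>) powr (s - \<sigma>)"
        "q2 = japanese (fst (\<zeta> - \<eta>)) powr (\<sigma> + 1/2 + \<epsilon>) * modW \<beta> (\<zeta> - \<eta>) powr b"
      have pq0: "0 \<le> p1" "0 \<le> q1" "0 \<le> p2" "0 \<le> q2" unfolding pq by auto
      have "?w \<zeta> \<le> ennreal ((9 powr s * 12 powr b * 4 powr \<sigma> * 3) *
         ((k_output \<zeta> \<eta> + k_left \<zeta> \<eta> + k_right \<zeta> \<eta>) * (p1 * q1) + (k_left \<zeta> \<eta> + k_low \<zeta> \<eta>) * (p2 * q2)))"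
        unfolding pq by (intro ennreal_leI kernel_pointwise s \<epsilon>)
      also have "\<dots> = C * ((ennreal (k_output \<zeta> \<eta>) + ennreal (k_left \<zeta> \<eta>) + ennreal (k_right \<zeta> \<eta>))
          * (ennreal p1 * ennreal q1)
          + (ennreal (k_left \<zeta> \<eta>) + ennreal (k_low \<zeta> \<eta>)) * (ennreal p2 * ennreal q2))"
        unfolding C_def using kernel_nonneg pq0 by (simp add: ennreal_mult ennreal_plus)
      finally have "?w \<zeta> * (f \<eta> * g (\<zeta> - \<eta>)) \<le> \<dots> * (f \<eta> * g (\<zeta> - \<eta>))"
        by (rule mult_right_mono) simp
      also have "\<dots> = ?R \<eta>"
        unfolding F1_def G1_def F2_def G2_def pq[symmetric]
            by (simp only: distrib_left distrib_right mult_ac add_ac)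
      finally show "?w \<zeta> * (f \<eta> * g (\<zeta> - \<eta>)) \<le> ?R \<eta>" .
    qed
    also have "\<dots> = C * ?S \<zeta>"
      unfolding T_def by (simp add: nn_integral_cmult nn_integral_add)
    finally show ?thesis .
  qed
  have "(\<integral>\<^sup>+\<zeta>. (?w \<zeta> * (\<integral>\<^sup>+\<eta>. f \<eta> * g (\<zeta> - \<eta>) \<partial>lborel))\<^sup>2 \<partial>lborel) \<le> (\<integral>\<^sup>+\<zeta>. C\<^sup>2 * (64 * ?S2 \<zeta>) \<partial>lborel)"
  proof (rule nn_integral_mono)
    fix \<zeta>
    have "(?w \<zeta> * (\<integral>\<^sup>+\<eta>. f \<eta> * g (\<zeta> - \<eta>) \<partial>lborel))\<^sup>2 \<le> (C * ?S \<zeta>)\<^sup>2"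
      by (intro power_mono pw) simp
    also have "\<dots> \<le> C\<^sup>2 * (64 * ?S2 \<zeta>)"
      unfolding power_mult_distrib by (intro mult_left_mono ennreal_add5_square_le) simp
    finally show "(?w \<zeta> * (\<integral>\<^sup>+\<eta>. f \<eta> * g (\<zeta> - \<eta>) \<partial>lborel))\<^sup>2 \<le> C\<^sup>2 * (64 * ?S2 \<zeta>)" .
  qed
  also have "\<dots> = C\<^sup>2 * (64 * ((\<integral>\<^sup>+\<zeta>. (T k_output F1 G1 \<zeta>)\<^sup>2 \<partial>lborel) + (\<integral>\<^sup>+\<zeta>. (T k_left F1 G1 \<zeta>)\<^sup>2 \<partial>lborel)
      + (\<integral>\<^sup>+\<zeta>. (T k_right F1 G1 \<zeta>)\<^sup>2 \<partial>lborel) + ((\<integral>\<^sup>+\<zeta>. (T k_left F2 G2 \<zeta>)\<^sup>2 \<partial>lborel)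
          + (\<integral>\<^sup>+\<zeta>. (T k_low F2 G2 \<zeta>)\<^sup>2 \<partial>lborel))))"
    by (simp add: nn_integral_cmult nn_integral_add)
  also have "\<dots> \<le> C\<^sup>2 * (64 * (kernel_const * A + kernel_const * A + kernel_const * A + (kernel_const * B
      + kernel_const * B)))"
    unfolding T_def A_def B_def
    by (intro mult_left_mono add_mono schur_output schur_left schur_right meas k_output_bound k_left_bound
        k_right_bound k_low_bound) measurable
  \<comment> \<open>A third copy of the \<open>B\<close> term matches the three \<open>A\<close>
    terms, so that 3 factors out; with the 64 from squaring five summands this makes 192.\<close>
  also have "\<dots> \<le> C\<^sup>2 * (64 * (kernel_const * A + kernel_const * A + kernel_const * A + (kernel_const * B
      + kernel_const * B + kernel_const * B)))"
    by (intro mult_left_mono add_left_mono) (auto simp: add.assoc intro: add_increasing2)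
  also have "\<dots> = C\<^sup>2 * (192 * kernel_const) * (A + B)"
  proof -
    have t3: "x + x + x = 3 * x" for x :: ennreal
    proof -
      have "(1 + 1 + 1) * x = x + x + x" by (simp only: distrib_right mult_1_left)
      moreover have "(1 + 1 + 1 :: ennreal) = 3" by simp
      ultimately show ?thesis by simp
    qed
    have t64: "64 * (k * (3 * x)) = 192 * (k * x)" for k x :: ennreal
    proof -
      have "64 * (k * (3 * x)) = (64 * 3) * (k * x)" by (simp only: mult_ac)
      then show ?thesis by simp
    qed
    show ?thesis by (simp only: t3 distrib_left[symmetric] t64 mult.assoc)
  qed
  finally show ?thesis unfolding C_def A_def B_def F1_def G1_def F2_def G2_def .
qed

end

section \<open>The product estimate\<close>

definition wt :: "(real^3 \<Rightarrow> real) \<Rightarrow> real \<Rightarrow> real \<Rightarrow> spacetime \<Rightarrow> real" where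
  "wt \<phi> s b \<zeta> = japanese (fst \<zeta>) powr s * japanese (snd \<zeta> + \<phi> (fst \<zeta>)) powr b"

lemma schwartz_X_norm_eq: "schwartz_X_norm \<phi> s b f = wnorm (wt \<phi> s b) f"
  by (simp add: schwartz_X_norm_def wnorm_def wt_def case_prod_unfold)

lemma X_tendsto_eq: "X_tendsto \<phi> s b = wtendsto (wt \<phi> s b)"
  by (intro ext) (simp add: X_tendsto_def wtendsto_def schwartz_X_norm_eq)

lemma X_norm_eq: "X_norm \<phi> s b = wlim_norm (wt \<phi> s b)"
  by (intro ext) (simp add: X_norm_def wlim_norm_def X_tendsto_eq schwartz_X_norm_eq)

text \<open>Expresses bracket powers through the polynomial \<open>1 + (norm x)\<^sup>2\<close>, so
  that \<open>slow_powr\<close> applies without differentiating a square root.\<close>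

lemma japanese_powr_eq: "japanese x powr a = (1 + (norm x)\<^sup>2) powr (a / 2)"
proof -
  have "1 + (norm x)\<^sup>2 \<ge> 0" by simp
  then show ?thesis unfolding japanese_def by (simp add: powr_half_sqrt[symmetric] powr_powr)
qed

lemma slow_norm_fst_square: "slow (\<lambda>z::spacetime. complex_of_real ((norm (fst z))\<^sup>2))"
proof -
  have "(norm (fst z))\<^sup>2 = (\<Sum>i\<in>Basis. (z \<bullet> (i, 0)) * (z \<bullet> (i, 0)))" for z :: spacetime
    by (subst norm_square_sum) (simp add: inner_prod_def power2_eq_square)
  then have "(\<lambda>z::spacetime. complex_of_real ((norm (fst z))\<^sup>2))
      = (\<lambda>z. \<Sum>i\<in>Basis. complex_of_real (z \<bullet> (i, 0)) * complex_of_real (z \<bullet> (i, 0)))"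
    by (simp only: of_real_sum of_real_mult)
  then show ?thesis by (simp only:) (intro slow_sum slow_mult slow_inner)
qed

lemma slow_japanese_fst_powr: "slow (\<lambda>z::spacetime. complex_of_real (japanese (fst z) powr a))"
proof -
  have "slow (\<lambda>z::spacetime. complex_of_real (1 + (norm (fst z))\<^sup>2))"
    using slow_add[OF slow_const[of 1] slow_norm_fst_square] by simp
  then show ?thesis unfolding japanese_powr_eq by (rule slow_powr) simp
qed

lemma slow_wt:
  assumes "slow (\<lambda>z::spacetime. complex_of_real (\<phi> (fst z)))"
  shows "slow (\<lambda>z. complex_of_real (wt \<phi> s b z))"
proof -
  have "slow (\<lambda>z::spacetime. complex_of_real (z \<bullet> (0, 1)))" by (rule slow_inner)
  then have r: "slow (\<lambda>z::spacetime. complex_of_real (snd z + \<phi> (fst z)))"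
    using slow_add[OF _ assms] by (fastforce simp: inner_prod_def)
  have "slow (\<lambda>z::spacetime. complex_of_real (1 + (norm (snd z + \<phi> (fst z)))\<^sup>2))"
    using slow_add[OF slow_const[of 1] slow_mult[OF r r]] by (simp add: power2_eq_square)
  then have "slow (\<lambda>z::spacetime. complex_of_real (japanese (snd z + \<phi> (fst z)) powr b))"
    unfolding japanese_powr_eq by (rule slow_powr) simp
  from slow_mult[OF slow_japanese_fst_powr this] show ?thesis by (simp add: wt_def)
qed

text \<open>The inverse of such a weight is the weight of the same shape with both exponents
  negated, so one slowness statement covers both requirements.\<close>

lemma weight_wt:
  assumes "slow (\<lambda>z::spacetime. complex_of_real (\<phi> (fst z)))"
  shows "weight (wt \<phi> s b)"
proof -
  have "wt \<phi> s b z > 0" for z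
    unfolding wt_def by (intro mult_pos_pos) auto
  moreover have "1 / wt \<phi> s b z = wt \<phi> (- s) (- b) z" for z
    by (simp add: wt_def powr_minus divide_simps)
  ultimately show ?thesis unfolding weight_def using slow_wt[OF assms] by simp
qed

lemma weight_S: "weight (wt phase_S s b)"
  by (rule weight_wt) (simp only: phase_S_def slow_norm_fst_square)

lemma weight_KG: "weight (wt (phase_KG pm) s b)"
proof (rule weight_wt)
  have "slow (\<lambda>z::spacetime. complex_of_real pm * complex_of_real (japanese (fst z) powr 1))"
    by (intro slow_mult slow_const slow_japanese_fst_powr)
  moreover have "japanese x powr 1 = japanese x" for x :: "real^3" using japanese_pos[of x] by simp
  ultimately show "slow (\<lambda>z::spacetime. complex_of_real (phase_KG pm (fst z)))"
    by (simp add: phase_KG_def)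
qed

lemma conj_if_diff: "conj_if c (\<lambda>z. f z - g z) z = conj_if c f z - conj_if c g z"
  by (simp add: conj_if_def)

lemma schwartz_conj_if: "schwartz f \<Longrightarrow> schwartz (conj_if c f)"
  by (auto simp: conj_if_def intro: schwartz_cnj)

text \<open>Conjugation conjugates and reflects the transform. The reflection is moved to the weight
  by a change of variables, so the reflected weight on the conjugate function measures the norm of
  the original function.\<close>

lemma nn_integral_fourier_conj_if:
  assumes m: "weight m" and F: "schwartz F" and m': "\<And>\<eta>. m' \<eta> = m (if a then - \<eta> else \<eta>)"
  shows "(\<integral>\<^sup>+\<eta>. (ennreal (m' \<eta>) * ennreal (cmod (fourier (conj_if a F) \<eta>)))\<^sup>2 \<partial>lborel)
      = ennreal ((wnorm m F)\<^sup>2)"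
proof -
  have [measurable]: "m \<in> borel_measurable borel" "F \<in> borel_measurable borel"
    using weight_measurable[OF m] schwartz_measurable[OF F] by auto
  let ?h = "\<lambda>\<eta>. ennreal ((m \<eta> * cmod (fourier F \<eta>))\<^sup>2)"
  have "(ennreal (m' \<eta>) * ennreal (cmod (fourier (conj_if a F) \<eta>)))\<^sup>2 = ?h (if a then - \<eta> else \<eta>)" for \<eta>
    using less_imp_le[OF weight_pos[OF m]]
    by (simp add: m' conj_if_def fourier_cnj ennreal_mult[symmetric] ennreal_power)
  then have "(\<integral>\<^sup>+\<eta>. (ennreal (m' \<eta>) * ennreal (cmod (fourier (conj_if a F) \<eta>)))\<^sup>2 \<partial>lborel)
      = (\<integral>\<^sup>+\<eta>. ?h (if a then - \<eta> else \<eta>) \<partial>lborel)"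
    by simp
  also have "\<dots> = (\<integral>\<^sup>+\<eta>. ?h \<eta> \<partial>lborel)"
    using nn_integral_lborel_affine[of ?h "-1" 0] by (cases a) simp_all
  also have "\<dots> = ennreal (LINT \<eta>|lborel. (m \<eta> * cmod (fourier F \<eta>))\<^sup>2)"
    by (rule nn_integral_eq_integral[OF weight_integrable[OF m F]]) simp
  finally show ?thesis by (simp add: wnorm_square)
qed

lemma fourier_mult_bound:
  fixes f g :: "'a::euclidean_space \<Rightarrow> complex"
  assumes f: "schwartz f" and g: "schwartz g"
  shows "ennreal (cmod (fourier (\<lambda>z. f z * g z) \<zeta>))
    \<le> ennreal (inverse ((2 * pi) ^ DIM('a))) * (\<integral>\<^sup>+\<eta>. ennreal (cmod (fourier f \<eta>))
        * ennreal (cmod (fourier g (\<zeta> - \<eta>))) \<partial>lborel)"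
proof -
  let ?h = "\<lambda>\<eta>. fourier f \<eta> * fourier g (\<zeta> - \<eta>)"
  \<comment> \<open>For a non-integrable integrand the \<open>LINT\<close> has the default value 0
    and the bound is trivial, so integrability need not be established here.\<close>
  have "ennreal (cmod (LINT \<eta>|lborel. ?h \<eta>)) \<le> (\<integral>\<^sup>+\<eta>. ennreal (cmod (?h \<eta>)) \<partial>lborel)"
    by (cases "integrable lborel ?h") (auto intro: integral_norm_bound_ennreal simp:
        not_integrable_integral_eq)
  then have "ennreal (inverse ((2 * pi) ^ DIM('a))) * ennreal (cmod (LINT \<eta>|lborel. ?h \<eta>))
     \<le> ennreal (inverse ((2 * pi) ^ DIM('a))) * (\<integral>\<^sup>+\<eta>. ennreal (cmod (?h \<eta>)) \<partial>lborel)"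
    by (rule mult_left_mono) simp
  moreover have "cmod (fourier (\<lambda>z. f z * g z) \<zeta>) = inverse ((2 * pi) ^ DIM('a)) * cmod (LINT \<eta>|lborel. ?h \<eta>)"
    unfolding fourier_mult[OF f g] norm_mult norm_of_real
        by (simp only: abs_of_nonneg inverse_nonnegative_iff_nonnegative zero_le_power pi_ge_zero
        mult_nonneg_nonneg zero_le_numeral)
  ultimately show ?thesis by (simp add: ennreal_mult norm_mult)
qed

lemma product_estimate:
  fixes s \<sigma> \<epsilon> pm :: real and a d :: bool
  assumes s: "0 \<le> s" and \<sigma>: "0 \<le> \<sigma>" "\<sigma> < 1/2" and pm: "pm = 1 \<or> pm = -1" and \<epsilon>: "0 < \<epsilon>"
  obtains c where "0 \<le> c"
    "\<And>F G. schwartz F \<Longrightarrow> schwartz G \<Longrightarrow>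
      wnorm (wt phase_S s (- (1/2) - \<epsilon>)) (\<lambda>z. conj_if a F z * conj_if d G z)
      \<le> c * (wnorm (wt phase_S 0 (1/2 + \<epsilon>)) F * wnorm (wt (phase_KG pm) (s - 1/2) (1/2 + \<epsilon>)) G
           + wnorm (wt phase_S (s - \<sigma>) 0) F * wnorm (wt (phase_KG pm) (\<sigma> + 1/2 + \<epsilon>) (1/2 + \<epsilon>)) G)"
proof -
  define b where "b = 1/2 + \<epsilon>"
  have b: "b > 1/2" using \<epsilon> by (simp add: b_def)
  \<comment> \<open>Reflecting both variables changes \<open>\<tau> + \<phi> \<xi>\<close> into
    \<open>- (\<tau> - \<phi> \<xi>)\<close> for the even phases used here. As the bracket is even,
    a conjugate amounts to the opposite sign of the phase.\<close>
  define \<alpha> where "\<alpha> = (if a then -1 else 1 :: real)"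
  define \<beta> where "\<beta> = (if d then - pm else pm)"
  have \<alpha>: "\<alpha> = 1 \<or> \<alpha> = -1" and \<beta>: "\<bar>\<beta>\<bar> \<le> 1" using pm by (auto simp: \<alpha>_def \<beta>_def)
  define K where "K = (ennreal (inverse ((2 * pi) ^ DIM(spacetime))))\<^sup>2 * ((ennreal (9 powr s * 12 powr b
      * 4 powr \<sigma> * 3))\<^sup>2 * (192 * kernel_const b \<sigma>))"
  have "K < \<top>"
    unfolding K_def using kernel_const_finite[OF b \<sigma> \<alpha> \<beta>]
        by (auto simp: ennreal_mult_less_top power2_eq_square)
  then obtain k where k: "0 \<le> k" "K = ennreal k" by (cases K) auto
  show ?thesis
  proof (rule that[of "sqrt k"])
    show "0 \<le> sqrt k" using k by simp
    fix F G :: "spacetime \<Rightarrow> complex" assume F: "schwartz F" and G: "schwartz G"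
    let ?m = "wt phase_S s (- (1/2) - \<epsilon>)"
    let ?X1 = "wnorm (wt phase_S 0 (1/2 + \<epsilon>)) F" and ?Y1 = "wnorm (wt (phase_KG pm) (s - 1/2) (1/2 + \<epsilon>)) G"
    let ?X2 = "wnorm (wt phase_S (s - \<sigma>) 0) F" and ?Y2 = "wnorm (wt (phase_KG pm) (\<sigma> + 1/2 + \<epsilon>) (1/2 + \<epsilon>)) G"
    let ?P = "\<lambda>z. conj_if a F z * conj_if d G z"
    let ?f = "\<lambda>\<eta>. ennreal (cmod (fourier (conj_if a F) \<eta>))" and ?g =
        "\<lambda>\<eta>. ennreal (cmod (fourier (conj_if d G) \<eta>))"
    have Fa: "schwartz (conj_if a F)" and Gd: "schwartz (conj_if d G)" using F G
        by (auto intro: schwartz_conj_if)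
    have [measurable]: "fourier (conj_if a F) \<in> borel_measurable borel"
        "fourier (conj_if d G) \<in> borel_measurable borel"
      by (intro schwartz_measurable schwartz_fourier Fa Gd)+
    have P: "schwartz ?P" by (intro schwartz_mult Fa Gd)
    have S_eq: "modS \<alpha> \<eta> = modS 1 (if a then - \<eta> else \<eta>)" for \<eta> :: spacetime
      using japanese_minus[of "snd \<eta> - (norm (fst \<eta>))\<^sup>2"] by (simp add: \<alpha>_def)
    have W_eq: "modW \<beta> \<eta> = modW pm (if d then - \<eta> else \<eta>)" for \<eta> :: spacetime
      using japanese_minus[of "snd \<eta> - pm * japanese (fst \<eta>)"] by (simp add: \<beta>_def)
    have X1: "(\<integral>\<^sup>+\<eta>. (ennreal (modS \<alpha> \<eta> powr b) * ?f \<eta>)\<^sup>2 \<partial>lborel) = ennreal (?X1\<^sup>2)"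
      by (rule nn_integral_fourier_conj_if[OF weight_S F]) (simp add: S_eq wt_def phase_S_def b_def)
    have X2: "(\<integral>\<^sup>+\<eta>. (ennreal (japanese (fst \<eta>) powr (s - \<sigma>)) * ?f \<eta>)\<^sup>2 \<partial>lborel) = ennreal (?X2\<^sup>2)"
      by (rule nn_integral_fourier_conj_if[OF weight_S F]) (simp add: wt_def)
    have Y1: "(\<integral>\<^sup>+\<eta>. (ennreal (japanese (fst \<eta>) powr (s - 1/2) * modW \<beta> \<eta> powr b) * ?g \<eta>)\<^sup>2 \<partial>lborel)
        = ennreal (?Y1\<^sup>2)"
      by (rule nn_integral_fourier_conj_if[OF weight_KG G]) (simp add: W_eq wt_def phase_KG_def b_def)
    have Y2: "(\<integral>\<^sup>+\<eta>. (ennreal (japanese (fst \<eta>) powr (\<sigma> + 1/2 + \<epsilon>) * modW \<beta> \<eta> powr b) * ?g \<eta>)\<^sup>2 \<partial>lborel)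
        = ennreal (?Y2\<^sup>2)"
      by (rule nn_integral_fourier_conj_if[OF weight_KG G]) (simp add: W_eq wt_def phase_KG_def b_def)
    let ?pi = "ennreal (inverse ((2 * pi) ^ DIM(spacetime)))"
    let ?T = "\<lambda>\<zeta>. ennreal (japanese (fst \<zeta>) powr s * modS 1 \<zeta> powr (- b)) * (\<integral>\<^sup>+\<eta>. ?f \<eta> * ?g (\<zeta> - \<eta>) \<partial>lborel)"
    have m_eq: "?m \<zeta> = japanese (fst \<zeta>) powr s * modS 1 \<zeta> powr (- b)" for \<zeta>
      by (simp add: wt_def phase_S_def b_def)
    have "ennreal ((wnorm ?m ?P)\<^sup>2) = (\<integral>\<^sup>+\<zeta>. (ennreal (?m \<zeta>)
        * ennreal (cmod (fourier (conj_if False ?P) \<zeta>)))\<^sup>2 \<partial>lborel)"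
      by (rule nn_integral_fourier_conj_if[OF weight_S P, symmetric]) simp
    also have "\<dots> \<le> (\<integral>\<^sup>+\<zeta>. ?pi\<^sup>2 * (?T \<zeta>)\<^sup>2 \<partial>lborel)"
    proof (rule nn_integral_mono)
      fix \<zeta>
      have "ennreal (?m \<zeta>) * ennreal (cmod (fourier ?P \<zeta>)) \<le> ennreal (?m \<zeta>) * (?pi * (\<integral>\<^sup>+\<eta>. ?f \<eta>
          * ?g (\<zeta> - \<eta>) \<partial>lborel))"
        by (intro mult_left_mono fourier_mult_bound Fa Gd) simp
      also have "\<dots> = ?pi * ?T \<zeta>" unfolding m_eq by (simp only: mult_ac)
      finally have "(ennreal (?m \<zeta>) * ennreal (cmod (fourier ?P \<zeta>)))\<^sup>2 \<le> (?pi * ?T \<zeta>)\<^sup>2"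
          by (rule power_mono) simp
      then show "(ennreal (?m \<zeta>) * ennreal (cmod (fourier (conj_if False ?P) \<zeta>)))\<^sup>2 \<le> ?pi\<^sup>2 * (?T \<zeta>)\<^sup>2"
        by (simp only: power_mult_distrib conj_if_def if_False)
    qed
    also have "\<dots> = ?pi\<^sup>2 * (\<integral>\<^sup>+\<zeta>. (?T \<zeta>)\<^sup>2 \<partial>lborel)" by (rule nn_integral_cmult) measurable
    also have "\<dots> \<le> ?pi\<^sup>2 * ((ennreal (9 powr s * 12 powr b * 4 powr \<sigma> * 3))\<^sup>2 * (192 * kernel_const b \<sigma>)
        * (ennreal (?X1\<^sup>2) * ennreal (?Y1\<^sup>2) + ennreal (?X2\<^sup>2) * ennreal (?Y2\<^sup>2)))"
      unfolding X1[symmetric] X2[symmetric] Y1[symmetric] Y2[symmetric]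
      using \<epsilon> by (intro mult_left_mono bilinear_kernel_estimate b \<sigma> \<alpha> \<beta> s) auto
    also have "\<dots> = K * (ennreal (?X1\<^sup>2) * ennreal (?Y1\<^sup>2) + ennreal (?X2\<^sup>2) * ennreal (?Y2\<^sup>2))"
      unfolding K_def by (simp only: mult.assoc)
    also have "\<dots> = ennreal (k * (?X1\<^sup>2 * ?Y1\<^sup>2 + ?X2\<^sup>2 * ?Y2\<^sup>2))"
      using k by (simp add: ennreal_mult)
    finally have "(wnorm ?m ?P)\<^sup>2 \<le> k * (?X1\<^sup>2 * ?Y1\<^sup>2 + ?X2\<^sup>2 * ?Y2\<^sup>2)"
      using k by (subst (asm) ennreal_le_iff) auto
    also have "\<dots> \<le> k * (?X1 * ?Y1 + ?X2 * ?Y2)\<^sup>2"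
    proof (intro mult_left_mono k)
      \<comment> \<open>The mixed term is nonnegative, so a sum of squares is at most the square of
        the sum and the root can be taken.\<close>
      have "0 \<le> 2 * (?X1 * ?Y1) * (?X2 * ?Y2)" by simp
      then show "?X1\<^sup>2 * ?Y1\<^sup>2 + ?X2\<^sup>2 * ?Y2\<^sup>2 \<le> (?X1 * ?Y1 + ?X2 * ?Y2)\<^sup>2"
        by (simp only: power2_sum power_mult_distrib)
    qed
    also have "\<dots> = (sqrt k * (?X1 * ?Y1 + ?X2 * ?Y2))\<^sup>2"
        unfolding power_mult_distrib real_sqrt_pow2[OF k(1)] ..
    finally show "wnorm ?m ?P \<le> sqrt k * (?X1 * ?Y1 + ?X2 * ?Y2)"
      by (rule power2_le_imp_le) (intro mult_nonneg_nonneg add_nonneg_nonneg wnorm_nonneg real_sqrt_ge_zero k)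
  qed
qed

section \<open>Extension of the product from Schwartz functions to the spaces\<close>

context
  fixes m1 m2 n1 n2 m :: "spacetime \<Rightarrow> real" and a d :: bool and c :: real
  assumes m1: "weight m1" and m2: "weight m2" and n1: "weight n1" and n2: "weight n2" and m: "weight m"
    and c: "0 \<le> c"
    and est: "\<And>F G. schwartz F \<Longrightarrow> schwartz G \<Longrightarrow>
      wnorm m (\<lambda>z. conj_if a F z * conj_if d G z) \<le> c * (wnorm m1 F * wnorm n1 G + wnorm m2 F * wnorm n2 G)"
begin

text \<open>One statement for two purposes: with both pairs of sequences equal it is the Cauchy
  property of the products, with different pairs it is independence of the approximation.\<close>

lemma product_close:
  assumes F: "wtendsto m1 F u" "wtendsto m2 F u" and G: "wtendsto n1 G v" "wtendsto n2 G v"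
    and F': "wtendsto m1 F' u" "wtendsto m2 F' u" and G': "wtendsto n1 G' v" "wtendsto n2 G' v"
    and e: "e > 0"
  shows "\<exists>N. \<forall>j\<ge>N. \<forall>k\<ge>N. wnorm m (\<lambda>z. conj_if a (F j) z * conj_if d (G j) z - conj_if a (F' k) z
      * conj_if d (G' k) z) < e"
proof -
  have bdd: "\<exists>D\<ge>0. \<forall>k. wnorm w (h k) \<le> D" if "weight w" "wtendsto w h x" for w :: "spacetime \<Rightarrow> real" and h x
  proof -
    have "Bseq (\<lambda>k. wnorm w (h k))" using wnorm_tendsto[OF that] convergentI convergent_imp_Bseq by blast
    then obtain D where "D > 0" "\<And>k. norm (wnorm w (h k)) \<le> D" by (auto elim: BseqE)
    then show ?thesis by (auto intro!: exI[of _ D])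
  qed
  obtain D1 D2 D3 D4 where D: "D1 \<ge> 0" "D2 \<ge> 0" "D3 \<ge> 0" "D4 \<ge> 0"
      "\<And>k. wnorm m1 (F' k) \<le> D1" "\<And>k. wnorm m2 (F' k) \<le> D2" "\<And>k. wnorm n1 (G k) \<le> D3" "\<And>k. wnorm n2 (G k)
          \<le> D4"
    using bdd[OF m1 F'(1)] bdd[OF m2 F'(2)] bdd[OF n1 G(1)] bdd[OF n2 G(2)] by blast
  \<comment> \<open>The summand 1 makes \<open>E\<close> positive and the final inequality strict,
    even if all bounds vanish.\<close>
  define E where "E = c * (D1 + D2 + D3 + D4) + 1"
  have E: "E > 0" using c D by (simp add: E_def add_nonneg_pos)
  define \<delta> where "\<delta> = e / E"
  have \<delta>: "\<delta> > 0" using e E by (simp add: \<delta>_def)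
  obtain N1 where N1: "\<And>j k. j \<ge> N1 \<Longrightarrow> k \<ge> N1 \<Longrightarrow> wnorm m1 (\<lambda>z. F j z - F' k z) < \<delta>"
    using wtendsto_close[OF m1 F(1) F'(1) \<delta>] by blast
  obtain N2 where N2: "\<And>j k. j \<ge> N2 \<Longrightarrow> k \<ge> N2 \<Longrightarrow> wnorm m2 (\<lambda>z. F j z - F' k z) < \<delta>"
    using wtendsto_close[OF m2 F(2) F'(2) \<delta>] by blast
  obtain N3 where N3: "\<And>j k. j \<ge> N3 \<Longrightarrow> k \<ge> N3 \<Longrightarrow> wnorm n1 (\<lambda>z. G j z - G' k z) < \<delta>"
    using wtendsto_close[OF n1 G(1) G'(1) \<delta>] by blast
  obtain N4 where N4: "\<And>j k. j \<ge> N4 \<Longrightarrow> k \<ge> N4 \<Longrightarrow> wnorm n2 (\<lambda>z. G j z - G' k z) < \<delta>"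
    using wtendsto_close[OF n2 G(2) G'(2) \<delta>] by blast
  note S = wtendsto_schwartz[OF F(1)] wtendsto_schwartz[OF G(1)] wtendsto_schwartz[OF F'(1)]
      wtendsto_schwartz[OF G'(1)]
  show ?thesis
  proof (intro exI allI impI)
    fix j k assume jk: "j \<ge> max (max N1 N2) (max N3 N4)" "k \<ge> max (max N1 N2) (max N3 N4)"
    let ?F = "\<lambda>z. F j z - F' k z" and ?G = "\<lambda>z. G j z - G' k z"
    have SFG: "schwartz ?F" "schwartz ?G" by (intro schwartz_diff S)+
    \<comment> \<open>The usual bilinear splitting: one factor is replaced at a time, and
      conjugation respects differences.\<close>
    have "(\<lambda>z. conj_if a (F j) z * conj_if d (G j) z - conj_if a (F' k) z * conj_if d (G' k) z)
      = (\<lambda>z. conj_if a ?F z * conj_if d (G j) z + conj_if a (F' k) z * conj_if d ?G z)"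
      by (simp add: conj_if_diff algebra_simps)
    then have "wnorm m (\<lambda>z. conj_if a (F j) z * conj_if d (G j) z - conj_if a (F' k) z * conj_if d (G' k) z)
      \<le> wnorm m (\<lambda>z. conj_if a ?F z * conj_if d (G j) z) + wnorm m (\<lambda>z. conj_if a (F' k) z * conj_if d ?G z)"
      using wnorm_add[OF m schwartz_mult schwartz_mult] S SFG by (simp add: schwartz_conj_if)
    also have "\<dots> \<le> c * (wnorm m1 ?F * wnorm n1 (G j) + wnorm m2 ?F * wnorm n2 (G j))
        + c * (wnorm m1 (F' k) * wnorm n1 ?G + wnorm m2 (F' k) * wnorm n2 ?G)"
      by (intro add_mono est S SFG)
    also have "\<dots> \<le> c * (\<delta> * D3 + \<delta> * D4) + c * (D1 * \<delta> + D2 * \<delta>)"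
      using c D \<delta> N1[of j k] N2[of j k] N3[of j k] N4[of j k] jk
      by (intro add_mono mult_left_mono mult_mono) (auto intro: less_imp_le)
    also have "\<dots> = c * (D1 + D2 + D3 + D4) * \<delta>" by (simp add: algebra_simps)
    also have "\<dots> < E * \<delta>" using \<delta> by (intro mult_strict_right_mono) (auto simp: E_def)
    also have "\<dots> = e" using E by (simp add: \<delta>_def)
    finally show "wnorm m (\<lambda>z. conj_if a (F j) z * conj_if d (G j) z - conj_if a (F' k) z
        * conj_if d (G' k) z) < e" .
  qed
qed

text \<open>The sequences for the two spaces of each factor are given separately. They are merged
  first, because \<open>est\<close> needs both norms of one approximant; the inequality then passes
  to the limit along the merged sequences.\<close>

lemma product_limit:
  assumes u: "wtendsto m1 F1 u" "wtendsto m2 F2 u" and v: "wtendsto n1 G1 v" "wtendsto n2 G2 v"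
  obtains F0 G0 w where "wtendsto m1 F0 u" "wtendsto m2 F0 u" "wtendsto n1 G0 v" "wtendsto n2 G0 v"
    "\<And>F G. wtendsto m1 F u \<Longrightarrow> wtendsto m2 F u \<Longrightarrow> wtendsto n1 G v \<Longrightarrow> wtendsto n2 G v \<Longrightarrow>
       wtendsto m (\<lambda>k z. conj_if a (F k) z * conj_if d (G k) z) w"
    "wlim_norm m w \<le> c * (wlim_norm m1 u * wlim_norm n1 v + wlim_norm m2 u * wlim_norm n2 v)"
proof -
  obtain F0 where F0: "wtendsto m1 F0 u" "wtendsto m2 F0 u" using wtendsto_common[OF m1 m2 u] by blast
  obtain G0 where G0: "wtendsto n1 G0 v" "wtendsto n2 G0 v" using wtendsto_common[OF n1 n2 v] by blast
  let ?P = "\<lambda>F G (k::nat) z. conj_if a (F k) z * conj_if d (G k) z"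
  have SP: "schwartz (?P F G k)" if "wtendsto m1 F u" "wtendsto n1 G v" for F G k
    using wtendsto_schwartz[OF that(1)] wtendsto_schwartz[OF that(2)]
        by (intro schwartz_mult schwartz_conj_if)
  obtain w where w: "wtendsto m (?P F0 G0) w"
    using Cauchy_wtendsto[OF m, of "?P F0 G0"] SP[OF F0(1) G0(1)] product_close[OF F0 G0 F0 G0] by blast
  have lim: "wtendsto m (?P F G) w" if "wtendsto m1 F u" "wtendsto m2 F u" "wtendsto n1 G v"
      "wtendsto n2 G v" for F G
    using wtendsto_perturb[OF m w, of "?P F G"] SP[OF that(1,3)] product_close[OF that F0 G0] by blast
  have "wlim_norm m w \<le> c * (wlim_norm m1 u * wlim_norm n1 v + wlim_norm m2 u * wlim_norm n2 v)"
  proof (rule LIMSEQ_le)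
    show "(\<lambda>k. wnorm m (?P F0 G0 k)) \<longlonglongrightarrow> wlim_norm m w" by (rule wnorm_tendsto[OF m w])
    show "(\<lambda>k. c * (wnorm m1 (F0 k) * wnorm n1 (G0 k) + wnorm m2 (F0 k) * wnorm n2 (G0 k)))
      \<longlonglongrightarrow> c * (wlim_norm m1 u * wlim_norm n1 v + wlim_norm m2 u * wlim_norm n2 v)"
      by (intro tendsto_intros wnorm_tendsto m1 m2 n1 n2 F0 G0)
    show "\<exists>N. \<forall>k\<ge>N. wnorm m (?P F0 G0 k) \<le> c * (wnorm m1 (F0 k) * wnorm n1 (G0 k) + wnorm m2 (F0 k)
        * wnorm n2 (G0 k))"
      using est wtendsto_schwartz[OF F0(1)] wtendsto_schwartz[OF G0(1)] by blast
  qed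
  then show ?thesis using that F0 G0 lim by blast
qed

end

theorem lemma1p5:
  fixes s \<sigma> \<epsilon> pm :: real and lu ln ru rn :: bool
  assumes "s \<ge> 0" and "0 \<le> \<sigma>" and "\<sigma> < 1/2"
    and "pm = 1 \<or> pm = -1" and "\<epsilon> > 0"
  shows "\<exists>c::real. \<forall>u n.
    dconj_if ru u \<in> X_space phase_S 0 (1/2 + \<epsilon>) \<inter> X_space phase_S (s - \<sigma>) 0 \<and>
    dconj_if rn n \<in> X_space (phase_KG pm) (s - 1/2) (1/2 + \<epsilon>)
                     \<inter> X_space (phase_KG pm) (\<sigma> + 1/2 + \<epsilon>) (1/2 + \<epsilon>) \<longrightarrow>
    (\<exists>w. extended_product
           {f. X_tendsto phase_S 0 (1/2 + \<epsilon>) (\<lambda>k. conj_if ru (f k)) (dconj_if ru u) \<and>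
               X_tendsto phase_S (s - \<sigma>) 0 (\<lambda>k. conj_if ru (f k)) (dconj_if ru u)}
           {g. X_tendsto (phase_KG pm) (s - 1/2) (1/2 + \<epsilon>)
                 (\<lambda>k. conj_if rn (g k)) (dconj_if rn n) \<and>
               X_tendsto (phase_KG pm) (\<sigma> + 1/2 + \<epsilon>) (1/2 + \<epsilon>)
                 (\<lambda>k. conj_if rn (g k)) (dconj_if rn n)}
           (X_tendsto phase_S s (- (1/2) - \<epsilon>)) lu ln w \<and>
         X_norm phase_S s (- (1/2) - \<epsilon>) w
           \<le> c * (X_norm phase_S 0 (1/2 + \<epsilon>) (dconj_if ru u)
                    * X_norm (phase_KG pm) (s - 1/2) (1/2 + \<epsilon>) (dconj_if rn n)
                  + X_norm phase_S (s - \<sigma>) 0 (dconj_if ru u)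
                    * X_norm (phase_KG pm) (\<sigma> + 1/2 + \<epsilon>) (1/2 + \<epsilon>) (dconj_if rn n)))"
proof -
  let ?m = "wt phase_S s (- (1/2) - \<epsilon>)"
  let ?m1 = "wt phase_S 0 (1/2 + \<epsilon>)" and ?m2 = "wt phase_S (s - \<sigma>) 0"
  let ?n1 = "wt (phase_KG pm) (s - 1/2) (1/2 + \<epsilon>)" and ?n2 = "wt (phase_KG pm) (\<sigma> + 1/2 + \<epsilon>) (1/2 + \<epsilon>)"
  \<comment> \<open>The norms on the right are those of \<open>conj_if ru f\<close>, while the
    product contains \<open>conj_if lu f\<close>. Relative to the function that converges, a
    conjugation remains exactly when the two flags differ, and likewise for the second
    factor.\<close>
  obtain c where c: "0 \<le> c" and est: "\<And>F G. schwartz F \<Longrightarrow> schwartz G \<Longrightarrow>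
      wnorm ?m (\<lambda>z. conj_if (lu \<noteq> ru) F z * conj_if (ln \<noteq> rn) G z) \<le> c * (wnorm ?m1 F * wnorm ?n1 G
          + wnorm ?m2 F * wnorm ?n2 G)"
    using product_estimate[OF assms, of "lu \<noteq> ru" "ln \<noteq> rn"] by blast
  show ?thesis
  proof (rule exI[of _ c], intro allI impI)
    fix u n :: distribution
    assume "dconj_if ru u \<in> X_space phase_S 0 (1/2 + \<epsilon>) \<inter> X_space phase_S (s - \<sigma>) 0 \<and>
      dconj_if rn n \<in> X_space (phase_KG pm) (s - 1/2) (1/2 + \<epsilon>) \<inter> X_space (phase_KG pm) (\<sigma> + 1/2 + \<epsilon>) (1/2
          + \<epsilon>)"
    then obtain F1 F2 G1 G2 where FG: "wtendsto ?m1 F1 (dconj_if ru u)" "wtendsto ?m2 F2 (dconj_if ru u)"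
        "wtendsto ?n1 G1 (dconj_if rn n)" "wtendsto ?n2 G2 (dconj_if rn n)"
      unfolding X_space_def X_tendsto_eq by blast
    obtain F0 G0 w where F0: "wtendsto ?m1 F0 (dconj_if ru u)" "wtendsto ?m2 F0 (dconj_if ru u)"
        and G0: "wtendsto ?n1 G0 (dconj_if rn n)" "wtendsto ?n2 G0 (dconj_if rn n)"
        and lim: "\<And>F G. wtendsto ?m1 F (dconj_if ru u) \<Longrightarrow> wtendsto ?m2 F (dconj_if ru u) \<Longrightarrow>
             wtendsto ?n1 G (dconj_if rn n) \<Longrightarrow> wtendsto ?n2 G (dconj_if rn n) \<Longrightarrow>
             wtendsto ?m (\<lambda>k z. conj_if (lu \<noteq> ru) (F k) z * conj_if (ln \<noteq> rn) (G k) z) w"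
        and norm: "wlim_norm ?m w \<le> c * (wlim_norm ?m1 (dconj_if ru u) * wlim_norm ?n1 (dconj_if rn n)
             + wlim_norm ?m2 (dconj_if ru u) * wlim_norm ?n2 (dconj_if rn n))"
      by (rule product_limit[OF weight_S weight_S weight_KG weight_KG weight_S c _ FG])
        (rule est, assumption, assumption, rule that, assumption+)
    have twice: "conj_if r (conj_if r f) = f" for r f by (simp add: conj_if_def)
    \<comment> \<open>Two conjugations cancel, which turns the product of the converging sequences
      with relative flags into the product of the original sequences.\<close>
    have swap: "conj_if (l \<noteq> r) (conj_if r f) = conj_if l f" for l r f by (auto simp: conj_if_def)
    let ?U = "{f. wtendsto ?m1 (\<lambda>k. conj_if ru (f k)) (dconj_if ru u) \<and> wtendsto ?m2 (\<lambda>k. conj_if ru (f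
        k)) (dconj_if ru u)}"
    let ?V = "{g. wtendsto ?n1 (\<lambda>k. conj_if rn (g k)) (dconj_if rn n) \<and> wtendsto ?n2 (\<lambda>k. conj_if rn (g
        k)) (dconj_if rn n)}"
    have mem: "(\<lambda>k. conj_if ru (F0 k)) \<in> ?U" "(\<lambda>k. conj_if rn (G0 k)) \<in> ?V" using F0 G0
        by (simp_all add: twice)
    have nonempty: "A \<noteq> {}" if "x \<in> A" for x and A :: "(nat \<Rightarrow> spacetime \<Rightarrow> complex) set" using that by blast
    have conv: "wtendsto ?m (\<lambda>k z. conj_if lu (f k) z * conj_if ln (g k) z) w" if "f \<in> ?U" "g \<in> ?V" for f g
      using lim[of "\<lambda>k. conj_if ru (f k)" "\<lambda>k. conj_if rn (g k)"] that unfolding swap by blast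
    have "extended_product ?U ?V (wtendsto ?m) lu ln w"
      unfolding extended_product_def by (intro conjI ballI nonempty[OF mem(1)] nonempty[OF mem(2)] conv)
    then show "\<exists>w. extended_product
           {f. X_tendsto phase_S 0 (1/2 + \<epsilon>) (\<lambda>k. conj_if ru (f k)) (dconj_if ru u) \<and>
               X_tendsto phase_S (s - \<sigma>) 0 (\<lambda>k. conj_if ru (f k)) (dconj_if ru u)}
           {g. X_tendsto (phase_KG pm) (s - 1/2) (1/2 + \<epsilon>)
                 (\<lambda>k. conj_if rn (g k)) (dconj_if rn n) \<and>
               X_tendsto (phase_KG pm) (\<sigma> + 1/2 + \<epsilon>) (1/2 + \<epsilon>)
                 (\<lambda>k. conj_if rn (g k)) (dconj_if rn n)}
           (X_tendsto phase_S s (- (1/2) - \<epsilon>)) lu ln w \<and>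
         X_norm phase_S s (- (1/2) - \<epsilon>) w
           \<le> c * (X_norm phase_S 0 (1/2 + \<epsilon>) (dconj_if ru u)
                    * X_norm (phase_KG pm) (s - 1/2) (1/2 + \<epsilon>) (dconj_if rn n)
                  + X_norm phase_S (s - \<sigma>) 0 (dconj_if ru u)
                    * X_norm (phase_KG pm) (\<sigma> + 1/2 + \<epsilon>) (1/2 + \<epsilon>) (dconj_if rn n))"
      unfolding X_tendsto_eq X_norm_eq using norm by blast
  qed
qed

end
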